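(* Let $t_0\in\mathbb{R}$, $a>0$, $J=[t_0,t_0+a]$, let $g:J\to\mathbb{R}$ be nondecreasing and left-continuous, let $x_0\in\mathbb{R}^n$, and let $f,h:J\times\mathbb{R}^n\to\mathbb{R}^n$ be functions satisfying: (A0) For every $t\in J$, the function $f(t,\cdot)$ is continuous. (A1) For every $u\in\mathbb{R}^n$, the function $f(\cdot,u)$ is Kurzweil--Stieltjes integrable with respect to $g$ on $J$. (A2* ) There exists a function $M:J\times[0,\infty)\to[0,\infty)$ such that $M(\cdot,\alpha)$ is Kurzweil--Stieltjes integrable with respect to $g$ on $J$ for all $\alpha\ge0$, the function $M(s,\cdot)$ is nondecreasing for all $s\in J$, and $\left\|\int_c^d f(s,u)\,\mathrm{d}g(s)\right\|\le\int_c^d M(s,\|u\|)\,\mathrm{d}g(s)$ for all $u\in\mathbb{R}^n$ and all $[c,d]\subseteq J$. (A3* ) For every $v\in\mathbb{R}^n$, the function $h(\cdot,v)$ is regulated on $J$, and there exists a function $\varphi:[0,\infty)\times[0,\infty)\to[0,\infty)$ such that for every $r\ge0$, $\varphi(\cdot,r)$ is a $\mathfrak{D}$-function satisfying $\varphi(t,r)<t$ for all $t>0$, and $\|h(t,u)-h(t,v)\|\le\varphi(\|u-v\|,r)$ for all $u,v\in\mathbb{R}^n$ with $\|u\|,\|v\|\le r$ and all $t\in J$. Assume further that $$\liminf_{r\to\infty}\left(\frac{\varphi(r,r)}{r}+\frac1r\int_{t_0}^{t_0+a}M(s,r)\,\mathrm{d}g(s)\right)<1 .$$ Then there exists a solution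 $x:J\to\mathbb{R}^n$ of the problem $$x(t)=x_0-h(t_0,x(t_0))+h(t,x(t))+\int_{t_0}^t f(s,x(s))\,\mathrm{d}g(s),\quad t\in J,\qquad x(t_0)=x_0 .$$
   Context: $\mathbb{R}^n$ carries a norm $\|\cdot\|$. A function $x:[a,b]\to X$ ($X$ a Banach space) is regulated if the one-sided limit $x(t^-)$ exists for every $t\in(a,b]$ and $x(t^+)$ exists for every $t\in[a,b)$. Kurzweil--Stieltjes integral: a gauge on $[a,b]$ is a function $\delta:[a,b]\to(0,\infty)$. A tagged partition $a=s_0\le s_1\le\dots\le s_k=b$ with tags $\tau_i\in[s_{i-1},s_i]$ is $\delta$-fine if $[s_{i-1},s_i]\subset(\tau_i-\delta(\tau_i),\tau_i+\delta(\tau_i))$ for all $i$. A function $f:[a,b]\to\mathbb{R}^n$ is Kurzweil--Stieltjes integrable with respect to $g:[a,b]\to\mathbb{R}$ if there is $\mathcal{I}\in\mathbb{R}^n$ such that for every $\varepsilon>0$ there is a gauge $\delta$ on $[a,b]$ with $\left\|\sum_{i=1}^k f(\tau_i)(g(s_i)-g(s_{i-1}))-\mathcal{I}\right\|<\varepsilon$ for all $\delta$-fine tagged partitions of $[a,b]$; then $\int_a^b f\,\mathrm{d}g:=\mathcal{I}$. All integrals are in this sense. A $\mathfrak{D}$-function is a continuous nondecreasing function $\psi:[0,\infty)\to[0,\infty)$ with $\psi(0)=0$ and $\psi(s)>0$ for $s>0$. A solution of the problem is a regulated function $x:J\to\mathbb{R}^n$ such that $t\mapsto h(t,x(t))$ is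 regulated on $J$, the integral equation holds for all $t\in J$ (with the integral existing in the Kurzweil--Stieltjes sense), and $x(t_0)=x_0$. *)

theory Defs
  imports "HOL-Analysis.Analysis"
begin

text \<open>
  \<open>\<real>\<^sup>n\<close> is rendered as \<open>real ^ 'n\<close> with an arbitrary norm \<open>N\<close>, which need not be the
  Euclidean \<open>norm\<close> of the type. All norms on \<open>\<real>\<^sup>n\<close> induce the same topology, so continuity and
  one-sided limits are the topological notions of the library. Functions on a compact interval
  are total functions on \<open>real\<close> whose values outside the interval are irrelevant.
\<close>

definition is_norm :: "('a::real_vector \<Rightarrow> real) \<Rightarrow> bool" where
  "is_norm N \<longleftrightarrow>
     (\<forall>x. 0 \<le> N x) \<and>
     (\<forall>x. N x = 0 \<longleftrightarrow> x = 0) \<and>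
     (\<forall>c x. N (c *\<^sub>R x) = \<bar>c\<bar> * N x) \<and>
     (\<forall>x y. N (x + y) \<le> N x + N y)"

definition regulated :: "real \<Rightarrow> real \<Rightarrow> (real \<Rightarrow> 'a::topological_space) \<Rightarrow> bool" where
  "regulated a b x \<longleftrightarrow>
     (\<forall>t\<in>{a<..b}. \<exists>l. (x \<longlongrightarrow> l) (at_left t)) \<and>
     (\<forall>t\<in>{a..<b}. \<exists>l. (x \<longlongrightarrow> l) (at_right t))"

definition left_continuous :: "real \<Rightarrow> real \<Rightarrow> (real \<Rightarrow> real) \<Rightarrow> bool" where
  "left_continuous a b g \<longleftrightarrow> (\<forall>t\<in>{a<..b}. (g \<longlongrightarrow> g t) (at_left t))"

text \<open>
  A tagged partition consists of \<open>k\<close> intervals \<open>[s (i - 1), s i]\<close> with tags \<open>\<tau> i\<close>, where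
  \<open>i \<in> {1..k}\<close>; the other values of \<open>s\<close> and \<open>\<tau>\<close> are irrelevant.
\<close>

definition ks_gauge :: "real \<Rightarrow> real \<Rightarrow> (real \<Rightarrow> real) \<Rightarrow> bool" where
  "ks_gauge a b \<delta> \<longleftrightarrow> (\<forall>t\<in>{a..b}. 0 < \<delta> t)"

definition tagged_partition ::
    "real \<Rightarrow> real \<Rightarrow> nat \<Rightarrow> (nat \<Rightarrow> real) \<Rightarrow> (nat \<Rightarrow> real) \<Rightarrow> bool" where
  "tagged_partition a b k s \<tau> \<longleftrightarrow>
     s 0 = a \<and> s k = b \<and>
     (\<forall>i\<in>{1..k}. s (i - 1) \<le> s i \<and> \<tau> i \<in> {s (i - 1)..s i})"

definition fine_partition ::
    "(real \<Rightarrow> real) \<Rightarrow> nat \<Rightarrow> (nat \<Rightarrow> real) \<Rightarrow> (nat \<Rightarrow> real) \<Rightarrow> bool" where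
  "fine_partition \<delta> k s \<tau> \<longleftrightarrow>
     (\<forall>i\<in>{1..k}. {s (i - 1)..s i} \<subseteq> {\<tau> i - \<delta> (\<tau> i)<..<\<tau> i + \<delta> (\<tau> i)})"

definition has_ks_integral ::
    "('a::real_vector \<Rightarrow> real) \<Rightarrow> (real \<Rightarrow> 'a) \<Rightarrow> (real \<Rightarrow> real) \<Rightarrow> real \<Rightarrow> real \<Rightarrow> 'a \<Rightarrow> bool" where
  "has_ks_integral N f g a b I \<longleftrightarrow>
     (\<forall>\<epsilon>>0. \<exists>\<delta>. ks_gauge a b \<delta> \<and>
        (\<forall>k s \<tau>. tagged_partition a b k s \<tau> \<and> fine_partition \<delta> k s \<tau> \<longrightarrow>
           N ((\<Sum>i=1..k. (g (s i) - g (s (i - 1))) *\<^sub>R f (\<tau> i)) - I) < \<epsilon>))"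

definition ks_integrable ::
    "('a::real_vector \<Rightarrow> real) \<Rightarrow> (real \<Rightarrow> 'a) \<Rightarrow> (real \<Rightarrow> real) \<Rightarrow> real \<Rightarrow> real \<Rightarrow> bool" where
  "ks_integrable N f g a b \<longleftrightarrow> (\<exists>I. has_ks_integral N f g a b I)"

text \<open>
  For \<open>a \<le> b\<close> the value is unique because every gauge admits a fine tagged partition
  (Cousin's lemma).
\<close>

definition ks_integral ::
    "('a::real_vector \<Rightarrow> real) \<Rightarrow> (real \<Rightarrow> 'a) \<Rightarrow> (real \<Rightarrow> real) \<Rightarrow> real \<Rightarrow> real \<Rightarrow> 'a" where
  "ks_integral N f g a b = (THE I. has_ks_integral N f g a b I)"

definition D_function :: "(real \<Rightarrow> real) \<Rightarrow> bool" where
  "D_function \<psi> \<longleftrightarrow>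
     (\<forall>s\<ge>0. 0 \<le> \<psi> s) \<and> continuous_on {0..} \<psi> \<and> mono_on {0..} \<psi> \<and>
     \<psi> 0 = 0 \<and> (\<forall>s>0. 0 < \<psi> s)"

definition is_solution ::
    "(real ^ 'n \<Rightarrow> real) \<Rightarrow> real \<Rightarrow> real \<Rightarrow> (real \<Rightarrow> real) \<Rightarrow> real ^ 'n \<Rightarrow>
     (real \<Rightarrow> real ^ 'n \<Rightarrow> real ^ 'n) \<Rightarrow> (real \<Rightarrow> real ^ 'n \<Rightarrow> real ^ 'n) \<Rightarrow>
     (real \<Rightarrow> real ^ 'n) \<Rightarrow> bool" where
  "is_solution N t0 a g x0 f h x \<longleftrightarrow>
     regulated t0 (t0 + a) x \<and>
     regulated t0 (t0 + a) (\<lambda>t. h t (x t)) \<and>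
     (\<forall>t\<in>{t0..t0 + a}.
        ks_integrable N (\<lambda>s. f s (x s)) g t0 t \<and>
        x t = x0 - h t0 (x t0) + h t (x t) + ks_integral N (\<lambda>s. f s (x s)) g t0 t) \<and>
     x t0 = x0"

end

theory Submission
  imports Defs "HOL-Complex_Analysis.Great_Picard"
begin

text \<open>
  The equation is solved by separating the contraction \<open>h\<close> from the integral. Put
  \<open>y t = x t - h t (x t)\<close> and \<open>c = x0 - h t0 x0\<close>. On a ball of radius \<open>r\<close> the map
  \<open>u \<mapsto> y + h t u\<close> shrinks distances strictly, so \<open>x t\<close> can be recovered from \<open>y t\<close> as its
  fixed point \<open>resolvent N r (h t) (y t)\<close>, which depends continuously on \<open>y t\<close>. The problem
  becomes \<open>y t = c + \<integral> f(s, resolvent (h s) (y s)) dg(s)\<close>, in which nothing but an integral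
  remains. The condition on the lower limit supplies a radius \<open>r\<close> for which the ball is not left:
  \<open>\<phi> r r\<close>, the integral of \<open>M(s, r)\<close> and a fixed constant add up to at most \<open>r\<close>.

  The reduced equation is solved by compactness (\<open>exact_solution\<close>). Approximate solutions with
  error \<open>\<epsilon>\<close> exist near every point, because \<open>resolvent (h s)\<close> has uniform one-sided limits in
  \<open>s\<close>, and two of them on adjacent intervals can be joined; hence they exist on the whole
  interval. All of them have increments bounded by those of one monotone function \<open>Q\<close>, an
  indefinite integral of \<open>M(s, r)\<close>, so a subsequence converges at every point, and dominated
  convergence identifies the limit as an exact solution.

  The integrals are handled through their primitives. A function \<open>\<Phi>\<close> is a primitive of \<open>f\<close>
  with respect to \<open>g\<close> if \<open>f t * (g v - g t)\<close> differs from \<open>\<Phi> v - \<Phi> t\<close>, for \<open>v\<close> near \<open>t\<close>, by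
  at most an increment of a monotone function of small total growth. This is Ward's form of the
  Perron integral. It is equivalent to the definition by tagged partitions
  (\<open>has_ks_integral_ks_primitive\<close>, \<open>ks_integrable_imp_ks_primitive\<close>), and it is a
  local condition: comparisons of primitives are proved near each point and pass to the whole
  interval by compactness (\<open>local_to_global\<close>). The central result is
  \<open>ks_primitive_SUP\<close>: the pointwise supremum of functions whose primitives have increments
  below those of a fixed function has a primitive, obtained by following at each point one of the
  given primitives and taking the best such choice. Applied twice it gives a lemma of Fatou type,
  and from there dominated convergence. Domination is expressed by increments of
  primitives, the form in which the hypothesis on \<open>f\<close> and \<open>M\<close> provides it.
\<close>

section \<open>Arbitrary norms on a finite-dimensional space\<close>

lemma
  assumes "is_norm N"
  shows is_norm_nonneg: "0 \<le> N x"
    and is_norm_eq_0: "N x = 0 \<longleftrightarrow> x = 0"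
    and is_norm_scaleR: "N (c *\<^sub>R x) = \<bar>c\<bar> * N x"
    and is_norm_triangle: "N (x + y) \<le> N x + N y"
  using assms by (simp_all add: is_norm_def)

lemma is_norm_zero: "is_norm N \<Longrightarrow> N 0 = 0"
  by (simp add: is_norm_def)

lemma is_norm_minus:
  assumes "is_norm N" shows "N (- x) = N x"
  using is_norm_scaleR[OF assms, of "-1" x] by simp

lemma is_norm_commute: "is_norm N \<Longrightarrow> N (x - y) = N (y - x)"
  using is_norm_minus[of N "x - y"] by simp

lemma is_norm_diff_triangle:
  assumes "is_norm N" shows "N (x - z) \<le> N (x - y) + N (y - z)"
  using is_norm_triangle[OF assms, of "x - y" "y - z"] by simp

lemma is_norm_sum:
  assumes N: "is_norm N" shows "N (\<Sum>i\<in>A. x i) \<le> (\<Sum>i\<in>A. N (x i))"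
proof (induction A rule: infinite_finite_induct)
  case (insert i A)
  have "N (x i + (\<Sum>i\<in>A. x i)) \<le> N (x i) + N (\<Sum>i\<in>A. x i)"
    by (rule is_norm_triangle[OF N])
  with insert show ?case by simp
qed (simp_all add: is_norm_zero[OF N])

lemma is_norm_abs: "is_norm (abs :: real \<Rightarrow> real)"
  by (simp add: is_norm_def abs_mult abs_triangle_ineq)

lemma is_norm_le_norm:
  fixes N :: "real ^ 'n \<Rightarrow> real"
  assumes N: "is_norm N"
  obtains C where "C > 0" "\<And>x. N x \<le> C * norm x"
proof
  let ?C = "(\<Sum>i\<in>UNIV. N (axis i 1)) + 1"
  have nn: "N x \<ge> 0" for x by (rule is_norm_nonneg[OF N])
  show "?C > 0" using nn by (simp add: add_nonneg_pos sum_nonneg)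
  show "N x \<le> ?C * norm x" for x
  proof -
    have "x = (\<Sum>i\<in>UNIV. (x $ i) *\<^sub>R axis i 1)"
      using basis_expansion[of x] by (simp add: scalar_mult_eq_scaleR)
    then have "N x \<le> (\<Sum>i\<in>UNIV. N ((x $ i) *\<^sub>R axis i 1))"
      using is_norm_sum[OF N] by metis
    also have "\<dots> = (\<Sum>i\<in>UNIV. \<bar>x $ i\<bar> * N (axis i 1))"
      by (simp add: is_norm_scaleR[OF N])
    also have "\<dots> \<le> (\<Sum>i\<in>UNIV. norm x * N (axis i 1))"
      using nn component_le_norm_cart by (intro sum_mono mult_right_mono) auto
    also have "\<dots> \<le> ?C * norm x"
      by (simp add: sum_distrib_left[symmetric] algebra_simps)
    finally show ?thesis .
  qed
qed

lemma is_norm_continuous_on: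
  fixes N :: "real ^ 'n \<Rightarrow> real"
  assumes N: "is_norm N"
  shows "continuous_on A N"
proof -
  obtain C where C: "C > 0" "\<And>x. N x \<le> C * norm x" using is_norm_le_norm[OF N] by blast
  have "\<bar>N x - N y\<bar> \<le> C * norm (x - y)" for x y
  proof -
    have "N x \<le> N (x - y) + N y" "N y \<le> N (y - x) + N x"
      using is_norm_triangle[OF N, of "x - y" y] is_norm_triangle[OF N, of "y - x" x] by simp_all
    moreover have "N (y - x) = N (x - y)" using is_norm_minus[OF N, of "x - y"] by simp
    ultimately show ?thesis using C(2)[of "x - y"] by linarith
  qed
  then have "C-lipschitz_on A N"
    using C(1) by (intro lipschitz_onI) (auto simp: dist_norm)
  then show ?thesis by (rule lipschitz_on_continuous_on)
qed

text \<open>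
  On the Euclidean unit sphere, which is compact, the continuous function \<open>N\<close> attains a positive
  minimum; homogeneity carries the resulting bound to all vectors.
\<close>

lemma norm_le_is_norm:
  fixes N :: "real ^ 'n \<Rightarrow> real"
  assumes N: "is_norm N"
  obtains C where "C > 0" "\<And>x. norm x \<le> C * N x"
proof -
  let ?S = "sphere (0::real^'n) 1"
  have "axis undefined 1 \<in> ?S" by simp
  then obtain z where z: "z \<in> ?S" "\<And>x. x \<in> ?S \<Longrightarrow> N z \<le> N x"
    using continuous_attains_inf[OF compact_sphere _ is_norm_continuous_on[OF N], of 0 1] by blast
  have pos: "N z > 0"
    using z(1) is_norm_nonneg[OF N, of z] is_norm_eq_0[OF N, of z] by (auto simp: less_le)
  show ?thesis
  proof
    show "1 / N z > 0" using pos by simp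
    show "norm x \<le> 1 / N z * N x" for x
    proof (cases "x = 0")
      case False
      then have "N z \<le> N ((1 / norm x) *\<^sub>R x)" by (intro z(2)) simp
      also have "\<dots> = N x / norm x" by (simp add: is_norm_scaleR[OF N])
      finally show ?thesis using pos False by (simp add: field_simps)
    qed (simp add: is_norm_zero[OF N])
  qed
qed

lemma is_norm_tendsto:
  fixes N :: "real ^ 'n \<Rightarrow> real"
  assumes "is_norm N" "(f \<longlongrightarrow> l) F"
  shows "((\<lambda>s. N (f s)) \<longlongrightarrow> N l) F"
  using continuous_on_tendsto_compose[OF is_norm_continuous_on[OF assms(1), of UNIV] assms(2)] by simp

lemma is_norm_diff_tendsto_0:
  fixes N :: "real ^ 'n \<Rightarrow> real"
  assumes "is_norm N" "(f \<longlongrightarrow> l) F"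
  shows "((\<lambda>s. N (f s - l)) \<longlongrightarrow> 0) F"
  using is_norm_tendsto[OF assms(1) tendsto_diff[OF assms(2) tendsto_const[of l]]]
  by (simp add: is_norm_zero[OF assms(1)])

lemma tendsto_if_is_norm_diff:
  fixes N :: "real ^ 'n \<Rightarrow> real"
  assumes N: "is_norm N" and "\<And>e. e > 0 \<Longrightarrow> eventually (\<lambda>s. N (f s - l) < e) F"
  shows "(f \<longlongrightarrow> l) F"
proof (rule tendstoI)
  fix e :: real assume "e > 0"
  obtain C where C: "C > 0" "\<And>x. norm x \<le> C * N x" using norm_le_is_norm[OF N] by blast
  have "eventually (\<lambda>s. N (f s - l) < e / C) F" using C \<open>e > 0\<close> by (intro assms) auto
  then show "eventually (\<lambda>s. dist (f s) l < e) F"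
  proof eventually_elim
    case (elim s)
    then have "C * N (f s - l) < e" using C(1) by (simp add: field_simps)
    then show ?case using C(2)[of "f s - l"] by (simp add: dist_norm)
  qed
qed

lemma compact_is_norm_ball:
  fixes N :: "real ^ 'n \<Rightarrow> real"
  assumes N: "is_norm N"
  shows "compact {x. N x \<le> r}"
proof -
  obtain C where C: "C > 0" "\<And>x. norm x \<le> C * N x" using norm_le_is_norm[OF N] by blast
  have "norm x \<le> C * r" if "N x \<le> r" for x
    using C(2)[of x] mult_left_mono[OF that, of C] C(1) by linarith
  then have "bounded {x. N x \<le> r}" by (intro boundedI[of _ "C * r"]) auto
  moreover have "closed {x. N x \<le> r}"
    using is_norm_continuous_on[OF N, of UNIV] by (intro closed_Collect_le continuous_intros)
  ultimately show ?thesis by (simp add: compact_eq_bounded_closed)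
qed

lemma is_norm_ball_net:
  fixes N :: "real ^ 'n \<Rightarrow> real"
  assumes N: "is_norm N" and e: "e > 0"
  obtains K where "finite K" "\<And>w. w \<in> K \<Longrightarrow> N w \<le> r" "\<And>x. N x \<le> r \<Longrightarrow> \<exists>w\<in>K. N (x - w) < e"
proof -
  have op: "open {x. N (x - w) < e}" for w
    by (intro open_Collect_less continuous_intros
        continuous_on_compose2[OF is_norm_continuous_on[OF N, of UNIV], of UNIV "\<lambda>x. x - w"]) auto
  have "{x. N x \<le> r} \<subseteq> (\<Union>w\<in>{x. N x \<le> r}. {x. N (x - w) < e})"
    using e by (force simp: is_norm_zero[OF N])
  then obtain K where "K \<subseteq> {x. N x \<le> r}" "finite K" "{x. N x \<le> r} \<subseteq> (\<Union>w\<in>K. {x. N (x - w) < e})"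
    using compactE_image[OF compact_is_norm_ball[OF N, of r], of "{x. N x \<le> r}" "\<lambda>w. {x. N (x - w) < e}"] op
    by metis
  then show ?thesis by (intro that[of K]) auto
qed

section \<open>Primitives with respect to an integrator\<close>

text \<open>
  Cousin's lemma in the form of an induction principle: a relation between end points that is
  transitive, and holds for all short intervals that start or end at a given point, holds for every
  subinterval. An interval with the point \<open>t\<close> in its interior is cut at \<open>t\<close>.
\<close>

lemma local_to_global:
  fixes P :: "real \<Rightarrow> real \<Rightarrow> bool"
  assumes cd: "a \<le> c" "c \<le> d" "d \<le> b"
    and trans: "\<And>u v w. a \<le> u \<Longrightarrow> u \<le> v \<Longrightarrow> v \<le> w \<Longrightarrow> w \<le> b \<Longrightarrow> P u v \<Longrightarrow> P v w \<Longrightarrow> P u w"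
    and loc: "\<And>t. t \<in> {a..b} \<Longrightarrow>
      \<exists>\<delta>>0. \<forall>v\<in>{a..b}. \<bar>v - t\<bar> < \<delta> \<longrightarrow> (t \<le> v \<longrightarrow> P t v) \<and> (v \<le> t \<longrightarrow> P v t)"
  shows "P c d"
proof -
  have "a \<le> c \<and> d \<le> b \<longrightarrow> P c d"
  proof (rule Bolzano[OF cd(2), where P = "\<lambda>u v. a \<le> u \<and> v \<le> b \<longrightarrow> P u v"])
    fix u v w
    assume "a \<le> u \<and> v \<le> b \<longrightarrow> P u v" "a \<le> v \<and> w \<le> b \<longrightarrow> P v w" "u \<le> v" "v \<le> w"
    then show "a \<le> u \<and> w \<le> b \<longrightarrow> P u w"
      using trans[of u v w] by auto
  next
    fix t
    assume t: "c \<le> t" "t \<le> d"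
    then obtain \<delta> where \<delta>: "\<delta> > 0"
      "\<And>v. v \<in> {a..b} \<Longrightarrow> \<bar>v - t\<bar> < \<delta> \<Longrightarrow> (t \<le> v \<longrightarrow> P t v) \<and> (v \<le> t \<longrightarrow> P v t)"
      using loc[of t] cd by auto
    have "a \<le> u \<and> v \<le> b \<longrightarrow> P u v" if "u \<le> t \<and> t \<le> v \<and> v - u < \<delta>" for u v
      using that t cd \<delta>(2)[of u] \<delta>(2)[of v] trans[of u t v] by auto
    with \<delta>(1) show "\<exists>\<delta>>0. \<forall>u v. u \<le> t \<and> t \<le> v \<and> v - u < \<delta> \<longrightarrow> a \<le> u \<and> v \<le> b \<longrightarrow> P u v"
      by blast
  qed
  then show ?thesis using cd by simp
qed

lemma increments_le_if_locally_le:
  fixes F G :: "real \<Rightarrow> real"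
  assumes "a \<le> c" "c \<le> d" "d \<le> b"
    and loc: "\<And>t. t \<in> {a..b} \<Longrightarrow> \<exists>\<delta>>0. \<forall>v\<in>{a..b}. \<bar>v - t\<bar> < \<delta> \<longrightarrow>
      (t \<le> v \<longrightarrow> F v - F t \<le> G v - G t) \<and> (v \<le> t \<longrightarrow> F t - F v \<le> G t - G v)"
  shows "F d - F c \<le> G d - G c"
  using assms(1-3)
  by (rule local_to_global[where P = "\<lambda>u v. F v - F u \<le> G v - G u", OF _ _ _ _ loc]) auto

text \<open>
  Indefinite integrals in Ward's sense. The error at a tag \<open>t\<close> is measured by increments of one
  monotone \<open>W\<close>, so that errors add up to at most \<open>W b - W a\<close> over any partition, and the condition
  can be checked separately at each \<open>t\<close>. Only intervals having \<open>t\<close> as an end point are compared: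
  a tagged interval around \<open>t\<close> is the union of two of these, and both sides are additive. The
  absolute value on the right serves \<open>v \<le> t\<close> as well as \<open>t \<le> v\<close>. For
  monotone \<open>g\<close> a primitive of a real function is determined up to an additive constant.
\<close>

definition ks_primitive ::
    "(real \<Rightarrow> real) \<Rightarrow> real \<Rightarrow> real \<Rightarrow> (real \<Rightarrow> 'a::real_normed_vector) \<Rightarrow> (real \<Rightarrow> 'a) \<Rightarrow> bool" where
  "ks_primitive g a b f \<Phi> \<longleftrightarrow>
     (\<forall>\<epsilon>>0. \<exists>W. mono_on {a..b} W \<and> W b - W a \<le> \<epsilon> \<and>
        (\<forall>t\<in>{a..b}. \<exists>\<delta>>0. \<forall>v\<in>{a..b}. \<bar>v - t\<bar> < \<delta> \<longrightarrow>
           norm ((g v - g t) *\<^sub>R f t - (\<Phi> v - \<Phi> t)) \<le> \<bar>W v - W t\<bar>))"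

lemma ks_primitiveE:
  assumes "ks_primitive g a b f \<Phi>" "\<epsilon> > 0"
  obtains W where "mono_on {a..b} W" "W b - W a \<le> \<epsilon>"
    "\<And>t. t \<in> {a..b} \<Longrightarrow> \<exists>\<delta>>0. \<forall>v\<in>{a..b}. \<bar>v - t\<bar> < \<delta> \<longrightarrow>
           norm ((g v - g t) *\<^sub>R f t - (\<Phi> v - \<Phi> t)) \<le> \<bar>W v - W t\<bar>"
  using assms unfolding ks_primitive_def by meson

text \<open>
  Error bounds obtained in practice carry a constant factor; it is absorbed here once and for all.
\<close>

lemma ks_primitive_scaled:
  fixes f \<Phi> :: "real \<Rightarrow> 'a::real_normed_vector"
  assumes C: "C \<ge> 0"
    and "\<And>\<epsilon>. \<epsilon> > 0 \<Longrightarrow> \<exists>W. mono_on {a..b} W \<and> W b - W a \<le> C * \<epsilon> \<and>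
        (\<forall>t\<in>{a..b}. \<exists>\<delta>>0. \<forall>v\<in>{a..b}. \<bar>v - t\<bar> < \<delta> \<longrightarrow>
           norm ((g v - g t) *\<^sub>R f t - (\<Phi> v - \<Phi> t)) \<le> \<bar>W v - W t\<bar>)"
  shows "ks_primitive g a b f \<Phi>"
  unfolding ks_primitive_def
proof (intro allI impI)
  fix \<epsilon> :: real assume "\<epsilon> > 0"
  moreover have "C * (\<epsilon> / (C + 1)) \<le> \<epsilon>"
    using C \<open>\<epsilon> > 0\<close> by (simp add: field_simps)
  ultimately show "\<exists>W. mono_on {a..b} W \<and> W b - W a \<le> \<epsilon> \<and>
        (\<forall>t\<in>{a..b}. \<exists>\<delta>>0. \<forall>v\<in>{a..b}. \<bar>v - t\<bar> < \<delta> \<longrightarrow>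
           norm ((g v - g t) *\<^sub>R f t - (\<Phi> v - \<Phi> t)) \<le> \<bar>W v - W t\<bar>)"
    using C assms(2)[of "\<epsilon> / (C + 1)"]
    by (smt (verit, best) divide_pos_pos)
qed

lemma mono_on_increment_abs:
  fixes W :: "real \<Rightarrow> real"
  assumes "mono_on {a..b} W" "t \<in> {a..b}" "v \<in> {a..b}"
  shows "t \<le> v \<Longrightarrow> \<bar>W v - W t\<bar> = W v - W t" and "v \<le> t \<Longrightarrow> \<bar>W v - W t\<bar> = W t - W v"
  using assms by (auto simp: mono_on_def)

lemma ks_primitive_subinterval:
  assumes "ks_primitive g a b f \<Phi>" "a \<le> c" "c \<le> d" "d \<le> b"
  shows "ks_primitive g c d f \<Phi>"
  unfolding ks_primitive_def
proof (intro allI impI)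
  fix \<epsilon> :: real assume e: "\<epsilon> > 0"
  obtain W where W: "mono_on {a..b} W" "W b - W a \<le> \<epsilon>"
    "\<And>t. t \<in> {a..b} \<Longrightarrow> \<exists>\<delta>>0. \<forall>v\<in>{a..b}. \<bar>v - t\<bar> < \<delta> \<longrightarrow>
           norm ((g v - g t) *\<^sub>R f t - (\<Phi> v - \<Phi> t)) \<le> \<bar>W v - W t\<bar>"
    by (rule ks_primitiveE[OF assms(1) e]) blast
  have sub: "{c..d} \<subseteq> {a..b}" using assms by auto
  have "W a \<le> W c" "W d \<le> W b"
    using W(1) assms(2-) by (auto simp: mono_on_def)
  then show "\<exists>W. mono_on {c..d} W \<and> W d - W c \<le> \<epsilon> \<and>
        (\<forall>t\<in>{c..d}. \<exists>\<delta>>0. \<forall>v\<in>{c..d}. \<bar>v - t\<bar> < \<delta> \<longrightarrow>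
           norm ((g v - g t) *\<^sub>R f t - (\<Phi> v - \<Phi> t)) \<le> \<bar>W v - W t\<bar>)"
    using W(2) sub mono_on_subset[OF W(1) sub] W(3)
    by (intro exI[of _ W] conjI ballI) (linarith | meson subsetD)+
qed

lemma ks_primitive_cong:
  assumes "ks_primitive g a b f \<Phi>" "\<And>t. t \<in> {a..b} \<Longrightarrow> f t = f' t"
    "\<And>t. t \<in> {a..b} \<Longrightarrow> \<Phi>' t = \<Phi> t + c"
  shows "ks_primitive g a b f' \<Phi>'"
  using assms(1) unfolding ks_primitive_def
  by (simp add: assms(2,3))

lemma ks_primitive_uminus:
  assumes "ks_primitive g a b f \<Phi>"
  shows "ks_primitive g a b (\<lambda>t. - f t) (\<lambda>t. - \<Phi> t)"
proof -
  have "norm ((g v - g t) *\<^sub>R (- f t) - (- \<Phi> v - - \<Phi> t)) = norm ((g v - g t) *\<^sub>R f t - (\<Phi> v - \<Phi> t))" for v t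
    using norm_minus_cancel[of "(g v - g t) *\<^sub>R f t - (\<Phi> v - \<Phi> t)"]
    by (simp add: algebra_simps)
  then show ?thesis
    using assms unfolding ks_primitive_def by simp
qed

lemma ks_primitive_component:
  fixes f \<Phi> :: "real \<Rightarrow> real ^ 'n"
  assumes "ks_primitive g a b f \<Phi>"
  shows "ks_primitive g a b (\<lambda>t. f t $ i) (\<lambda>t. \<Phi> t $ i)"
proof -
  have le: "\<bar>(g v - g t) *\<^sub>R f t $ i - (\<Phi> v $ i - \<Phi> t $ i)\<bar> \<le> norm ((g v - g t) *\<^sub>R f t - (\<Phi> v - \<Phi> t))" for v t
    using component_le_norm_cart[of "(g v - g t) *\<^sub>R f t - (\<Phi> v - \<Phi> t)" i] by simp
  show ?thesis
    using assms unfolding ks_primitive_def real_norm_def by (meson le order_trans)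
qed

lemma ks_primitive_vec:
  fixes f \<Phi> :: "real \<Rightarrow> real ^ 'n"
  assumes "\<And>i. ks_primitive g a b (\<lambda>t. f t $ i) (\<lambda>t. \<Phi> t $ i)"
  shows "ks_primitive g a b f \<Phi>"
proof (rule ks_primitive_scaled[of "real CARD('n)"])
  fix \<epsilon> :: real assume "\<epsilon> > 0"
  then have "\<exists>W. mono_on {a..b} W \<and> W b - W a \<le> \<epsilon> \<and>
        (\<forall>t\<in>{a..b}. \<exists>\<delta>>0. \<forall>v\<in>{a..b}. \<bar>v - t\<bar> < \<delta> \<longrightarrow>
           norm ((g v - g t) *\<^sub>R f t $ i - (\<Phi> v $ i - \<Phi> t $ i)) \<le> \<bar>W v - W t\<bar>)" for i
    using assms[of i] unfolding ks_primitive_def by blast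
  then obtain W where W: "\<And>i. mono_on {a..b} (W i)" "\<And>i. W i b - W i a \<le> \<epsilon>"
    "\<And>i t. t \<in> {a..b} \<Longrightarrow> \<exists>\<delta>>0. \<forall>v\<in>{a..b}. \<bar>v - t\<bar> < \<delta> \<longrightarrow>
           norm ((g v - g t) *\<^sub>R f t $ i - (\<Phi> v $ i - \<Phi> t $ i)) \<le> \<bar>W i v - W i t\<bar>"
    by metis
  let ?W = "\<lambda>t. \<Sum>i\<in>UNIV. W i t"
  have mono: "mono_on {a..b} ?W"
    using W(1) by (auto simp: mono_on_def intro!: sum_mono)
  have tot: "?W b - ?W a \<le> real CARD('n) * \<epsilon>"
    using sum_mono[of UNIV, OF W(2)] by (simp add: sum_subtractf)
  have abs: "(\<Sum>i\<in>UNIV. \<bar>W i v - W i t\<bar>) = \<bar>?W v - ?W t\<bar>" if "t \<in> {a..b}" "v \<in> {a..b}" for v t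
  proof (cases "t \<le> v")
    case True
    then show ?thesis
      using mono_on_increment_abs(1)[OF W(1) that] mono_on_increment_abs(1)[OF mono that]
      by (simp add: sum_subtractf)
  next
    case False
    then show ?thesis
      using mono_on_increment_abs(2)[OF W(1) that] mono_on_increment_abs(2)[OF mono that]
      by (simp add: sum_subtractf)
  qed
  have "\<exists>\<delta>>0. \<forall>v\<in>{a..b}. \<bar>v - t\<bar> < \<delta> \<longrightarrow>
           norm ((g v - g t) *\<^sub>R f t - (\<Phi> v - \<Phi> t)) \<le> \<bar>?W v - ?W t\<bar>" if t: "t \<in> {a..b}" for t
  proof -
    obtain \<delta> where \<delta>: "\<And>i. \<delta> i > 0" "\<And>i v. v \<in> {a..b} \<Longrightarrow> \<bar>v - t\<bar> < \<delta> i \<Longrightarrow>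
           norm ((g v - g t) *\<^sub>R f t $ i - (\<Phi> v $ i - \<Phi> t $ i)) \<le> \<bar>W i v - W i t\<bar>"
      using W(3)[OF t] by metis
    have pos: "Min (range \<delta>) > 0" using \<delta>(1) by simp
    have "norm ((g v - g t) *\<^sub>R f t - (\<Phi> v - \<Phi> t)) \<le> \<bar>?W v - ?W t\<bar>"
      if v: "v \<in> {a..b}" "\<bar>v - t\<bar> < Min (range \<delta>)" for v
    proof -
      have "norm ((g v - g t) *\<^sub>R f t - (\<Phi> v - \<Phi> t)) \<le> (\<Sum>i\<in>UNIV. \<bar>((g v - g t) *\<^sub>R f t - (\<Phi> v - \<Phi> t)) $ i\<bar>)"
        by (rule norm_le_l1_cart)
      also have "\<dots> \<le> (\<Sum>i\<in>UNIV. \<bar>W i v - W i t\<bar>)"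
        using \<delta>(2)[OF v(1)] v(2) by (intro sum_mono) simp
      finally show ?thesis using abs[OF t v(1)] by simp
    qed
    then show ?thesis using pos by blast
  qed
  then show "\<exists>W. mono_on {a..b} W \<and> W b - W a \<le> real CARD('n) * \<epsilon> \<and>
        (\<forall>t\<in>{a..b}. \<exists>\<delta>>0. \<forall>v\<in>{a..b}. \<bar>v - t\<bar> < \<delta> \<longrightarrow>
           norm ((g v - g t) *\<^sub>R f t - (\<Phi> v - \<Phi> t)) \<le> \<bar>W v - W t\<bar>)"
    using mono tot by blast
qed simp

text \<open>
  Near each point \<open>\<Phi>\<close> grows at most as fast as \<open>\<Phi>'\<close> plus the errors of both, and the errors
  can be made small. This is monotonicity of the integral on every subinterval at once, and implies
  uniqueness.
\<close>

lemma ks_primitive_mono: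
  fixes f f' \<Phi> \<Phi>' :: "real \<Rightarrow> real"
  assumes g: "mono_on {a..b} g"
    and f: "ks_primitive g a b f \<Phi>" and f': "ks_primitive g a b f' \<Phi>'"
    and le: "\<And>t. t \<in> {a..b} \<Longrightarrow> f t \<le> f' t"
    and cd: "a \<le> c" "c \<le> d" "d \<le> b"
  shows "\<Phi> d - \<Phi> c \<le> \<Phi>' d - \<Phi>' c"
proof (rule field_le_epsilon)
  fix e :: real assume "e > 0"
  then have e2: "e / 2 > 0" by simp
  from f e2 obtain W where W: "mono_on {a..b} W" "W b - W a \<le> e / 2"
    "\<And>t. t \<in> {a..b} \<Longrightarrow> \<exists>\<delta>>0. \<forall>v\<in>{a..b}. \<bar>v - t\<bar> < \<delta> \<longrightarrow>
           norm ((g v - g t) *\<^sub>R f t - (\<Phi> v - \<Phi> t)) \<le> \<bar>W v - W t\<bar>"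
    by (rule ks_primitiveE) blast
  from f' e2 obtain W' where W': "mono_on {a..b} W'" "W' b - W' a \<le> e / 2"
    "\<And>t. t \<in> {a..b} \<Longrightarrow> \<exists>\<delta>>0. \<forall>v\<in>{a..b}. \<bar>v - t\<bar> < \<delta> \<longrightarrow>
           norm ((g v - g t) *\<^sub>R f' t - (\<Phi>' v - \<Phi>' t)) \<le> \<bar>W' v - W' t\<bar>"
    by (rule ks_primitiveE) blast
  have "\<Phi> d - \<Phi> c \<le> (\<Phi>' d + W d + W' d) - (\<Phi>' c + W c + W' c)"
  proof (rule increments_le_if_locally_le[OF cd, where G = "\<lambda>t. \<Phi>' t + W t + W' t"])
    fix t assume t: "t \<in> {a..b}"
    obtain \<delta>1 where d1: "\<delta>1 > 0" "\<And>v. v \<in> {a..b} \<Longrightarrow> \<bar>v - t\<bar> < \<delta>1 \<Longrightarrow>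
           norm ((g v - g t) *\<^sub>R f t - (\<Phi> v - \<Phi> t)) \<le> \<bar>W v - W t\<bar>"
      using W(3)[OF t] by blast
    obtain \<delta>2 where d2: "\<delta>2 > 0" "\<And>v. v \<in> {a..b} \<Longrightarrow> \<bar>v - t\<bar> < \<delta>2 \<Longrightarrow>
           norm ((g v - g t) *\<^sub>R f' t - (\<Phi>' v - \<Phi>' t)) \<le> \<bar>W' v - W' t\<bar>"
      using W'(3)[OF t] by blast
    show "\<exists>\<delta>>0. \<forall>v\<in>{a..b}. \<bar>v - t\<bar> < \<delta> \<longrightarrow>
      (t \<le> v \<longrightarrow> \<Phi> v - \<Phi> t \<le> (\<Phi>' v + W v + W' v) - (\<Phi>' t + W t + W' t)) \<and>
      (v \<le> t \<longrightarrow> \<Phi> t - \<Phi> v \<le> (\<Phi>' t + W t + W' t) - (\<Phi>' v + W v + W' v))"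
    proof (intro exI[of _ "min \<delta>1 \<delta>2"] conjI ballI impI)
      fix v assume v: "v \<in> {a..b}" "\<bar>v - t\<bar> < min \<delta>1 \<delta>2"
      have 1: "\<bar>(g v - g t) * f t - (\<Phi> v - \<Phi> t)\<bar> \<le> \<bar>W v - W t\<bar>" using d1(2)[of v] v by simp
      have 2: "\<bar>(g v - g t) * f' t - (\<Phi>' v - \<Phi>' t)\<bar> \<le> \<bar>W' v - W' t\<bar>" using d2(2)[of v] v by simp
      { assume "t \<le> v"
        moreover have "(g v - g t) * f t \<le> (g v - g t) * f' t"
          using \<open>t \<le> v\<close> g t v le[OF t] by (intro mult_left_mono) (auto simp: mono_on_def)
        ultimately show "\<Phi> v - \<Phi> t \<le> (\<Phi>' v + W v + W' v) - (\<Phi>' t + W t + W' t)"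
          using 1 2 mono_on_increment_abs(1)[OF W(1) t v(1)] mono_on_increment_abs(1)[OF W'(1) t v(1)]
          by linarith }
      { assume "v \<le> t"
        moreover have "(g v - g t) * f' t \<le> (g v - g t) * f t"
          using \<open>v \<le> t\<close> g t v le[OF t] by (intro mult_left_mono_neg) (auto simp: mono_on_def)
        ultimately show "\<Phi> t - \<Phi> v \<le> (\<Phi>' t + W t + W' t) - (\<Phi>' v + W v + W' v)"
          using 1 2 mono_on_increment_abs(2)[OF W(1) t v(1)] mono_on_increment_abs(2)[OF W'(1) t v(1)]
          by linarith }
    qed (use d1 d2 in auto)
  qed
  moreover have "W d - W c \<le> W b - W a" "W' d - W' c \<le> W' b - W' a"
    using W(1) W'(1) cd by (auto simp: mono_on_def intro!: diff_mono)
  ultimately show "\<Phi> d - \<Phi> c \<le> \<Phi>' d - \<Phi>' c + e"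
    using W(2) W'(2) by linarith
qed

lemma ks_primitive_zero: "ks_primitive g a b (\<lambda>_. 0) (\<lambda>_. 0)"
  unfolding ks_primitive_def
  by (intro allI impI exI[of _ "\<lambda>_. 0"]) (auto simp: mono_on_def intro: exI[of _ 1])

lemma ks_primitive_degenerate: "ks_primitive g t t f (\<lambda>_. c)"
  unfolding ks_primitive_def
  by (intro allI impI exI[of _ "\<lambda>_. 0"]) (auto simp: mono_on_def intro: exI[of _ 1])

lemma ks_primitive_nonneg:
  fixes f \<Phi> :: "real \<Rightarrow> real"
  assumes "mono_on {a..b} g" "ks_primitive g a b f \<Phi>" "\<And>t. t \<in> {a..b} \<Longrightarrow> 0 \<le> f t"
    and "a \<le> c" "c \<le> d" "d \<le> b"
  shows "\<Phi> c \<le> \<Phi> d"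
  using ks_primitive_mono[OF assms(1) ks_primitive_zero assms(2-)] by simp

lemma ks_primitive_unique:
  fixes f \<Phi> \<Phi>' :: "real \<Rightarrow> real"
  assumes "mono_on {a..b} g" "ks_primitive g a b f \<Phi>" "ks_primitive g a b f \<Phi>'"
    and "a \<le> c" "c \<le> d" "d \<le> b"
  shows "\<Phi> d - \<Phi> c = \<Phi>' d - \<Phi>' c"
  using ks_primitive_mono[OF assms(1-3) _ assms(4-)] ks_primitive_mono[OF assms(1,3,2) _ assms(4-)]
  by fastforce

section \<open>Primitives and the Kurzweil--Stieltjes integral\<close>

text \<open>
  The values of Riemann--Stieltjes sums over fine partitions of \<open>[u, v]\<close>. As a relation between
  \<open>u\<close>, \<open>v\<close> and the value it hides the indexing of partitions; they are built by concatenation.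
\<close>

definition fine_sum ::
    "(real \<Rightarrow> 'a::real_vector) \<Rightarrow> (real \<Rightarrow> real) \<Rightarrow> (real \<Rightarrow> real) \<Rightarrow> real \<Rightarrow> real \<Rightarrow> 'a \<Rightarrow> bool" where
  "fine_sum f g \<delta> u v S \<longleftrightarrow> (\<exists>k s \<tau>. tagged_partition u v k s \<tau> \<and> fine_partition \<delta> k s \<tau> \<and>
     S = (\<Sum>i=1..k. (g (s i) - g (s (i - 1))) *\<^sub>R f (\<tau> i)))"

lemma fine_sum_refl: "fine_sum f g \<delta> u u 0"
  unfolding fine_sum_def
  by (intro exI[of _ 0] exI[of _ "\<lambda>_. u"]) (auto simp: tagged_partition_def fine_partition_def)

lemma fine_sum_single:
  assumes "t \<in> {u..v}" "{u..v} \<subseteq> {t - \<delta> t<..<t + \<delta> t}"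
  shows "fine_sum f g \<delta> u v ((g v - g u) *\<^sub>R f t)"
  unfolding fine_sum_def
  using assms
  by (intro exI[of _ 1] exI[of _ "\<lambda>i. if i = 0 then u else v"] exI[of _ "\<lambda>_. t"])
    (auto simp: tagged_partition_def fine_partition_def)

lemma fine_sum_append:
  assumes "fine_sum f g \<delta> u v S" "fine_sum f g \<delta> v w S'"
  shows "fine_sum f g \<delta> u w (S + S')"
proof -
  obtain k s \<tau> where 1: "tagged_partition u v k s \<tau>" "fine_partition \<delta> k s \<tau>"
    and S: "S = (\<Sum>i=1..k. (g (s i) - g (s (i - 1))) *\<^sub>R f (\<tau> i))"
    using assms(1) unfolding fine_sum_def by blast
  obtain k' s' \<tau>' where 2: "tagged_partition v w k' s' \<tau>'" "fine_partition \<delta> k' s' \<tau>'"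
    and S': "S' = (\<Sum>i=1..k'. (g (s' i) - g (s' (i - 1))) *\<^sub>R f (\<tau>' i))"
    using assms(2) unfolding fine_sum_def by blast
  define r where "r i = (if i \<le> k then s i else s' (i - k))" for i
  define \<sigma> where "\<sigma> i = (if i \<le> k then \<tau> i else \<tau>' (i - k))" for i
  have r1: "r i = s i" "r (i - 1) = s (i - 1)" "\<sigma> i = \<tau> i" if "i \<in> {1..k}" for i
    using that by (auto simp: r_def \<sigma>_def)
  have r2: "r (k + i) = s' i" "r (k + i - 1) = s' (i - 1)" "\<sigma> (k + i) = \<tau>' i" if "i \<in> {1..k'}" for i
  proof -
    have "s k = s' 0" using 1 2 by (simp add: tagged_partition_def)
    then show "r (k + i - 1) = s' (i - 1)" using that by (cases "i = 1") (auto simp: r_def)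
  qed (use that in \<open>auto simp: r_def \<sigma>_def\<close>)
  have split: "(\<exists>j\<in>{1..k}. i = j) \<or> (\<exists>j\<in>{1..k'}. i = k + j)" if "i \<in> {1..k + k'}" for i
  proof (cases "i \<le> k")
    case False
    then have "i - k \<in> {1..k'} \<and> i = k + (i - k)" using that by auto
    then show ?thesis by blast
  qed (use that in auto)
  have "tagged_partition u w (k + k') r \<sigma>"
    unfolding tagged_partition_def
  proof (intro conjI ballI)
    show "r 0 = u" "r (k + k') = w"
      using 1 2 by (auto simp: r_def tagged_partition_def)
  next
    fix i assume "i \<in> {1..k + k'}"
    then show "r (i - 1) \<le> r i" "\<sigma> i \<in> {r (i - 1)..r i}"
      using split[of i] 1(1) 2(1) r1 r2 by (auto simp: tagged_partition_def)
  qed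
  moreover have "fine_partition \<delta> (k + k') r \<sigma>"
    unfolding fine_partition_def
  proof (intro ballI)
    fix i assume "i \<in> {1..k + k'}"
    then show "{r (i - 1)..r i} \<subseteq> {\<sigma> i - \<delta> (\<sigma> i)<..<\<sigma> i + \<delta> (\<sigma> i)}"
      using split[of i] 1(2) 2(2) r1 r2 unfolding fine_partition_def by metis
  qed
  moreover have "(\<Sum>i=1..k + k'. (g (r i) - g (r (i - 1))) *\<^sub>R f (\<sigma> i)) = S + S'"
  proof -
    have "(\<Sum>i=1..k + k'. (g (r i) - g (r (i - 1))) *\<^sub>R f (\<sigma> i)) =
      (\<Sum>i=1..k. (g (r i) - g (r (i - 1))) *\<^sub>R f (\<sigma> i)) +
      (\<Sum>i=k+1..k + k'. (g (r i) - g (r (i - 1))) *\<^sub>R f (\<sigma> i))"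
      by (rule sum.ub_add_nat) simp
    also have "(\<Sum>i=k+1..k + k'. (g (r i) - g (r (i - 1))) *\<^sub>R f (\<sigma> i)) =
        (\<Sum>i=1..k'. (g (r (k + i)) - g (r (k + i - 1))) *\<^sub>R f (\<sigma> (k + i)))"
      using sum.shift_bounds_cl_nat_ivl[of "\<lambda>i. (g (r i) - g (r (i - 1))) *\<^sub>R f (\<sigma> i)" 1 k k']
      by (simp add: add.commute)
    also have "\<dots> = S'" unfolding S' using r2 by (intro sum.cong) auto
    also have "(\<Sum>i=1..k. (g (r i) - g (r (i - 1))) *\<^sub>R f (\<sigma> i)) = S"
      unfolding S using r1 by (intro sum.cong) auto
    finally show ?thesis .
  qed
  ultimately show ?thesis unfolding fine_sum_def by metis
qed

lemma fine_sum_exists: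
  assumes "a \<le> c" "c \<le> d" "d \<le> b" "ks_gauge a b \<delta>"
  shows "\<exists>S. fine_sum f g \<delta> c d S"
  using assms(1-3)
proof (rule local_to_global[where P = "\<lambda>u v. \<exists>S. fine_sum f g \<delta> u v S"])
  fix t assume t: "t \<in> {a..b}"
  have "(t \<le> v \<longrightarrow> (\<exists>S. fine_sum f g \<delta> t v S)) \<and> (v \<le> t \<longrightarrow> (\<exists>S. fine_sum f g \<delta> v t S))"
    if "\<bar>v - t\<bar> < \<delta> t" for v
    using that fine_sum_single[of t t v \<delta> f g] fine_sum_single[of t v t \<delta> f g]
    by (auto simp: abs_if subset_iff split: if_splits)
  then show "\<exists>\<delta>'>0. \<forall>v\<in>{a..b}. \<bar>v - t\<bar> < \<delta>' \<longrightarrow>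
      (t \<le> v \<longrightarrow> (\<exists>S. fine_sum f g \<delta> t v S)) \<and> (v \<le> t \<longrightarrow> (\<exists>S. fine_sum f g \<delta> v t S))"
    using assms(4) t unfolding ks_gauge_def by blast
qed (use fine_sum_append in blast)

lemma has_ks_integral_fine_sum:
  "has_ks_integral N f g a b I \<longleftrightarrow>
    (\<forall>\<epsilon>>0. \<exists>\<delta>. ks_gauge a b \<delta> \<and> (\<forall>S. fine_sum f g \<delta> a b S \<longrightarrow> N (S - I) < \<epsilon>))"
  unfolding has_ks_integral_def fine_sum_def by blast

lemma fine_sum_gauge_mono:
  assumes "fine_sum f g \<delta> u v S" "\<And>t. \<delta> t \<le> \<delta>' t"
  shows "fine_sum f g \<delta>' u v S"
proof -
  have "{x - \<delta> x<..<x + \<delta> x} \<subseteq> {x - \<delta>' x<..<x + \<delta>' x}" for x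
    using assms(2)[of x] by auto
  then have "fine_partition \<delta> k s \<tau> \<Longrightarrow> fine_partition \<delta>' k s \<tau>" for k s \<tau>
    unfolding fine_partition_def by (meson subset_trans)
  then show ?thesis using assms(1) unfolding fine_sum_def by blast
qed

lemma has_ks_integral_unique:
  assumes N: "is_norm N" and "a \<le> b" "has_ks_integral N f g a b I" "has_ks_integral N f g a b I'"
  shows "I = I'"
proof (rule ccontr)
  assume "I \<noteq> I'"
  then have pos: "N (I - I') / 2 > 0"
    using is_norm_nonneg[OF N, of "I - I'"] is_norm_eq_0[OF N, of "I - I'"] by simp
  obtain \<delta> where \<delta>: "ks_gauge a b \<delta>" "\<And>S. fine_sum f g \<delta> a b S \<Longrightarrow> N (S - I) < N (I - I') / 2"
    using assms(3) pos unfolding has_ks_integral_fine_sum by blast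
  obtain \<delta>' where \<delta>': "ks_gauge a b \<delta>'" "\<And>S. fine_sum f g \<delta>' a b S \<Longrightarrow> N (S - I') < N (I - I') / 2"
    using assms(4) pos unfolding has_ks_integral_fine_sum by blast
  have "ks_gauge a b (\<lambda>t. min (\<delta> t) (\<delta>' t))"
    using \<delta>(1) \<delta>'(1) by (simp add: ks_gauge_def)
  then obtain S where "fine_sum f g (\<lambda>t. min (\<delta> t) (\<delta>' t)) a b S"
    using fine_sum_exists \<open>a \<le> b\<close> by (metis order_refl)
  then have "fine_sum f g \<delta> a b S" "fine_sum f g \<delta>' a b S"
    by (rule fine_sum_gauge_mono; simp)+
  then have "N (S - I) < N (I - I') / 2" "N (S - I') < N (I - I') / 2"
    using \<delta>(2) \<delta>'(2) by blast+
  moreover have "N (I - S) = N (S - I)"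
    using is_norm_minus[OF N, of "S - I"] by simp
  ultimately show False
    using is_norm_diff_triangle[OF N, of I I' S] by linarith
qed

lemma ks_integral_eqI:
  assumes "is_norm N" "a \<le> b" "has_ks_integral N f g a b I"
  shows "ks_integral N f g a b = I"
  unfolding ks_integral_def
  using assms has_ks_integral_unique by blast

lemma tagged_partition_points:
  assumes "tagged_partition c d k s \<tau>" "i \<le> k"
  shows "s i \<in> {c..d}"
proof -
  have next_le: "s j \<le> s (Suc j)" if "j < k" for j
    using assms(1) that unfolding tagged_partition_def by force
  have "s 0 \<le> s i" using \<open>i \<le> k\<close> 
  proof (induction i)
    case (Suc i)
    then show ?case using next_le[of i] by auto
  qed simp
  moreover have "s i \<le> s k" using \<open>i \<le> k\<close>
  proof (induction rule: inc_induct)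
    case (step i)
    then show ?case using next_le[of i] by auto
  qed simp
  ultimately show ?thesis using assms(1) unfolding tagged_partition_def by simp
qed

text \<open>
  The direction from primitives to the integral: the gauge is the radius given by the primitive,
  and the errors of a fine partition telescope to at most \<open>W d - W c\<close>.
\<close>

theorem has_ks_integral_ks_primitive:
  fixes f \<Phi> :: "real \<Rightarrow> 'a::real_normed_vector"
  assumes N: "is_norm N" and C: "C > 0" "\<And>x. N x \<le> C * norm x"
    and prim: "ks_primitive g a b f \<Phi>" and cd: "a \<le> c" "c \<le> d" "d \<le> b"
  shows "has_ks_integral N f g c d (\<Phi> d - \<Phi> c)"
  unfolding has_ks_integral_fine_sum
proof (intro allI impI)
  fix \<epsilon> :: real assume "\<epsilon> > 0"
  then have e: "\<epsilon> / (2 * C) > 0" using C by simp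
  obtain W where W: "mono_on {c..d} W" "W d - W c \<le> \<epsilon> / (2 * C)"
    "\<And>t. t \<in> {c..d} \<Longrightarrow> \<exists>\<delta>>0. \<forall>v\<in>{c..d}. \<bar>v - t\<bar> < \<delta> \<longrightarrow>
           norm ((g v - g t) *\<^sub>R f t - (\<Phi> v - \<Phi> t)) \<le> \<bar>W v - W t\<bar>"
    by (rule ks_primitiveE[OF ks_primitive_subinterval[OF prim cd] e]) blast
  then obtain \<delta> where \<delta>: "\<And>t. t \<in> {c..d} \<Longrightarrow> \<delta> t > 0"
    "\<And>t v. t \<in> {c..d} \<Longrightarrow> v \<in> {c..d} \<Longrightarrow> \<bar>v - t\<bar> < \<delta> t \<Longrightarrow>
           norm ((g v - g t) *\<^sub>R f t - (\<Phi> v - \<Phi> t)) \<le> \<bar>W v - W t\<bar>"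
    by metis
  have "N (S - (\<Phi> d - \<Phi> c)) < \<epsilon>" if S: "fine_sum f g \<delta> c d S" for S
  proof -
    obtain k s \<tau> where p: "tagged_partition c d k s \<tau>" "fine_partition \<delta> k s \<tau>"
      "S = (\<Sum>i=1..k. (g (s i) - g (s (i - 1))) *\<^sub>R f (\<tau> i))"
      using S unfolding fine_sum_def by blast
    have ends: "s 0 = c" "s k = d" using p(1) by (auto simp: tagged_partition_def)
    have tele: "(\<Sum>i=1..k. F (s i) - F (s (i - 1))) = F d - F c" for F :: "real \<Rightarrow> 'b::real_normed_vector"
      using sum_telescope''[of 0 k "\<lambda>i. F (s i)"] ends by simp
    have summand: "N ((g (s i) - g (s (i - 1))) *\<^sub>R f (\<tau> i) - (\<Phi> (s i) - \<Phi> (s (i - 1)))) \<le> C * (W (s i) - W (s (i - 1)))"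
      if i: "i \<in> {1..k}" for i
    proof -
      let ?u = "s (i - 1)" and ?v = "s i" and ?t = "\<tau> i"
      have uv: "?u \<in> {c..d}" "?v \<in> {c..d}"
        using tagged_partition_points[OF p(1)] i by auto
      have t: "?u \<le> ?t" "?t \<le> ?v"
        using p(1) i by (auto simp: tagged_partition_def)
      then have t': "?t \<in> {c..d}" using uv by auto
      have sub: "{?u..?v} \<subseteq> {?t - \<delta> ?t<..<?t + \<delta> ?t}"
        using p(2) i by (auto simp: fine_partition_def)
      moreover have "?u \<in> {?u..?v}" "?v \<in> {?u..?v}" using t by auto
      ultimately have uv': "?u \<in> {?t - \<delta> ?t<..<?t + \<delta> ?t}" "?v \<in> {?t - \<delta> ?t<..<?t + \<delta> ?t}"
        by blast+
      let ?e = "\<lambda>w. (g w - g ?t) *\<^sub>R f ?t - (\<Phi> w - \<Phi> ?t)"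
      have ne: "norm (?e w) \<le> \<bar>W w - W ?t\<bar>" if "w \<in> {?u, ?v}" for w
        using that \<delta>(2)[OF t', of w] uv uv' by auto
      have "(g ?v - g ?u) *\<^sub>R f ?t - (\<Phi> ?v - \<Phi> ?u) = ?e ?v - ?e ?u"
        by (simp add: algebra_simps)
      then have "norm ((g ?v - g ?u) *\<^sub>R f ?t - (\<Phi> ?v - \<Phi> ?u)) \<le> norm (?e ?v) + norm (?e ?u)"
        by (metis norm_triangle_ineq4)
      also have "\<dots> \<le> (W ?v - W ?t) + (W ?t - W ?u)"
        using ne mono_on_increment_abs(1)[OF W(1) t' uv(2) t(2)]
          mono_on_increment_abs(2)[OF W(1) t' uv(1) t(1)]
        by (metis add_mono insertI1 insertI2 singletonI)
      finally have "C * norm ((g ?v - g ?u) *\<^sub>R f ?t - (\<Phi> ?v - \<Phi> ?u)) \<le> C * (W ?v - W ?u)"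
        using C(1) by simp
      then show ?thesis using C(2) order_trans by blast
    qed
    have "S - (\<Phi> d - \<Phi> c) = (\<Sum>i=1..k. (g (s i) - g (s (i - 1))) *\<^sub>R f (\<tau> i) - (\<Phi> (s i) - \<Phi> (s (i - 1))))"
      using tele[of \<Phi>] p(3) by (simp add: sum_subtractf)
    also have "N \<dots> \<le> (\<Sum>i=1..k. C * (W (s i) - W (s (i - 1))))"
      by (rule order_trans[OF is_norm_sum[OF N]]) (rule sum_mono, rule summand)
    also have "\<dots> = C * (W d - W c)"
      using tele[of W] by (simp add: sum_distrib_left[symmetric])
    also have "\<dots> \<le> \<epsilon> / 2"
      using W(2) C(1) by (simp add: field_simps)
    finally show ?thesis using \<open>\<epsilon> > 0\<close> by linarith
  qed
  then show "\<exists>\<delta>. ks_gauge c d \<delta> \<and> (\<forall>S. fine_sum f g \<delta> c d S \<longrightarrow> N (S - (\<Phi> d - \<Phi> c)) < \<epsilon>)"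
    using \<delta>(1) unfolding ks_gauge_def by blast
qed

text \<open>
  The supremum \<open>U t\<close> of the sums over fine partitions of \<open>[a, t]\<close> grows from \<open>t\<close> to a close
  \<open>v\<close> by at least \<open>f t * (g v - g t)\<close>, because a partition can be prolonged by the interval with
  tag \<open>t\<close>. It is finite because every partition of \<open>[a, t]\<close> extends to one of \<open>[a, b]\<close>, whose
  sum is near \<open>I\<close>. Minor functions come from the same construction for \<open>- f\<close>.
\<close>

lemma major_function:
  fixes f :: "real \<Rightarrow> real"
  assumes "a \<le> b" "has_ks_integral abs f g a b I" "\<epsilon> > 0"
  shows "\<exists>U. U b - U a \<le> I + \<epsilon> \<and> (\<forall>t\<in>{a..b}. \<exists>\<delta>>0. \<forall>v\<in>{a..b}. \<bar>v - t\<bar> < \<delta> \<longrightarrow>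
      (t \<le> v \<longrightarrow> f t * (g v - g t) \<le> U v - U t) \<and> (v \<le> t \<longrightarrow> f t * (g t - g v) \<le> U t - U v))"
proof -
  obtain \<delta> where \<delta>: "ks_gauge a b \<delta>" "\<And>S. fine_sum f g \<delta> a b S \<Longrightarrow> \<bar>S - I\<bar> < \<epsilon>"
    using assms(2,3) unfolding has_ks_integral_fine_sum by blast
  define U where "U t = Sup {S. fine_sum f g \<delta> a t S}" for t
  have bdd: "bdd_above {S. fine_sum f g \<delta> a t S}" if t: "t \<in> {a..b}" for t
  proof -
    obtain S' where S': "fine_sum f g \<delta> t b S'"
      using fine_sum_exists[of a t b b \<delta> f g] t \<delta>(1) by auto
    have "S \<le> I + \<epsilon> - S'" if "fine_sum f g \<delta> a t S" for S
      using \<delta>(2)[OF fine_sum_append[OF that S']] by linarith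
    then show ?thesis by (intro bdd_aboveI[of _ "I + \<epsilon> - S'"]) blast
  qed
  have ne: "{S. fine_sum f g \<delta> a t S} \<noteq> {}" if "t \<in> {a..b}" for t
    using fine_sum_exists[of a a t b \<delta> f g] that \<delta>(1) by auto
  have step: "U u + S \<le> U v" if uv: "u \<in> {a..b}" "v \<in> {a..b}" and S: "fine_sum f g \<delta> u v S" for u v S
  proof -
    have "U u \<le> U v - S"
      unfolding U_def
    proof (rule cSup_least[OF ne[OF uv(1)]])
      fix S' assume "S' \<in> {S. fine_sum f g \<delta> a u S}"
      then have "S' + S \<in> {S. fine_sum f g \<delta> a v S}" using fine_sum_append S by blast
      then have "S' + S \<le> Sup {S. fine_sum f g \<delta> a v S}" by (rule cSup_upper[OF _ bdd[OF uv(2)]])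
      then show "S' \<le> Sup {S. fine_sum f g \<delta> a v S} - S" by simp
    qed
    then show ?thesis by simp
  qed
  have "U b \<le> I + \<epsilon>"
    unfolding U_def using \<delta>(2) ne[of b] \<open>a \<le> b\<close>
    by (intro cSup_least) (fastforce simp: abs_less_iff)+
  moreover have "U a \<ge> 0"
    unfolding U_def using \<open>a \<le> b\<close> by (intro cSup_upper[OF _ bdd]) (auto simp: fine_sum_refl)
  moreover have "\<exists>\<delta>>0. \<forall>v\<in>{a..b}. \<bar>v - t\<bar> < \<delta> \<longrightarrow>
      (t \<le> v \<longrightarrow> f t * (g v - g t) \<le> U v - U t) \<and> (v \<le> t \<longrightarrow> f t * (g t - g v) \<le> U t - U v)"
    if t: "t \<in> {a..b}" for t
  proof (intro exI[of _ "\<delta> t"] conjI ballI impI)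
    show "\<delta> t > 0" using t \<delta>(1) by (auto simp: ks_gauge_def)
    fix v assume v: "v \<in> {a..b}" "\<bar>v - t\<bar> < \<delta> t"
    { assume "t \<le> v"
      then have "fine_sum f g \<delta> t v ((g v - g t) *\<^sub>R f t)"
        using v by (intro fine_sum_single) auto
      then show "f t * (g v - g t) \<le> U v - U t"
        using step[of t v] t v by (fastforce simp: mult.commute) }
    { assume "v \<le> t"
      then have "fine_sum f g \<delta> v t ((g t - g v) *\<^sub>R f t)"
        using v by (intro fine_sum_single) auto
      then show "f t * (g t - g v) \<le> U t - U v"
        using step[of v t] t v by (fastforce simp: mult.commute) }
  qed
  ultimately show ?thesis by (intro exI[of _ U]) auto
qed

lemma has_ks_integral_uminus:
  fixes f :: "real \<Rightarrow> real"
  assumes "has_ks_integral abs f g a b I"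
  shows "has_ks_integral abs (\<lambda>t. - f t) g a b (- I)"
proof -
  have eq: "\<bar>(\<Sum>i=1..k. (g (s i) - g (s (i - 1))) *\<^sub>R (- f (\<tau> i))) - (- I)\<bar> =
      \<bar>(\<Sum>i=1..k. (g (s i) - g (s (i - 1))) *\<^sub>R f (\<tau> i)) - I\<bar>" for k s \<tau>
    unfolding scaleR_minus_right sum_negf by linarith
  show ?thesis using assms unfolding has_ks_integral_def eq .
qed

text \<open>
  Let \<open>U n\<close> and \<open>L n\<close> be major and minor functions with total growth within \<open>1 / (n + 1)\<close>
  of \<open>I\<close>. Any \<open>U m - L n\<close> is monotone, so all of them have nearly the same increments and
  \<open>U n - U n a\<close> converges to a function \<open>\<Phi>\<close> whose increments lie between those of \<open>L n\<close> and \<open>U n\<close> for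
  every \<open>n\<close>. The monotone function \<open>U n - L n\<close> then bounds the error of \<open>\<Phi>\<close>.
\<close>

lemma has_ks_integral_imp_ks_primitive_real:
  fixes f :: "real \<Rightarrow> real"
  assumes ab: "a \<le> b" and I: "has_ks_integral abs f g a b I"
  shows "\<exists>\<Phi>. ks_primitive g a b f \<Phi>"
proof -
  define e where "e n = 1 / real (Suc n)" for n
  have e: "e n > 0" for n by (simp add: e_def)
  have e_lim: "e \<longlonglongrightarrow> 0" unfolding e_def by (rule LIMSEQ_inverse_real_of_nat[unfolded inverse_eq_divide])
  have "\<exists>U. U b - U a \<le> I + e n \<and> (\<forall>t\<in>{a..b}. \<exists>\<delta>>0. \<forall>v\<in>{a..b}. \<bar>v - t\<bar> < \<delta> \<longrightarrow>
      (t \<le> v \<longrightarrow> f t * (g v - g t) \<le> U v - U t) \<and> (v \<le> t \<longrightarrow> f t * (g t - g v) \<le> U t - U v))" for n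
    by (rule major_function[OF ab I e])
  then obtain U where U: "\<And>n. U n b - U n a \<le> I + e n"
    "\<And>n t. t \<in> {a..b} \<Longrightarrow> \<exists>\<delta>>0. \<forall>v\<in>{a..b}. \<bar>v - t\<bar> < \<delta> \<longrightarrow>
      (t \<le> v \<longrightarrow> f t * (g v - g t) \<le> U n v - U n t) \<and> (v \<le> t \<longrightarrow> f t * (g t - g v) \<le> U n t - U n v)"
    by metis
  have "\<exists>U. U b - U a \<le> - I + e n \<and> (\<forall>t\<in>{a..b}. \<exists>\<delta>>0. \<forall>v\<in>{a..b}. \<bar>v - t\<bar> < \<delta> \<longrightarrow>
      (t \<le> v \<longrightarrow> - f t * (g v - g t) \<le> U v - U t) \<and> (v \<le> t \<longrightarrow> - f t * (g t - g v) \<le> U t - U v))" for n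
    by (rule major_function[OF ab has_ks_integral_uminus[OF I] e])
  then obtain L' where L': "\<And>n. L' n b - L' n a \<le> - I + e n"
    "\<And>n t. t \<in> {a..b} \<Longrightarrow> \<exists>\<delta>>0. \<forall>v\<in>{a..b}. \<bar>v - t\<bar> < \<delta> \<longrightarrow>
      (t \<le> v \<longrightarrow> - f t * (g v - g t) \<le> L' n v - L' n t) \<and> (v \<le> t \<longrightarrow> - f t * (g t - g v) \<le> L' n t - L' n v)"
    by metis
  define L where "L n t = - L' n t" for n t
  have L: "I - e n \<le> L n b - L n a" for n using L'(1)[of n] by (simp add: L_def)
  have LU: "L m d - L m c \<le> U n d - U n c" if cd: "a \<le> c" "c \<le> d" "d \<le> b" for m n c d
  proof (rule increments_le_if_locally_le[OF cd])
    fix t assume t: "t \<in> {a..b}"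
    obtain \<delta>1 where d1: "\<delta>1 > 0" "\<And>v. v \<in> {a..b} \<Longrightarrow> \<bar>v - t\<bar> < \<delta>1 \<Longrightarrow>
       (t \<le> v \<longrightarrow> f t * (g v - g t) \<le> U n v - U n t) \<and> (v \<le> t \<longrightarrow> f t * (g t - g v) \<le> U n t - U n v)"
      using U(2)[OF t] by blast
    obtain \<delta>2 where d2: "\<delta>2 > 0" "\<And>v. v \<in> {a..b} \<Longrightarrow> \<bar>v - t\<bar> < \<delta>2 \<Longrightarrow>
       (t \<le> v \<longrightarrow> - f t * (g v - g t) \<le> L' m v - L' m t) \<and> (v \<le> t \<longrightarrow> - f t * (g t - g v) \<le> L' m t - L' m v)"
      using L'(2)[OF t] by blast
    show "\<exists>\<delta>>0. \<forall>v\<in>{a..b}. \<bar>v - t\<bar> < \<delta> \<longrightarrow>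
      (t \<le> v \<longrightarrow> L m v - L m t \<le> U n v - U n t) \<and> (v \<le> t \<longrightarrow> L m t - L m v \<le> U n t - U n v)"
      using d1 d2 by (intro exI[of _ "min \<delta>1 \<delta>2"]) (fastforce simp: L_def)
  qed
  have UU: "U n d - U n c \<le> U k d - U k c + (e n + e k)"
    if cd: "a \<le> c" "c \<le> d" "d \<le> b" for n k c d
    using LU[OF order_refl cd(1) order_trans[OF cd(2,3)], of k n] LU[OF cd, of k k] LU[OF _ cd(3) order_refl, of k n]
      U(1)[of n] L[of k] cd by linarith
  \<comment> \<open>By \<open>UU\<close> all \<open>U n\<close> have the same increments up to small errors.\<close>
  have "Cauchy (\<lambda>n. U n t - U n a)" if t: "t \<in> {a..b}" for t
  proof (rule metric_CauchyI)
    fix r :: real assume "r > 0"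
    then obtain M where M: "\<And>n. n \<ge> M \<Longrightarrow> e n < r / 2"
      using order_tendstoD(2)[OF e_lim, of "r / 2"] by (auto simp: eventually_sequentially)
    have "dist (U m t - U m a) (U n t - U n a) < r" if "m \<ge> M" "n \<ge> M" for m n
      using UU[of a t n m] UU[of a t m n] t M[OF that(1)] M[OF that(2)]
      unfolding dist_real_def by auto
    then show "\<exists>M. \<forall>m\<ge>M. \<forall>n\<ge>M. dist (U m t - U m a) (U n t - U n a) < r" by blast
  qed
  then have "\<exists>l. (\<lambda>n. U n t - U n a) \<longlonglongrightarrow> l" if "t \<in> {a..b}" for t
    using that real_Cauchy_convergent convergent_def by blast
  then obtain \<Phi> where \<Phi>: "\<And>t. t \<in> {a..b} \<Longrightarrow> (\<lambda>n. U n t - U n a) \<longlonglongrightarrow> \<Phi> t"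
    by metis
  have lim: "(\<lambda>n. U n d - U n c) \<longlonglongrightarrow> \<Phi> d - \<Phi> c" if "c \<in> {a..b}" "d \<in> {a..b}" for c d
    using tendsto_diff[OF \<Phi>[OF that(2)] \<Phi>[OF that(1)]] by simp
  have \<Phi>L: "L n d - L n c \<le> \<Phi> d - \<Phi> c" if cd: "a \<le> c" "c \<le> d" "d \<le> b" for n c d
    using LU[OF cd, of n] cd by (intro LIMSEQ_le_const[OF lim]) auto
  have \<Phi>U: "\<Phi> d - \<Phi> c \<le> U n d - U n c" if cd: "a \<le> c" "c \<le> d" "d \<le> b" for n c d
  proof -
    have "U k d - U k c \<le> U n d - U n c + 2 * e k" for k
    proof -
      have "U k d - U k c \<le> L k d - L k c + 2 * e k"
        using LU[OF order_refl cd(1) order_trans[OF cd(2,3)], of k k] LU[OF _ cd(3) order_refl, of k k]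
          U(1)[of k] L[of k] cd by linarith
      then show ?thesis using LU[OF cd, of k n] by linarith
    qed
    moreover have "(\<lambda>k. U n d - U n c + 2 * e k) \<longlonglongrightarrow> U n d - U n c + 2 * 0"
      by (intro tendsto_intros e_lim)
    ultimately show ?thesis
      using cd LIMSEQ_le[OF lim, of c d "\<lambda>k. U n d - U n c + 2 * e k"] by auto
  qed
  have "ks_primitive g a b f \<Phi>"
    unfolding ks_primitive_def
  proof (intro allI impI)
    fix \<epsilon> :: real assume "\<epsilon> > 0"
    then obtain n where n: "e n < \<epsilon> / 2"
      using order_tendstoD(2)[OF e_lim, of "\<epsilon> / 2"] by (auto simp: eventually_sequentially)
    define W where "W t = U n t - L n t" for t
    have "mono_on {a..b} W"
      using LU[of _ _ n n] by (fastforce simp: mono_on_def W_def algebra_simps)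
    moreover have "W b - W a \<le> \<epsilon>" using U(1)[of n] L[of n] n by (simp add: W_def)
    moreover have "\<exists>\<delta>>0. \<forall>v\<in>{a..b}. \<bar>v - t\<bar> < \<delta> \<longrightarrow>
           norm ((g v - g t) *\<^sub>R f t - (\<Phi> v - \<Phi> t)) \<le> \<bar>W v - W t\<bar>" if t: "t \<in> {a..b}" for t
    proof -
      obtain \<delta>1 where d1: "\<delta>1 > 0" "\<And>v. v \<in> {a..b} \<Longrightarrow> \<bar>v - t\<bar> < \<delta>1 \<Longrightarrow>
         (t \<le> v \<longrightarrow> f t * (g v - g t) \<le> U n v - U n t) \<and> (v \<le> t \<longrightarrow> f t * (g t - g v) \<le> U n t - U n v)"
        using U(2)[OF t] by blast
      obtain \<delta>2 where d2: "\<delta>2 > 0" "\<And>v. v \<in> {a..b} \<Longrightarrow> \<bar>v - t\<bar> < \<delta>2 \<Longrightarrow>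
         (t \<le> v \<longrightarrow> - f t * (g v - g t) \<le> L' n v - L' n t) \<and> (v \<le> t \<longrightarrow> - f t * (g t - g v) \<le> L' n t - L' n v)"
        using L'(2)[OF t] by blast
      have "norm ((g v - g t) *\<^sub>R f t - (\<Phi> v - \<Phi> t)) \<le> \<bar>W v - W t\<bar>"
        if v: "v \<in> {a..b}" "\<bar>v - t\<bar> < min \<delta>1 \<delta>2" for v
      proof (cases "t \<le> v")
        case True
        then show ?thesis
          using d1(2)[of v] d2(2)[of v] v \<Phi>L[of t v n] \<Phi>U[of t v n] t
          by (auto simp: W_def L_def mult.commute)
      next
        case False
        have "(g v - g t) * f t = - (f t * (g t - g v))" by (simp add: algebra_simps)
        then show ?thesis
          using False d1(2)[of v] d2(2)[of v] v \<Phi>L[of v t n] \<Phi>U[of v t n] t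
          by (auto simp: W_def L_def)
      qed
      then show ?thesis using d1 d2 by (intro exI[of _ "min \<delta>1 \<delta>2"]) auto
    qed
    ultimately show "\<exists>W. mono_on {a..b} W \<and> W b - W a \<le> \<epsilon> \<and>
        (\<forall>t\<in>{a..b}. \<exists>\<delta>>0. \<forall>v\<in>{a..b}. \<bar>v - t\<bar> < \<delta> \<longrightarrow>
           norm ((g v - g t) *\<^sub>R f t - (\<Phi> v - \<Phi> t)) \<le> \<bar>W v - W t\<bar>)" by blast
  qed
  then show ?thesis by blast
qed

text \<open>
  Major functions need an order, so the real case is applied to the components. All norms being
  equivalent, integrability for \<open>N\<close> implies integrability of each component.
\<close>

theorem ks_integrable_imp_ks_primitive:
  fixes f :: "real \<Rightarrow> real ^ 'n"
  assumes N: "is_norm N" and ab: "a \<le> b" and int: "ks_integrable N f g a b"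
  obtains \<Phi> where "ks_primitive g a b f \<Phi>"
proof -
  obtain I where I: "has_ks_integral N f g a b I" using int unfolding ks_integrable_def by blast
  obtain C where C: "C > 0" "\<And>x. norm x \<le> C * N x" using norm_le_is_norm[OF N] by blast
  have "has_ks_integral abs (\<lambda>t. f t $ i) g a b (I $ i)" for i
    unfolding has_ks_integral_def
  proof (intro allI impI)
    fix \<epsilon> :: real assume "\<epsilon> > 0"
    then have "\<epsilon> / C > 0" using C by simp
    then obtain \<delta> where \<delta>: "ks_gauge a b \<delta>" "\<And>k s \<tau>. tagged_partition a b k s \<tau> \<and> fine_partition \<delta> k s \<tau> \<Longrightarrow>
       N ((\<Sum>i=1..k. (g (s i) - g (s (i - 1))) *\<^sub>R f (\<tau> i)) - I) < \<epsilon> / C"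
      using I unfolding has_ks_integral_def by blast
    have "\<bar>(\<Sum>j=1..k. (g (s j) - g (s (j - 1))) *\<^sub>R f (\<tau> j) $ i) - I $ i\<bar> < \<epsilon>"
      if p: "tagged_partition a b k s \<tau> \<and> fine_partition \<delta> k s \<tau>" for k s \<tau>
    proof -
      let ?x = "(\<Sum>i=1..k. (g (s i) - g (s (i - 1))) *\<^sub>R f (\<tau> i)) - I"
      have "\<bar>?x $ i\<bar> \<le> C * N ?x" using component_le_norm_cart[of ?x i] C(2)[of ?x] by linarith
      also have "\<dots> < \<epsilon>" using \<delta>(2)[OF p] C(1) by (simp add: field_simps)
      finally show ?thesis by simp
    qed
    then show "\<exists>\<delta>. ks_gauge a b \<delta> \<and> (\<forall>k s \<tau>. tagged_partition a b k s \<tau> \<and> fine_partition \<delta> k s \<tau> \<longrightarrow>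
       \<bar>(\<Sum>j=1..k. (g (s j) - g (s (j - 1))) *\<^sub>R f (\<tau> j) $ i) - I $ i\<bar> < \<epsilon>)"
      using \<delta>(1) by blast
  qed
  then have "\<exists>\<Phi>. ks_primitive g a b (\<lambda>t. f t $ i) \<Phi>" for i
    using has_ks_integral_imp_ks_primitive_real[OF ab] by blast
  then obtain \<Phi> where "\<And>i. ks_primitive g a b (\<lambda>t. f t $ i) (\<Phi> i)" by metis
  then have "ks_primitive g a b f (\<lambda>t. \<chi> i. \<Phi> i t)"
    by (intro ks_primitive_vec) simp
  then show ?thesis by (rule that)
qed

section \<open>Suprema and dominated convergence\<close>

text \<open>
  The functions that locally, on either side of each point, have the increments of one of
  \<open>\<Phi> 0, \<dots>, \<Phi> m\<close>. They play the part of sums over partitions in which each interval may use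
  a different \<open>\<Phi> k\<close>, but partitions are never named. The bound \<open>m\<close> on the indices is kept because
  for increasing sequences of integrands it makes \<open>\<Phi> m\<close> grow at least as fast as such a function.
\<close>

definition switching ::
    "real \<Rightarrow> real \<Rightarrow> (nat \<Rightarrow> real \<Rightarrow> real) \<Rightarrow> nat \<Rightarrow> (real \<Rightarrow> real) \<Rightarrow> bool" where
  "switching a b \<Phi> m S \<longleftrightarrow>
     (\<forall>t\<in>{a..b}. \<exists>\<delta>>0. \<exists>i\<le>m. \<exists>j\<le>m. \<forall>v\<in>{a..b}. \<bar>v - t\<bar> < \<delta> \<longrightarrow>
        (t \<le> v \<longrightarrow> S v - S t = \<Phi> i v - \<Phi> i t) \<and>
        (v \<le> t \<longrightarrow> S t - S v = \<Phi> j t - \<Phi> j v))"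

lemma switchingE:
  assumes "switching a b \<Phi> m S" "t \<in> {a..b}"
  obtains \<delta> i j where "\<delta> > 0" "i \<le> m" "j \<le> m"
    "\<And>v. v \<in> {a..b} \<Longrightarrow> \<bar>v - t\<bar> < \<delta> \<Longrightarrow> t \<le> v \<Longrightarrow> S v - S t = \<Phi> i v - \<Phi> i t"
    "\<And>v. v \<in> {a..b} \<Longrightarrow> \<bar>v - t\<bar> < \<delta> \<Longrightarrow> v \<le> t \<Longrightarrow> S t - S v = \<Phi> j t - \<Phi> j v"
  using assms unfolding switching_def by (metis (no_types))

lemma switching_self: "k \<le> m \<Longrightarrow> switching a b \<Phi> m (\<Phi> k)"
  unfolding switching_def by (auto intro!: exI[of _ 1] exI[of _ k])

lemma switching_mono:
  assumes "switching a b \<Phi> m S" "m \<le> m'"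
  shows "switching a b \<Phi> m' S"
  unfolding switching_def
proof
  fix t assume "t \<in> {a..b}"
  then obtain \<delta> i j where 1: "\<delta> > 0" "i \<le> m" "j \<le> m"
    "\<And>v. v \<in> {a..b} \<Longrightarrow> \<bar>v - t\<bar> < \<delta> \<Longrightarrow> t \<le> v \<Longrightarrow> S v - S t = \<Phi> i v - \<Phi> i t"
    "\<And>v. v \<in> {a..b} \<Longrightarrow> \<bar>v - t\<bar> < \<delta> \<Longrightarrow> v \<le> t \<Longrightarrow> S t - S v = \<Phi> j t - \<Phi> j v"
    by (rule switchingE[OF assms(1)]) blast
  then show "\<exists>\<delta>>0. \<exists>i\<le>m'. \<exists>j\<le>m'. \<forall>v\<in>{a..b}. \<bar>v - t\<bar> < \<delta> \<longrightarrow>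
        (t \<le> v \<longrightarrow> S v - S t = \<Phi> i v - \<Phi> i t) \<and> (v \<le> t \<longrightarrow> S t - S v = \<Phi> j t - \<Phi> j v)"
    using assms(2) by (intro exI[of _ \<delta>] exI[of _ i] exI[of _ j] conjI ballI impI) auto
qed

text \<open>
  A switching function may be abandoned at any point in favour of another one; this closure
  property is what makes the supremum over all of them additive.
\<close>

lemma switching_glue:
  assumes "switching a b \<Phi> m S" "switching a b \<Phi> m S'" "c \<in> {a..b}"
  shows "switching a b \<Phi> m (\<lambda>t. if t \<le> c then S t else S c + S' t - S' c)" (is "switching a b \<Phi> m ?G")
  unfolding switching_def
proof
  fix t assume t: "t \<in> {a..b}"
  obtain \<delta> i j where 1: "\<delta> > 0" "i \<le> m" "j \<le> m"
    "\<And>v. v \<in> {a..b} \<Longrightarrow> \<bar>v - t\<bar> < \<delta> \<Longrightarrow> t \<le> v \<Longrightarrow> S v - S t = \<Phi> i v - \<Phi> i t"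
    "\<And>v. v \<in> {a..b} \<Longrightarrow> \<bar>v - t\<bar> < \<delta> \<Longrightarrow> v \<le> t \<Longrightarrow> S t - S v = \<Phi> j t - \<Phi> j v"
    by (rule switchingE[OF assms(1) t]) blast
  obtain \<delta>' i' j' where 2: "\<delta>' > 0" "i' \<le> m" "j' \<le> m"
    "\<And>v. v \<in> {a..b} \<Longrightarrow> \<bar>v - t\<bar> < \<delta>' \<Longrightarrow> t \<le> v \<Longrightarrow> S' v - S' t = \<Phi> i' v - \<Phi> i' t"
    "\<And>v. v \<in> {a..b} \<Longrightarrow> \<bar>v - t\<bar> < \<delta>' \<Longrightarrow> v \<le> t \<Longrightarrow> S' t - S' v = \<Phi> j' t - \<Phi> j' v"
    by (rule switchingE[OF assms(2) t]) blast
  consider "t < c" | "t = c" | "t > c" by linarith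
  then show "\<exists>\<delta>>0. \<exists>i\<le>m. \<exists>j\<le>m. \<forall>v\<in>{a..b}. \<bar>v - t\<bar> < \<delta> \<longrightarrow>
        (t \<le> v \<longrightarrow> ?G v - ?G t = \<Phi> i v - \<Phi> i t) \<and>
        (v \<le> t \<longrightarrow> ?G t - ?G v = \<Phi> j t - \<Phi> j v)"
  proof cases
    case lt: 1
    have "min \<delta> (c - t) > 0" using 1(1) lt by simp
    moreover have "(t \<le> v \<longrightarrow> ?G v - ?G t = \<Phi> i v - \<Phi> i t) \<and> (v \<le> t \<longrightarrow> ?G t - ?G v = \<Phi> j t - \<Phi> j v)"
      if "v \<in> {a..b}" "\<bar>v - t\<bar> < min \<delta> (c - t)" for v
      using that 1(4,5)[of v] lt by auto
    ultimately show ?thesis using 1(2,3) by blast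
  next
    case eq: 2
    have "min \<delta> \<delta>' > 0" using 1(1) 2(1) by simp
    moreover have "(t \<le> v \<longrightarrow> ?G v - ?G t = \<Phi> i' v - \<Phi> i' t) \<and> (v \<le> t \<longrightarrow> ?G t - ?G v = \<Phi> j t - \<Phi> j v)"
      if "v \<in> {a..b}" "\<bar>v - t\<bar> < min \<delta> \<delta>'" for v
      using that 1(5)[of v] 2(4)[of v] eq by auto
    ultimately show ?thesis using 1(3) 2(2) by blast
  next
    case gt: 3
    have "min \<delta>' (t - c) > 0" using 2(1) gt by simp
    moreover have "(t \<le> v \<longrightarrow> ?G v - ?G t = \<Phi> i' v - \<Phi> i' t) \<and> (v \<le> t \<longrightarrow> ?G t - ?G v = \<Phi> j' t - \<Phi> j' v)"
      if "v \<in> {a..b}" "\<bar>v - t\<bar> < min \<delta>' (t - c)" for v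
      using that 2(4,5)[of v] gt by auto
    ultimately show ?thesis using 2(2,3) by blast
  qed
qed

lemma switching_increment_le:
  assumes S: "switching a b \<Phi> m S" and cd: "a \<le> c" "c \<le> d" "d \<le> b"
    and dom: "\<And>k u v. k \<le> m \<Longrightarrow> a \<le> u \<Longrightarrow> u \<le> v \<Longrightarrow> v \<le> b \<Longrightarrow> \<Phi> k v - \<Phi> k u \<le> G v - G u"
  shows "S d - S c \<le> G d - G c"
proof (rule increments_le_if_locally_le[OF cd])
  fix t assume t: "t \<in> {a..b}"
  obtain \<delta> i j where 1: "\<delta> > 0" "i \<le> m" "j \<le> m"
    "\<And>v. v \<in> {a..b} \<Longrightarrow> \<bar>v - t\<bar> < \<delta> \<Longrightarrow> t \<le> v \<Longrightarrow> S v - S t = \<Phi> i v - \<Phi> i t"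
    "\<And>v. v \<in> {a..b} \<Longrightarrow> \<bar>v - t\<bar> < \<delta> \<Longrightarrow> v \<le> t \<Longrightarrow> S t - S v = \<Phi> j t - \<Phi> j v"
    by (rule switchingE[OF S t]) blast
  show "\<exists>\<delta>>0. \<forall>v\<in>{a..b}. \<bar>v - t\<bar> < \<delta> \<longrightarrow>
      (t \<le> v \<longrightarrow> S v - S t \<le> G v - G t) \<and> (v \<le> t \<longrightarrow> S t - S v \<le> G t - G v)"
    using 1 t dom[OF 1(2)] dom[OF 1(3)] by (intro exI[of _ \<delta>]) auto
qed

text \<open>
  The primitive \<open>V\<close> is the largest growth achieved by switching functions on \<open>[a, t]\<close>. From
  below, \<open>V\<close> grows at least as fast as every \<open>\<Phi> k\<close>, and some \<open>\<phi> k t\<close> is within \<open>\<epsilon>\<close> of the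
  supremum at \<open>t\<close>. From above, a nearly optimal switching function \<open>S\<close> grows near \<open>t\<close> like some
  \<open>\<Phi> j\<close>, hence at most like the supremum, and \<open>V - S\<close> is monotone with small total growth. The
  errors of all \<open>\<Phi> k\<close> are collected in one monotone function by giving the \<open>k\<close>-th the weight
  \<open>\<epsilon> / 2 ^ k\<close>.
\<close>

theorem ks_primitive_SUP:
  fixes \<phi> \<Phi> :: "nat \<Rightarrow> real \<Rightarrow> real"
  assumes ab: "a \<le> b" and g: "mono_on {a..b} g"
    and prim: "\<And>k. ks_primitive g a b (\<phi> k) (\<Phi> k)"
    and dom: "\<And>k u v. a \<le> u \<Longrightarrow> u \<le> v \<Longrightarrow> v \<le> b \<Longrightarrow> \<Phi> k v - \<Phi> k u \<le> G v - G u"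
    and bdd: "\<And>t. t \<in> {a..b} \<Longrightarrow> bdd_above (range (\<lambda>k. \<phi> k t))"
  obtains V where "ks_primitive g a b (\<lambda>t. SUP k. \<phi> k t) V"
    "\<forall>k u v. a \<le> u \<longrightarrow> u \<le> v \<longrightarrow> v \<le> b \<longrightarrow> \<Phi> k v - \<Phi> k u \<le> V v - V u"
    "\<forall>\<epsilon>>0. \<exists>m S. switching a b \<Phi> m S \<and> V b - V a \<le> S b - S a + \<epsilon>"
proof -
  define A where "A t = {S t - S a | S m. switching a b \<Phi> m S}" for t
  define V where "V t = Sup (A t)" for t
  have inA: "S t - S a \<in> A t" if "switching a b \<Phi> m S" for S m t
    using that unfolding A_def by blast
  have A_ne: "A t \<noteq> {}" for t using inA[OF switching_self[of 0 0 a b \<Phi>]] by blast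
  have A_le: "x \<le> G t - G a" if "x \<in> A t" "t \<in> {a..b}" for x t
    using that switching_increment_le[of a b \<Phi> _ _ a t G] dom by (auto simp: A_def)
  have A_bdd: "bdd_above (A t)" if "t \<in> {a..b}" for t
    using A_le that by (intro bdd_aboveI[of _ "G t - G a"]) blast
  have Va: "V a = 0"
  proof -
    have "A a = {0}" using A_ne[of a] by (auto simp: A_def)
    then show ?thesis by (simp add: V_def)
  qed
  have V_ge: "S v - S u \<le> V v - V u" if S: "switching a b \<Phi> m S" and uv: "a \<le> u" "u \<le> v" "v \<le> b" for S m u v
  proof -
    have "V u \<le> V v - (S v - S u)"
      unfolding V_def
    proof (rule cSup_least[OF A_ne])
      fix x assume "x \<in> A u"
      then obtain S' m' where S': "x = S' u - S' a" "switching a b \<Phi> m' S'" by (auto simp: A_def)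
      let ?S = "\<lambda>t. if t \<le> u then S' t else S' u + S t - S u"
      have "switching a b \<Phi> (max m m') ?S"
        using S S'(2) uv by (intro switching_glue switching_mono[where m' = "max m m'"]) auto
      then have "?S v - ?S a \<in> A v" by (rule inA)
      then have "?S v - ?S a \<le> Sup (A v)" using uv by (intro cSup_upper A_bdd) auto
      moreover have "?S v - ?S a = x + (S v - S u)" using uv S'(1) by auto
      ultimately show "x \<le> Sup (A v) - (S v - S u)" by simp
    qed
    then show ?thesis by simp
  qed
  have V_ge_\<Phi>: "\<Phi> k v - \<Phi> k u \<le> V v - V u" if "a \<le> u" "u \<le> v" "v \<le> b" for k u v
    using V_ge[OF switching_self[OF order_refl] that] .
  have V_approx: "\<exists>m S. switching a b \<Phi> m S \<and> V b - V a \<le> S b - S a + \<epsilon>" if "\<epsilon> > 0" for \<epsilon>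
  proof -
    have "V b - \<epsilon> < Sup (A b)" using that by (simp add: V_def)
    then obtain x where x: "x \<in> A b" "V b - \<epsilon> < x"
      using less_cSupD[OF A_ne] by blast
    then show ?thesis using Va by (force simp: A_def)
  qed
  have "ks_primitive g a b (\<lambda>t. SUP k. \<phi> k t) V"
  proof (rule ks_primitive_scaled[of "g b - g a + 3"])
    show "0 \<le> g b - g a + 3" using g ab by (simp add: mono_on_def add_nonneg_nonneg)
    fix \<epsilon> :: real assume \<epsilon>: "\<epsilon> > 0"
    have pow: "\<epsilon> * (1/2) ^ k > 0" for k :: nat using \<epsilon> by simp
    have "\<exists>W. mono_on {a..b} W \<and> W b - W a \<le> \<epsilon> * (1/2) ^ k \<and>
        (\<forall>t\<in>{a..b}. \<exists>\<delta>>0. \<forall>v\<in>{a..b}. \<bar>v - t\<bar> < \<delta> \<longrightarrow>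
           norm ((g v - g t) *\<^sub>R \<phi> k t - (\<Phi> k v - \<Phi> k t)) \<le> \<bar>W v - W t\<bar>)" for k
      using prim[of k] pow[of k] unfolding ks_primitive_def by blast
    then obtain W where W: "\<And>k. mono_on {a..b} (W k)" "\<And>k. W k b - W k a \<le> \<epsilon> * (1/2) ^ k"
      "\<And>k t. t \<in> {a..b} \<Longrightarrow> \<exists>\<delta>>0. \<forall>v\<in>{a..b}. \<bar>v - t\<bar> < \<delta> \<longrightarrow>
           \<bar>(g v - g t) * \<phi> k t - (\<Phi> k v - \<Phi> k t)\<bar> \<le> \<bar>W k v - W k t\<bar>"
      unfolding real_norm_def real_scaleR_def by metis
    have Wm: "W k u \<le> W k v" if "a \<le> u" "u \<le> v" "v \<le> b" for k u v
      using W(1)[of k] that by (auto simp: mono_on_def)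
    have geo: "(\<lambda>k. \<epsilon> * (1/2) ^ k) sums (\<epsilon> * 2)"
      using sums_mult[OF geometric_sums[of "1/2 :: real"], of \<epsilon>] by simp
    have summ: "summable (\<lambda>k. W k t - W k a)" if t: "t \<in> {a..b}" for t
    proof (rule summable_comparison_test'[of "\<lambda>k. \<epsilon> * (1/2) ^ k" 0])
      show "summable (\<lambda>k. \<epsilon> * (1/2) ^ k)" using geo by (rule sums_summable)
      show "norm (W k t - W k a) \<le> \<epsilon> * (1/2) ^ k" for k
        using W(2)[of k] Wm[of a t k] Wm[of t b k] t by auto
    qed
    define T where "T t = (\<Sum>k. W k t - W k a)" for t
    have T_ge: "W k v - W k u \<le> T v - T u" if uv: "a \<le> u" "u \<le> v" "v \<le> b" for k u v
    proof -
      have s: "summable (\<lambda>k. (W k v - W k a) - (W k u - W k a))"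
        using uv by (intro summable_diff summ) auto
      have "T v - T u = (\<Sum>k. (W k v - W k a) - (W k u - W k a))"
        unfolding T_def using uv by (intro suminf_diff summ) auto
      also have "\<dots> \<ge> (\<Sum>i\<in>{k}. (W i v - W i a) - (W i u - W i a))"
        using Wm[OF uv] by (intro sum_le_suminf s) auto
      finally show ?thesis by simp
    qed
    have T_tot: "T b - T a \<le> \<epsilon> * 2"
    proof -
      have "T b \<le> (\<Sum>k. \<epsilon> * (1/2) ^ k)"
        unfolding T_def using ab W(2) by (intro suminf_le summ sums_summable[OF geo]) auto
      moreover have "T a = 0" by (simp add: T_def)
      ultimately show ?thesis using sums_unique[OF geo] by simp
    qed
    obtain m S where S: "switching a b \<Phi> m S" "V b - V a \<le> S b - S a + \<epsilon>"
      using V_approx[OF \<epsilon>] by blast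
    define Z where "Z t = \<epsilon> * g t + T t + (V t - S t)" for t
    have g_mono: "g u \<le> g v" if "a \<le> u" "u \<le> v" "v \<le> b" for u v
      using g that by (auto simp: mono_on_def)
    have T_mono: "T u \<le> T v" if "a \<le> u" "u \<le> v" "v \<le> b" for u v
      using T_ge[OF that, of 0] Wm[OF that, of 0] by linarith
    have Z_mono: "mono_on {a..b} Z"
      unfolding mono_on_def
    proof (intro allI impI)
      fix u v assume "u \<in> {a..b} \<and> v \<in> {a..b} \<and> u \<le> v"
      then have uv: "a \<le> u" "u \<le> v" "v \<le> b" by auto
      have "\<epsilon> * g u \<le> \<epsilon> * g v" using g_mono[OF uv] \<epsilon> by simp
      then show "Z u \<le> Z v" using T_mono[OF uv] V_ge[OF S(1) uv] by (simp add: Z_def)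
    qed
    have Z_tot: "Z b - Z a \<le> (g b - g a + 3) * \<epsilon>"
      using T_tot S(2) by (simp add: Z_def algebra_simps)
    have "\<exists>\<delta>>0. \<forall>v\<in>{a..b}. \<bar>v - t\<bar> < \<delta> \<longrightarrow>
           norm ((g v - g t) *\<^sub>R (SUP k. \<phi> k t) - (V v - V t)) \<le> \<bar>Z v - Z t\<bar>" if t: "t \<in> {a..b}" for t
    proof -
      let ?s = "SUP k. \<phi> k t"
      have le_s: "\<phi> k t \<le> ?s" for k by (rule cSUP_upper[OF _ bdd[OF t]]) simp
      obtain n where n: "?s - \<epsilon> < \<phi> n t"
        using less_cSUP_iff[OF _ bdd[OF t], of "?s - \<epsilon>"] \<epsilon> by auto
      obtain \<delta>1 i j where 1: "\<delta>1 > 0" "i \<le> m" "j \<le> m"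
        "\<And>v. v \<in> {a..b} \<Longrightarrow> \<bar>v - t\<bar> < \<delta>1 \<Longrightarrow> t \<le> v \<Longrightarrow> S v - S t = \<Phi> i v - \<Phi> i t"
        "\<And>v. v \<in> {a..b} \<Longrightarrow> \<bar>v - t\<bar> < \<delta>1 \<Longrightarrow> v \<le> t \<Longrightarrow> S t - S v = \<Phi> j t - \<Phi> j v"
        by (rule switchingE[OF S(1) t]) blast
      obtain \<delta> where \<delta>: "\<And>k. \<delta> k > 0" "\<And>k v. v \<in> {a..b} \<Longrightarrow> \<bar>v - t\<bar> < \<delta> k \<Longrightarrow>
           \<bar>(g v - g t) * \<phi> k t - (\<Phi> k v - \<Phi> k t)\<bar> \<le> \<bar>W k v - W k t\<bar>"
        using W(3)[OF t] by metis
      define \<delta>' where "\<delta>' = min (min \<delta>1 (\<delta> n)) (min (\<delta> i) (\<delta> j))"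
      have "\<delta>' > 0" using 1(1) \<delta>(1) by (simp add: \<delta>'_def)
      \<comment> \<open>Both one-sided estimates have the form of \<open>key\<close>: \<open>D\<close>, \<open>VV\<close>, \<open>TT\<close>, \<open>SS\<close>, \<open>Pn\<close> stand for
        the increments of \<open>g\<close>, \<open>V\<close>, \<open>T\<close>, \<open>S\<close>, \<open>\<Phi> n\<close>, and \<open>p\<close> for \<open>\<phi> i t\<close> or \<open>\<phi> j t\<close>.\<close>
      have key: "\<bar>D * ?s - VV\<bar> \<le> \<epsilon> * D + TT + (VV - SS)"
        if D: "D \<ge> 0" and n': "\<bar>D * \<phi> n t - Pn\<bar> \<le> Wn" "Wn \<le> TT" "Pn \<le> VV"
          and k': "\<bar>D * p - SS\<bar> \<le> Wk" "Wk \<le> TT" "p \<le> ?s" and "SS \<le> VV" for D VV TT SS Pn Wn Wk p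
      proof -
        have "D * (?s - \<epsilon>) \<le> D * \<phi> n t" using D n by (intro mult_left_mono) auto
        then have "D * ?s - \<epsilon> * D \<le> D * \<phi> n t" by (simp add: algebra_simps)
        moreover have "D * p \<le> D * ?s" using D k'(3) by (intro mult_left_mono) auto
        moreover have "0 \<le> \<epsilon> * D" using D \<epsilon> by simp
        ultimately show ?thesis using n' k' \<open>SS \<le> VV\<close> by linarith
      qed
      have "norm ((g v - g t) *\<^sub>R ?s - (V v - V t)) \<le> \<bar>Z v - Z t\<bar>"
        if v: "v \<in> {a..b}" "\<bar>v - t\<bar> < \<delta>'" for v
      proof (cases "t \<le> v")
        case True
        have tv: "a \<le> t" "t \<le> v" "v \<le> b" using t v True by auto
        have "\<bar>(g v - g t) * ?s - (V v - V t)\<bar> \<le> \<epsilon> * (g v - g t) + (T v - T t) + ((V v - V t) - (S v - S t))"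
        proof (rule key[where p = "\<phi> i t" and Pn = "\<Phi> n v - \<Phi> n t" and Wn = "W n v - W n t" and Wk = "W i v - W i t"])
          show "\<bar>(g v - g t) * \<phi> n t - (\<Phi> n v - \<Phi> n t)\<bar> \<le> W n v - W n t"
            using \<delta>(2)[of v n] v Wm[OF tv, of n] by (simp add: \<delta>'_def)
          show "\<bar>(g v - g t) * \<phi> i t - (S v - S t)\<bar> \<le> W i v - W i t"
            using \<delta>(2)[of v i] v Wm[OF tv, of i] 1(4)[of v] True by (simp add: \<delta>'_def)
        qed (use g_mono[OF tv] T_ge[OF tv] V_ge_\<Phi>[OF tv] V_ge[OF S(1) tv] le_s in auto)
        also have "\<dots> = Z v - Z t" by (simp add: Z_def algebra_simps)
        finally show ?thesis by simp
      next
        case False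
        then have vt: "a \<le> v" "v \<le> t" "t \<le> b" using t v by auto
        have flip: "(g v - g t) * x - y = - ((g t - g v) * x - (- y))" for x y
          by (simp add: algebra_simps)
        have "\<bar>(g t - g v) * ?s - (V t - V v)\<bar> \<le> \<epsilon> * (g t - g v) + (T t - T v) + ((V t - V v) - (S t - S v))"
        proof (rule key[where p = "\<phi> j t" and Pn = "\<Phi> n t - \<Phi> n v" and Wn = "W n t - W n v" and Wk = "W j t - W j v"])
          show "\<bar>(g t - g v) * \<phi> n t - (\<Phi> n t - \<Phi> n v)\<bar> \<le> W n t - W n v"
            using \<delta>(2)[of v n] v Wm[OF vt, of n] flip[of "\<phi> n t"] by (simp add: \<delta>'_def)
          show "\<bar>(g t - g v) * \<phi> j t - (S t - S v)\<bar> \<le> W j t - W j v"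
            using \<delta>(2)[of v j] v Wm[OF vt, of j] 1(5)[of v] vt flip[of "\<phi> j t"] by (simp add: \<delta>'_def)
        qed (use g_mono[OF vt] T_ge[OF vt] V_ge_\<Phi>[OF vt] V_ge[OF S(1) vt] le_s in auto)
        also have "\<dots> = Z t - Z v" by (simp add: Z_def algebra_simps)
        finally show ?thesis using flip[of ?s "V v - V t"] by simp
      qed
      then show ?thesis using \<open>\<delta>' > 0\<close> by blast
    qed
    with Z_mono Z_tot show "\<exists>W. mono_on {a..b} W \<and> W b - W a \<le> (g b - g a + 3) * \<epsilon> \<and>
        (\<forall>t\<in>{a..b}. \<exists>\<delta>>0. \<forall>v\<in>{a..b}. \<bar>v - t\<bar> < \<delta> \<longrightarrow>
           norm ((g v - g t) *\<^sub>R (SUP k. \<phi> k t) - (V v - V t)) \<le> \<bar>W v - W t\<bar>)" by blast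
  qed
  then show ?thesis using V_ge_\<Phi> V_approx by (intro that) auto
qed

text \<open>
  Two applications of the supremum theorem: first to the tails, giving primitives of
  \<open>\<psi> m t = sup {\<phi> k t | k \<ge> m}\<close>, then to the increasing sequence \<open>- \<psi> m\<close>, whose supremum is
  \<open>- f\<close>. Along an increasing sequence a switching function with indices up to \<open>m\<close> does not outgrow
  the \<open>m\<close>-th primitive, so the primitives of \<open>\<psi> m\<close> approach that of \<open>f\<close>; they dominate \<open>\<Phi> k\<close>
  for \<open>k \<ge> m\<close>.
\<close>

lemma ks_primitive_fatou:
  fixes \<phi> \<Phi> :: "nat \<Rightarrow> real \<Rightarrow> real"
  assumes ab: "a \<le> b" and g: "mono_on {a..b} g"
    and prim: "\<And>k. ks_primitive g a b (\<phi> k) (\<Phi> k)"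
    and dom: "\<And>k u v. a \<le> u \<Longrightarrow> u \<le> v \<Longrightarrow> v \<le> b \<Longrightarrow> \<bar>\<Phi> k v - \<Phi> k u\<bar> \<le> G v - G u"
    and lim: "\<And>t. t \<in> {a..b} \<Longrightarrow> (\<lambda>k. \<phi> k t) \<longlonglongrightarrow> f t"
    and Lim: "\<And>t. t \<in> {a..b} \<Longrightarrow> (\<lambda>k. \<Phi> k t) \<longlonglongrightarrow> F t"
  obtains P where "ks_primitive g a b f P" "\<forall>t\<in>{a..b}. F t - F a \<le> P t - P a"
proof -
  define \<psi> where "\<psi> m t = (SUP k. \<phi> (k + m) t)" for m t
  have Bseq: "Bseq (\<lambda>k. \<phi> k t)" if "t \<in> {a..b}" for t
    using lim[OF that] convergentI convergent_imp_Bseq by blast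
  have bdd: "bdd_above (range (\<lambda>k. \<phi> (k + m) t))" if "t \<in> {a..b}" for t m
    using Bseq_bdd_above[OF Bseq_ignore_initial_segment[OF Bseq[OF that], of m]] .
  have "\<exists>V. ks_primitive g a b (\<psi> m) V \<and>
     (\<forall>k u v. a \<le> u \<longrightarrow> u \<le> v \<longrightarrow> v \<le> b \<longrightarrow> \<Phi> (k + m) v - \<Phi> (k + m) u \<le> V v - V u)" for m
  proof -
    have dom': "\<Phi> (k + m) v - \<Phi> (k + m) u \<le> G v - G u" if "a \<le> u" "u \<le> v" "v \<le> b" for k u v
      using dom[OF that, of "k + m"] by linarith
    obtain V where "ks_primitive g a b (\<lambda>t. SUP k. \<phi> (k + m) t) V"
      "\<forall>k u v. a \<le> u \<longrightarrow> u \<le> v \<longrightarrow> v \<le> b \<longrightarrow> \<Phi> (k + m) v - \<Phi> (k + m) u \<le> V v - V u"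
      by (rule ks_primitive_SUP[OF ab g prim dom' bdd])
    then show ?thesis unfolding \<psi>_def by blast
  qed
  then obtain \<Psi> where \<Psi>: "\<And>m. ks_primitive g a b (\<psi> m) (\<Psi> m)"
    "\<And>m k u v. a \<le> u \<Longrightarrow> u \<le> v \<Longrightarrow> v \<le> b \<Longrightarrow> \<Phi> (k + m) v - \<Phi> (k + m) u \<le> \<Psi> m v - \<Psi> m u"
    by metis
  have \<psi>_le: "\<psi> m t \<le> x" if "\<And>k. k \<ge> m \<Longrightarrow> \<phi> k t \<le> x" for m t x
    unfolding \<psi>_def using that by (intro cSUP_least) auto
  have \<psi>_ge: "\<phi> k t \<le> \<psi> m t" if "t \<in> {a..b}" "k \<ge> m" for k m t
    unfolding \<psi>_def using cSUP_upper[OF _ bdd[OF that(1), of m], of "k - m"] that(2) by simp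
  have \<psi>_anti: "\<psi> n t \<le> \<psi> m t" if "t \<in> {a..b}" "m \<le> n" for m n t
    using \<psi>_ge that by (intro \<psi>_le) auto
  have f_le: "f t \<le> \<psi> m t" if "t \<in> {a..b}" for m t
    using \<psi>_ge that by (intro LIMSEQ_le_const2[OF lim[OF that]]) blast
  have \<psi>_inf: "(SUP m. - \<psi> m t) = - f t" if t: "t \<in> {a..b}" for t
  proof (rule antisym)
    show "(SUP m. - \<psi> m t) \<le> - f t" using f_le[OF t] by (intro cSUP_least) auto
    show "- f t \<le> (SUP m. - \<psi> m t)"
    proof (rule field_le_epsilon)
      fix e :: real assume "e > 0"
      then obtain m where m: "\<And>k. k \<ge> m \<Longrightarrow> \<phi> k t < f t + e"
        using order_tendstoD(2)[OF lim[OF t], of "f t + e"] by (auto simp: eventually_sequentially)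
      have "\<psi> m t \<le> f t + e" using m by (intro \<psi>_le) (auto intro: less_imp_le)
      moreover have "- \<psi> m t \<le> (SUP m. - \<psi> m t)"
        using f_le[OF t] by (intro cSUP_upper bdd_aboveI[of _ "- f t"]) auto
      ultimately show "- f t \<le> (SUP m. - \<psi> m t) + e" by linarith
    qed
  qed
  have nprim: "ks_primitive g a b (\<lambda>t. - \<psi> m t) (\<lambda>t. - \<Psi> m t)" for m
    by (rule ks_primitive_uminus[OF \<Psi>(1)])
  have ndom: "- \<Psi> m v - - \<Psi> m u \<le> G v - G u" if "a \<le> u" "u \<le> v" "v \<le> b" for m u v
    using \<Psi>(2)[OF that, of 0 m] dom[OF that, of m] by simp
  have nbdd: "bdd_above (range (\<lambda>m. - \<psi> m t))" if "t \<in> {a..b}" for t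
    using f_le[OF that] by (intro bdd_aboveI[of _ "- f t"]) auto
  obtain V where V: "ks_primitive g a b (\<lambda>t. SUP m. - \<psi> m t) V"
    "\<forall>m u v. a \<le> u \<longrightarrow> u \<le> v \<longrightarrow> v \<le> b \<longrightarrow> - \<Psi> m v - - \<Psi> m u \<le> V v - V u"
    "\<forall>\<epsilon>>0. \<exists>m S. switching a b (\<lambda>m t. - \<Psi> m t) m S \<and> V b - V a \<le> S b - S a + \<epsilon>"
    by (rule ks_primitive_SUP[OF ab g nprim ndom nbdd])
  define P where "P t = - V t" for t
  have "ks_primitive g a b (\<lambda>t. - (SUP m. - \<psi> m t)) (\<lambda>t. - V t)"
    by (rule ks_primitive_uminus[OF V(1)])
  then have "ks_primitive g a b f P"
    by (rule ks_primitive_cong[where c = 0]) (simp_all add: \<psi>_inf P_def)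
  moreover have "F t - F a \<le> P t - P a" if t: "t \<in> {a..b}" for t
  proof (rule field_le_epsilon)
    fix e :: real assume "e > 0"
    then obtain m S where S: "switching a b (\<lambda>m t. - \<Psi> m t) m S" "V b - V a \<le> S b - S a + e"
      using V(3) by blast
    have "S b - S a \<le> - \<Psi> m b - - \<Psi> m a"
    proof (rule switching_increment_le[OF S(1) order_refl ab order_refl])
      fix k u v assume "k \<le> m" "a \<le> u" "u \<le> v" "v \<le> b"
      then show "- \<Psi> k v - - \<Psi> k u \<le> - \<Psi> m v - - \<Psi> m u"
        by (intro ks_primitive_mono[OF g nprim nprim]) (auto intro: \<psi>_anti)
    qed
    then have "V b - V a \<le> - \<Psi> m b + \<Psi> m a + e" using S(2) by simp
    moreover have "- \<Psi> m b - - \<Psi> m t \<le> V b - V t" using V(2) t by simp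
    ultimately have le: "\<Psi> m t - \<Psi> m a \<le> P t - P a + e" by (simp add: P_def)
    have "(\<lambda>k. \<Phi> (k + m) t - \<Phi> (k + m) a) \<longlonglongrightarrow> F t - F a"
      using Lim t ab by (intro tendsto_diff LIMSEQ_ignore_initial_segment) auto
    moreover have "\<Phi> (k + m) t - \<Phi> (k + m) a \<le> P t - P a + e" for k
      using \<Psi>(2)[of a t k m] t le by simp
    ultimately show "F t - F a \<le> P t - P a + e"
      by (intro LIMSEQ_le_const2[where X = "\<lambda>k. \<Phi> (k + m) t - \<Phi> (k + m) a"]) auto
  qed
  ultimately show ?thesis by (intro that) auto
qed

text \<open>
  The Fatou bound for \<open>\<phi>\<close> and for \<open>- \<phi>\<close> encloses \<open>F\<close> between two primitives of \<open>f\<close>,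
  which differ by a constant.
\<close>

theorem ks_primitive_dominated_convergence_real:
  fixes \<phi> \<Phi> :: "nat \<Rightarrow> real \<Rightarrow> real"
  assumes ab: "a \<le> b" and g: "mono_on {a..b} g"
    and prim: "\<And>k. ks_primitive g a b (\<phi> k) (\<Phi> k)"
    and dom: "\<And>k u v. a \<le> u \<Longrightarrow> u \<le> v \<Longrightarrow> v \<le> b \<Longrightarrow> \<bar>\<Phi> k v - \<Phi> k u\<bar> \<le> G v - G u"
    and lim: "\<And>t. t \<in> {a..b} \<Longrightarrow> (\<lambda>k. \<phi> k t) \<longlonglongrightarrow> f t"
    and Lim: "\<And>t. t \<in> {a..b} \<Longrightarrow> (\<lambda>k. \<Phi> k t) \<longlonglongrightarrow> F t"
  shows "ks_primitive g a b f F"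
proof -
  obtain P where P: "ks_primitive g a b f P" "\<forall>t\<in>{a..b}. F t - F a \<le> P t - P a"
    by (rule ks_primitive_fatou[OF ab g prim dom lim Lim])
  have ndom: "\<bar>- \<Phi> k v - - \<Phi> k u\<bar> \<le> G v - G u" if "a \<le> u" "u \<le> v" "v \<le> b" for k u v
    using dom[OF that, of k] by (simp add: abs_minus_commute)
  obtain Q where Q: "ks_primitive g a b (\<lambda>t. - f t) Q" "\<forall>t\<in>{a..b}. - F t - - F a \<le> Q t - Q a"
    by (rule ks_primitive_fatou[OF ab g ks_primitive_uminus[OF prim] ndom tendsto_minus[OF lim] tendsto_minus[OF Lim]])
  have P': "ks_primitive g a b f (\<lambda>t. - Q t)"
    using ks_primitive_uminus[OF Q(1)] by simp
  have "F t = P t + (F a - P a)" if t: "t \<in> {a..b}" for t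
    using ks_primitive_unique[OF g P(1) P', of a t] P(2)[rule_format, OF t] Q(2)[rule_format, OF t] t by simp
  then show ?thesis by (rule ks_primitive_cong[OF P(1) refl])
qed

theorem ks_primitive_dominated_convergence:
  fixes \<phi> \<Phi> :: "nat \<Rightarrow> real \<Rightarrow> real ^ 'n"
  assumes ab: "a \<le> b" and g: "mono_on {a..b} g"
    and prim: "\<And>k. ks_primitive g a b (\<phi> k) (\<Phi> k)"
    and dom: "\<And>k u v. a \<le> u \<Longrightarrow> u \<le> v \<Longrightarrow> v \<le> b \<Longrightarrow> norm (\<Phi> k v - \<Phi> k u) \<le> G v - G u"
    and lim: "\<And>t. t \<in> {a..b} \<Longrightarrow> (\<lambda>k. \<phi> k t) \<longlonglongrightarrow> f t"
    and Lim: "\<And>t. t \<in> {a..b} \<Longrightarrow> (\<lambda>k. \<Phi> k t) \<longlonglongrightarrow> F t"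
  shows "ks_primitive g a b f F"
proof (rule ks_primitive_vec)
  fix i
  have dom': "\<bar>\<Phi> k v $ i - \<Phi> k u $ i\<bar> \<le> G v - G u" if "a \<le> u" "u \<le> v" "v \<le> b" for k u v
    using component_le_norm_cart[of "\<Phi> k v - \<Phi> k u" i] dom[OF that, of k] by simp
  show "ks_primitive g a b (\<lambda>t. f t $ i) (\<lambda>t. F t $ i)"
    by (rule ks_primitive_dominated_convergence_real[where \<phi> = "\<lambda>k t. \<phi> k t $ i"
          and \<Phi> = "\<lambda>k t. \<Phi> k t $ i", OF ab g ks_primitive_component[OF prim] dom'
            tendsto_vec_nth[OF lim] tendsto_vec_nth[OF Lim]])
qed

section \<open>One-sided limits, changes at a point and concatenation of primitives\<close>

lemma eventually_at_left_mem:
  fixes a t :: real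
  assumes "a < t" shows "eventually (\<lambda>s. s \<in> {a..<t}) (at_left t)"
  using eventually_at_left_real[OF assms] by eventually_elim auto

lemma eventually_at_right_mem:
  fixes b t :: real
  assumes "t < b" shows "eventually (\<lambda>s. s \<in> {t<..b}) (at_right t)"
  using eventually_at_right_real[OF assms] by eventually_elim auto

lemma eventually_one_sided_near:
  fixes t :: real
  assumes "F \<le> at t" "\<delta> > 0"
  shows "eventually (\<lambda>s. \<bar>s - t\<bar> < \<delta>) F"
  by (rule filter_leD[OF assms(1)])
    (use assms(2) in \<open>auto simp: eventually_at dist_real_def\<close>)

text \<open>
  A primitive inherits the one-sided limits of the integrator: it is continuous where \<open>g\<close> is, and
  a jump \<open>J\<close> of \<open>g\<close> at \<open>t\<close> produces the jump \<open>J *\<^sub>R f t\<close>.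
\<close>

lemma ks_primitive_tendsto:
  fixes f \<Phi> :: "real \<Rightarrow> 'a::real_normed_vector"
  assumes prim: "ks_primitive g a b f \<Phi>" and t: "t \<in> {a..b}"
    and F: "F \<le> at t" "eventually (\<lambda>s. s \<in> {a..b}) F"
    and g: "(g \<longlongrightarrow> g t + J) F"
  shows "(\<Phi> \<longlongrightarrow> \<Phi> t + J *\<^sub>R f t) F"
proof -
  have "((\<lambda>v. (g v - g t) *\<^sub>R f t - (\<Phi> v - \<Phi> t)) \<longlongrightarrow> 0) F"
  proof (rule tendstoI)
    fix e :: real assume "e > 0"
    then have e2: "e / 2 > 0" by simp
    obtain W where W: "mono_on {a..b} W" "W b - W a \<le> e / 2"
      "\<And>t. t \<in> {a..b} \<Longrightarrow> \<exists>\<delta>>0. \<forall>v\<in>{a..b}. \<bar>v - t\<bar> < \<delta> \<longrightarrow>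
           norm ((g v - g t) *\<^sub>R f t - (\<Phi> v - \<Phi> t)) \<le> \<bar>W v - W t\<bar>"
      by (rule ks_primitiveE[OF prim e2]) blast
    obtain \<delta> where \<delta>: "\<delta> > 0" "\<And>v. v \<in> {a..b} \<Longrightarrow> \<bar>v - t\<bar> < \<delta> \<Longrightarrow>
           norm ((g v - g t) *\<^sub>R f t - (\<Phi> v - \<Phi> t)) \<le> \<bar>W v - W t\<bar>"
      using W(3)[OF t] by blast
    have tot: "\<bar>W v - W t\<bar> \<le> e / 2" if v: "v \<in> {a..b}" for v
    proof -
      have "W a \<le> W v" "W v \<le> W b" "W a \<le> W t" "W t \<le> W b"
        using W(1) t v by (auto simp: mono_on_def)
      then show ?thesis using W(2) by linarith
    qed
    show "eventually (\<lambda>v. dist ((g v - g t) *\<^sub>R f t - (\<Phi> v - \<Phi> t)) 0 < e) F"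
      using F(2) eventually_one_sided_near[OF F(1) \<delta>(1)]
    proof eventually_elim
      case (elim v)
      then show ?case using \<delta>(2)[of v] tot[of v] \<open>e > 0\<close> by simp
    qed
  qed
  then have "((\<lambda>v. (g v - g t) *\<^sub>R f t - ((g v - g t) *\<^sub>R f t - (\<Phi> v - \<Phi> t)) + \<Phi> t) \<longlongrightarrow>
      (g t + J - g t) *\<^sub>R f t - 0 + \<Phi> t) F"
    by (intro tendsto_intros g)
  then show ?thesis by (simp add: add.commute)
qed

text \<open>
  Where \<open>g\<close> is left-continuous, the value of the integrand at a point matters only through the
  jump of \<open>g\<close> to the right of it. The discrepancy near \<open>p\<close> tends to \<open>0\<close> on each side and is
  absorbed by adding two jumps of height \<open>\<epsilon>\<close> to the error function. At the right end point of the
  interval a change of the integrand leaves the primitive as it is.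
\<close>

lemma ks_primitive_update:
  fixes f \<Phi> :: "real \<Rightarrow> 'a::real_normed_vector"
  assumes prim: "ks_primitive g a b f \<Phi>" and p: "p \<in> {a..b}"
    and left: "a < p \<Longrightarrow> (g \<longlongrightarrow> g p) (at_left p)"
    and right: "p < b \<Longrightarrow> (g \<longlongrightarrow> g p + J) (at_right p)"
  shows "ks_primitive g a b (f(p := c)) (\<lambda>t. if t \<le> p then \<Phi> t else \<Phi> t + J *\<^sub>R (c - f p))"
    (is "ks_primitive g a b ?f ?\<Phi>")
proof (rule ks_primitive_scaled[of 3])
  fix \<epsilon> :: real assume \<epsilon>: "\<epsilon> > 0"
  obtain W where W: "mono_on {a..b} W" "W b - W a \<le> \<epsilon>"
    "\<And>t. t \<in> {a..b} \<Longrightarrow> \<exists>\<delta>>0. \<forall>v\<in>{a..b}. \<bar>v - t\<bar> < \<delta> \<longrightarrow>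
         norm ((g v - g t) *\<^sub>R f t - (\<Phi> v - \<Phi> t)) \<le> \<bar>W v - W t\<bar>"
    by (rule ks_primitiveE[OF prim \<epsilon>]) blast
  \<comment> \<open>Separate jumps before and after \<open>p\<close> pay for the change of the integrand on either side.\<close>
  define Z where "Z t = W t + (if t < p then 0 else if t = p then \<epsilon> else 2 * \<epsilon>)" for t
  have "mono_on {a..b} Z"
    unfolding mono_on_def
  proof (intro allI impI)
    fix u v assume uv: "u \<in> {a..b} \<and> v \<in> {a..b} \<and> u \<le> v"
    then have "W u \<le> W v" using W(1) by (auto simp: mono_on_def)
    then show "Z u \<le> Z v" using uv \<epsilon> by (auto simp: Z_def)
  qed
  moreover have "Z b - Z a \<le> 3 * \<epsilon>"
    using W(2) \<epsilon> p by (auto simp: Z_def)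
  moreover have "\<exists>\<delta>>0. \<forall>v\<in>{a..b}. \<bar>v - t\<bar> < \<delta> \<longrightarrow>
           norm ((g v - g t) *\<^sub>R ?f t - (?\<Phi> v - ?\<Phi> t)) \<le> \<bar>Z v - Z t\<bar>" if t: "t \<in> {a..b}" for t
  proof -
    obtain \<delta> where \<delta>: "\<delta> > 0" "\<And>v. v \<in> {a..b} \<Longrightarrow> \<bar>v - t\<bar> < \<delta> \<Longrightarrow>
           norm ((g v - g t) *\<^sub>R f t - (\<Phi> v - \<Phi> t)) \<le> \<bar>W v - W t\<bar>"
      using W(3)[OF t] by blast
    show ?thesis
    proof (cases "t = p")
      case False
      then have "min \<delta> \<bar>t - p\<bar> > 0" using \<delta>(1) by simp
      moreover have "norm ((g v - g t) *\<^sub>R ?f t - (?\<Phi> v - ?\<Phi> t)) \<le> \<bar>Z v - Z t\<bar>"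
        if v: "v \<in> {a..b}" "\<bar>v - t\<bar> < min \<delta> \<bar>t - p\<bar>" for v
      proof -
        have "?\<Phi> v - ?\<Phi> t = \<Phi> v - \<Phi> t" "Z v - Z t = W v - W t"
          using v False by (auto simp: Z_def)
        then show ?thesis using \<delta>(2)[of v] v False by simp
      qed
      ultimately show ?thesis by blast
    next
      case True
      have "\<exists>d>0. \<forall>v\<in>{a..b}. v < p \<and> p - d < v \<longrightarrow> norm ((g v - g p) *\<^sub>R (c - f p)) \<le> \<epsilon>"
      proof (cases "a < p")
        case True
        have "((\<lambda>v. (g v - g p) *\<^sub>R (c - f p)) \<longlongrightarrow> (g p - g p) *\<^sub>R (c - f p)) (at_left p)"
          by (intro tendsto_intros left True)
        then have "((\<lambda>v. (g v - g p) *\<^sub>R (c - f p)) \<longlongrightarrow> 0) (at_left p)" by simp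
        then have "eventually (\<lambda>v. norm ((g v - g p) *\<^sub>R (c - f p)) < \<epsilon>) (at_left p)"
          using \<epsilon> unfolding tendsto_iff by (simp del: norm_scaleR)
        then obtain l where "l < p" "\<And>v. l < v \<Longrightarrow> v < p \<Longrightarrow> norm ((g v - g p) *\<^sub>R (c - f p)) < \<epsilon>"
          by (auto simp: eventually_at_left_field)
        then show ?thesis by (intro exI[of _ "p - l"]) (auto simp del: norm_scaleR intro: less_imp_le)
      qed (use p in \<open>auto intro: exI[of _ 1]\<close>)
      then obtain d1 where d1: "d1 > 0"
        "\<And>v. v \<in> {a..b} \<Longrightarrow> v < p \<Longrightarrow> p - d1 < v \<Longrightarrow> norm ((g v - g p) *\<^sub>R (c - f p)) \<le> \<epsilon>"
        by blast
      have "\<exists>d>0. \<forall>v\<in>{a..b}. p < v \<and> v < p + d \<longrightarrow> norm ((g v - g p - J) *\<^sub>R (c - f p)) \<le> \<epsilon>"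
      proof (cases "p < b")
        case True
        have "((\<lambda>v. (g v - g p - J) *\<^sub>R (c - f p)) \<longlongrightarrow> (g p + J - g p - J) *\<^sub>R (c - f p)) (at_right p)"
          by (intro tendsto_intros right True)
        then have "((\<lambda>v. (g v - g p - J) *\<^sub>R (c - f p)) \<longlongrightarrow> 0) (at_right p)" by simp
        then have "eventually (\<lambda>v. norm ((g v - g p - J) *\<^sub>R (c - f p)) < \<epsilon>) (at_right p)"
          using \<epsilon> unfolding tendsto_iff by (simp del: norm_scaleR)
        then obtain l where "p < l" "\<And>v. p < v \<Longrightarrow> v < l \<Longrightarrow> norm ((g v - g p - J) *\<^sub>R (c - f p)) < \<epsilon>"
          by (auto simp: eventually_at_right_field)
        then show ?thesis by (intro exI[of _ "l - p"]) (auto simp del: norm_scaleR intro: less_imp_le)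
      qed (use p in \<open>auto intro: exI[of _ 1]\<close>)
      then obtain d2 where d2: "d2 > 0"
        "\<And>v. v \<in> {a..b} \<Longrightarrow> p < v \<Longrightarrow> v < p + d2 \<Longrightarrow> norm ((g v - g p - J) *\<^sub>R (c - f p)) \<le> \<epsilon>"
        by blast
      have "norm ((g v - g t) *\<^sub>R ?f t - (?\<Phi> v - ?\<Phi> t)) \<le> \<bar>Z v - Z t\<bar>"
        if v: "v \<in> {a..b}" "\<bar>v - t\<bar> < min \<delta> (min d1 d2)" for v
      proof -
        let ?e = "(g v - g p) *\<^sub>R f p - (\<Phi> v - \<Phi> p)"
        have e: "norm ?e \<le> \<bar>W v - W p\<bar>" using \<delta>(2)[of v] v \<open>t = p\<close> by simp
        consider "v < p" | "v = p" | "p < v" by linarith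
        then show ?thesis
        proof cases
          case 1
          have "(g v - g t) *\<^sub>R ?f t - (?\<Phi> v - ?\<Phi> t) = ?e + (g v - g p) *\<^sub>R (c - f p)"
            using 1 \<open>t = p\<close> by (simp add: algebra_simps)
          moreover have "norm ((g v - g p) *\<^sub>R (c - f p)) \<le> \<epsilon>" using d1(2)[of v] v 1 \<open>t = p\<close> by simp
          moreover have "\<bar>Z v - Z t\<bar> = \<bar>W v - W p\<bar> + \<epsilon>"
            using 1 \<open>t = p\<close> \<epsilon> mono_on_increment_abs(2)[OF W(1) p v(1)] by (simp add: Z_def)
          ultimately show ?thesis using e norm_triangle_le by (metis add_mono)
        next
          case 2
          then show ?thesis using \<open>t = p\<close> by simp
        next
          case 3
          have "(g v - g t) *\<^sub>R ?f t - (?\<Phi> v - ?\<Phi> t) = ?e + (g v - g p - J) *\<^sub>R (c - f p)"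
            using 3 \<open>t = p\<close> by (simp add: algebra_simps)
          moreover have "norm ((g v - g p - J) *\<^sub>R (c - f p)) \<le> \<epsilon>" using d2(2)[of v] v 3 \<open>t = p\<close> by simp
          moreover have "\<bar>Z v - Z t\<bar> = \<bar>W v - W p\<bar> + \<epsilon>"
            using 3 \<open>t = p\<close> \<epsilon> mono_on_increment_abs(1)[OF W(1) p v(1)] by (simp add: Z_def)
          ultimately show ?thesis using e norm_triangle_le by (metis add_mono)
        qed
      qed
      then show ?thesis using \<delta>(1) d1(1) d2(1) by (intro exI[of _ "min \<delta> (min d1 d2)"]) auto
    qed
  qed
  ultimately show "\<exists>W. mono_on {a..b} W \<and> W b - W a \<le> 3 * \<epsilon> \<and>
        (\<forall>t\<in>{a..b}. \<exists>\<delta>>0. \<forall>v\<in>{a..b}. \<bar>v - t\<bar> < \<delta> \<longrightarrow>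
           norm ((g v - g t) *\<^sub>R ?f t - (?\<Phi> v - ?\<Phi> t)) \<le> \<bar>W v - W t\<bar>)" by blast
qed simp

text \<open>
  The left integrand may first be changed at \<open>m\<close> to agree with the right one, without affecting
  its primitive, because \<open>g\<close> is left-continuous there.
\<close>

lemma ks_primitive_glue:
  fixes f1 f2 \<Phi>1 \<Phi>2 :: "real \<Rightarrow> 'a::real_normed_vector"
  assumes m: "a \<le> m" "m \<le> b"
    and prim1: "ks_primitive g a m f1 \<Phi>1" and prim2: "ks_primitive g m b f2 \<Phi>2"
    and left: "a < m \<Longrightarrow> (g \<longlongrightarrow> g m) (at_left m)"
  shows "ks_primitive g a b (\<lambda>t. if t < m then f1 t else f2 t)
    (\<lambda>t. if t \<le> m then \<Phi>1 t else \<Phi>1 m + (\<Phi>2 t - \<Phi>2 m))" (is "ks_primitive g a b ?f ?\<Phi>")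
proof (rule ks_primitive_scaled[of 2])
  fix \<epsilon> :: real assume \<epsilon>: "\<epsilon> > 0"
  have "ks_primitive g a m (f1(m := f2 m)) \<Phi>1"
    by (rule ks_primitive_cong[OF ks_primitive_update[OF prim1 _ left, where J = 0], where c = 0])
      (use m in auto)
  then obtain W1 where W1: "mono_on {a..m} W1" "W1 m - W1 a \<le> \<epsilon>"
    "\<And>t. t \<in> {a..m} \<Longrightarrow> \<exists>\<delta>>0. \<forall>v\<in>{a..m}. \<bar>v - t\<bar> < \<delta> \<longrightarrow>
         norm ((g v - g t) *\<^sub>R (f1(m := f2 m)) t - (\<Phi>1 v - \<Phi>1 t)) \<le> \<bar>W1 v - W1 t\<bar>"
    by (rule ks_primitiveE[OF _ \<epsilon>]) blast
  obtain W2 where W2: "mono_on {m..b} W2" "W2 b - W2 m \<le> \<epsilon>"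
    "\<And>t. t \<in> {m..b} \<Longrightarrow> \<exists>\<delta>>0. \<forall>v\<in>{m..b}. \<bar>v - t\<bar> < \<delta> \<longrightarrow>
         norm ((g v - g t) *\<^sub>R f2 t - (\<Phi>2 v - \<Phi>2 t)) \<le> \<bar>W2 v - W2 t\<bar>"
    by (rule ks_primitiveE[OF prim2 \<epsilon>]) blast
  define Z where "Z t = (if t \<le> m then W1 t else W1 m + (W2 t - W2 m))" for t
  have "mono_on {a..b} Z"
    unfolding mono_on_def
  proof (intro allI impI)
    fix u v assume uv: "u \<in> {a..b} \<and> v \<in> {a..b} \<and> u \<le> v"
    show "Z u \<le> Z v"
    proof (cases "u \<le> m"; cases "v \<le> m")
      assume "u \<le> m" "\<not> v \<le> m"
      then have "W1 u \<le> W1 m" "W2 m \<le> W2 v" using uv W1(1) W2(1) by (auto simp: mono_on_def)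
      with \<open>u \<le> m\<close> \<open>\<not> v \<le> m\<close> show ?thesis by (simp add: Z_def)
    qed (use uv W1(1) W2(1) in \<open>auto simp: Z_def mono_on_def\<close>)
  qed
  moreover have "Z b - Z a \<le> 2 * \<epsilon>"
    using W1(2) W2(2) m \<epsilon> by (cases "b = m") (auto simp: Z_def)
  moreover have "\<exists>\<delta>>0. \<forall>v\<in>{a..b}. \<bar>v - t\<bar> < \<delta> \<longrightarrow>
           norm ((g v - g t) *\<^sub>R ?f t - (?\<Phi> v - ?\<Phi> t)) \<le> \<bar>Z v - Z t\<bar>" if t: "t \<in> {a..b}" for t
  proof -
    consider "t < m" | "t = m" | "m < t" by linarith
    then show ?thesis
    proof cases
      case 1
      then obtain \<delta> where \<delta>: "\<delta> > 0" "\<And>v. v \<in> {a..m} \<Longrightarrow> \<bar>v - t\<bar> < \<delta> \<Longrightarrow>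
         norm ((g v - g t) *\<^sub>R (f1(m := f2 m)) t - (\<Phi>1 v - \<Phi>1 t)) \<le> \<bar>W1 v - W1 t\<bar>"
        using W1(3)[of t] t by (auto simp del: fun_upd_apply)
      have "norm ((g v - g t) *\<^sub>R ?f t - (?\<Phi> v - ?\<Phi> t)) \<le> \<bar>Z v - Z t\<bar>"
        if "v \<in> {a..b}" "\<bar>v - t\<bar> < min \<delta> (m - t)" for v
        using \<delta>(2)[of v] that 1 by (auto simp: Z_def)
      then show ?thesis using 1 \<delta>(1) by (intro exI[of _ "min \<delta> (m - t)"]) auto
    next
      case 2
      then obtain \<delta> where \<delta>: "\<delta> > 0" "\<And>v. v \<in> {a..m} \<Longrightarrow> \<bar>v - t\<bar> < \<delta> \<Longrightarrow>
         norm ((g v - g t) *\<^sub>R (f1(m := f2 m)) t - (\<Phi>1 v - \<Phi>1 t)) \<le> \<bar>W1 v - W1 t\<bar>"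
        using W1(3)[of t] t by (auto simp del: fun_upd_apply)
      obtain \<delta>' where \<delta>': "\<delta>' > 0" "\<And>v. v \<in> {m..b} \<Longrightarrow> \<bar>v - t\<bar> < \<delta>' \<Longrightarrow>
         norm ((g v - g t) *\<^sub>R f2 t - (\<Phi>2 v - \<Phi>2 t)) \<le> \<bar>W2 v - W2 t\<bar>"
        using W2(3)[of t] t 2 by auto
      have "norm ((g v - g t) *\<^sub>R ?f t - (?\<Phi> v - ?\<Phi> t)) \<le> \<bar>Z v - Z t\<bar>"
        if "v \<in> {a..b}" "\<bar>v - t\<bar> < min \<delta> \<delta>'" for v
        using \<delta>(2)[of v] \<delta>'(2)[of v] that 2 by (cases "v \<le> m") (auto simp: Z_def)
      then show ?thesis using \<delta>(1) \<delta>'(1) by (intro exI[of _ "min \<delta> \<delta>'"]) auto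
    next
      case 3
      then obtain \<delta>' where \<delta>': "\<delta>' > 0" "\<And>v. v \<in> {m..b} \<Longrightarrow> \<bar>v - t\<bar> < \<delta>' \<Longrightarrow>
         norm ((g v - g t) *\<^sub>R f2 t - (\<Phi>2 v - \<Phi>2 t)) \<le> \<bar>W2 v - W2 t\<bar>"
        using W2(3)[of t] t by auto
      have "norm ((g v - g t) *\<^sub>R ?f t - (?\<Phi> v - ?\<Phi> t)) \<le> \<bar>Z v - Z t\<bar>"
        if "v \<in> {a..b}" "\<bar>v - t\<bar> < min \<delta>' (t - m)" for v
        using \<delta>'(2)[of v] that 3 by (auto simp: Z_def)
      then show ?thesis using 3 \<delta>'(1) by (intro exI[of _ "min \<delta>' (t - m)"]) auto
    qed
  qed
  ultimately show "\<exists>W. mono_on {a..b} W \<and> W b - W a \<le> 2 * \<epsilon> \<and>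
        (\<forall>t\<in>{a..b}. \<exists>\<delta>>0. \<forall>v\<in>{a..b}. \<bar>v - t\<bar> < \<delta> \<longrightarrow>
           norm ((g v - g t) *\<^sub>R ?f t - (?\<Phi> v - ?\<Phi> t)) \<le> \<bar>W v - W t\<bar>)" by blast
qed simp

lemma mono_on_right_limit:
  fixes g :: "real \<Rightarrow> real"
  assumes "mono_on {a..b} g" "a \<le> t" "t < b"
  obtains l where "(g \<longlongrightarrow> l) (at_right t)"
proof -
  have "(g \<longlongrightarrow> Inf (g ` ({t<..} \<inter> {a..b}))) (at t within ({t<..} \<inter> {a..b}))"
    using assms by (intro Lim_right_bound[where K = "g t"]) (auto simp: mono_on_def)
  moreover have "at t within ({t<..} \<inter> {a..b}) = at_right t"
  proof (rule at_within_nhd[of t "{..<b}"])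
    show "{t<..} \<inter> {a..b} \<inter> {..<b} - {t} = {t<..} \<inter> {..<b} - {t}" using assms by auto
  qed (use assms in auto)
  ultimately show ?thesis using that by simp
qed

section \<open>Fixed points of contractions on a ball\<close>

definition nonexpansive_on_ball :: "('a::real_vector \<Rightarrow> real) \<Rightarrow> real \<Rightarrow> ('a \<Rightarrow> 'a) \<Rightarrow> bool" where
  "nonexpansive_on_ball N r T \<longleftrightarrow> (\<forall>u v. N u \<le> r \<longrightarrow> N v \<le> r \<longrightarrow> N (T u - T v) \<le> N (u - v))"

text \<open>
  In the existence theorem \<open>T\<close> is \<open>h t\<close> or a one-sided limit of it, and \<open>p s = \<phi> s r\<close>. The bound at
  \<open>0\<close> is included because, together with \<open>p r\<close>, it bounds \<open>T\<close> on the whole ball.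
\<close>

definition D_contraction ::
    "('a::real_vector \<Rightarrow> real) \<Rightarrow> (real \<Rightarrow> real) \<Rightarrow> real \<Rightarrow> real \<Rightarrow> ('a \<Rightarrow> 'a) \<Rightarrow> bool" where
  "D_contraction N p r C T \<longleftrightarrow>
     (\<forall>u v. N u \<le> r \<longrightarrow> N v \<le> r \<longrightarrow> N (T u - T v) \<le> p (N (u - v))) \<and> N (T 0) \<le> C"

lemma D_contraction_nonexpansive:
  assumes "is_norm N" "D_function p" "\<forall>t>0. p t < t" "D_contraction N p r C T"
  shows "nonexpansive_on_ball N r T"
proof -
  have "p t \<le> t" if "t \<ge> 0" for t
    using assms(2,3) that by (cases "t = 0") (auto simp: D_function_def intro: less_imp_le)
  then show ?thesis
    using assms(4) is_norm_nonneg[OF assms(1)] unfolding D_contraction_def nonexpansive_on_ball_def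
    by (meson order_trans)
qed

lemma nonexpansive_continuous_on:
  fixes N :: "real ^ 'n \<Rightarrow> real"
  assumes N: "is_norm N" and T: "nonexpansive_on_ball N r T"
  shows "continuous_on {x. N x \<le> r} T"
proof -
  obtain C where C: "C > 0" "\<And>x. norm x \<le> C * N x" using norm_le_is_norm[OF N] by blast
  obtain D where D: "D > 0" "\<And>x. N x \<le> D * norm x" using is_norm_le_norm[OF N] by blast
  have "(C * D)-lipschitz_on {x. N x \<le> r} T"
  proof (rule lipschitz_onI)
    fix x y assume xy: "x \<in> {x. N x \<le> r}" "y \<in> {x. N x \<le> r}"
    have "norm (T x - T y) \<le> C * N (T x - T y)" by (rule C(2))
    also have "\<dots> \<le> C * N (x - y)"
      using T xy C(1) by (simp add: nonexpansive_on_ball_def)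
    also have "\<dots> \<le> C * (D * norm (x - y))" using D(2) C(1) by (intro mult_left_mono) auto
    finally show "dist (T x) (T y) \<le> C * D * dist x y" by (simp add: dist_norm)
  qed (use C D in simp)
  then show ?thesis by (rule lipschitz_on_continuous_on)
qed

text \<open>
  Pointwise convergence of maps that do not expand distances is uniform on a ball, which has finite
  nets.
\<close>

lemma nonexpansive_limit_uniform:
  fixes N :: "real ^ 'n \<Rightarrow> real"
  assumes N: "is_norm N" and F: "F \<noteq> bot"
    and ne: "eventually (\<lambda>s. nonexpansive_on_ball N r (h s)) F"
    and lim: "\<And>w. ((\<lambda>s. h s w) \<longlongrightarrow> L w) F" and e: "e > 0"
  shows "eventually (\<lambda>s. \<forall>w. N w \<le> r \<longrightarrow> N (h s w - L w) < e) F"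
proof -
  have neL: "N (L u - L v) \<le> N (u - v)" if "N u \<le> r" "N v \<le> r" for u v
    by (rule tendsto_upperbound[OF is_norm_tendsto[OF N tendsto_diff[OF lim[of u] lim[of v]]] _ F])
      (use ne that in \<open>auto elim!: eventually_mono simp: nonexpansive_on_ball_def\<close>)
  obtain K where K: "finite K" "\<And>w. w \<in> K \<Longrightarrow> N w \<le> r" "\<And>x. N x \<le> r \<Longrightarrow> \<exists>w\<in>K. N (x - w) < e / 3"
    using is_norm_ball_net[OF N, of "e / 3" r] e by auto
  have "eventually (\<lambda>s. N (h s w - L w) < e / 3) F" for w
    using order_tendstoD(2)[OF is_norm_diff_tendsto_0[OF N lim[of w]], of "e / 3"] e by simp
  then have "eventually (\<lambda>s. \<forall>w\<in>K. N (h s w - L w) < e / 3) F"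
    using K(1) by (simp add: eventually_ball_finite)
  with ne show ?thesis
  proof eventually_elim
    case (elim s)
    show ?case
    proof (intro allI impI)
      fix x assume x: "N x \<le> r"
      then obtain w where w: "w \<in> K" "N (x - w) < e / 3" using K(3) by blast
      have "N (h s x - h s w) \<le> N (x - w)" using elim(1) x K(2)[OF w(1)] by (simp add: nonexpansive_on_ball_def)
      moreover have "N (L w - L x) \<le> N (x - w)"
        using neL[OF K(2)[OF w(1)] x] by (simp add: is_norm_commute[OF N])
      moreover have "N (h s w - L w) < e / 3" using elim(2) w(1) by blast
      ultimately show "N (h s x - L x) < e"
        using is_norm_diff_triangle[OF N, of "h s x" "L x" "h s w"] 
          is_norm_diff_triangle[OF N, of "h s w" "L x" "L w"] w(2) by linarith
    qed
  qed
qed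

lemma D_contraction_limit:
  fixes N :: "real ^ 'n \<Rightarrow> real"
  assumes N: "is_norm N" and F: "F \<noteq> bot"
    and con: "eventually (\<lambda>s. D_contraction N p r C (h s)) F"
    and lim: "\<And>w. ((\<lambda>s. h s w) \<longlongrightarrow> L w) F"
  shows "D_contraction N p r C L"
  unfolding D_contraction_def
proof (intro conjI allI impI)
  fix u v assume uv: "N u \<le> r" "N v \<le> r"
  show "N (L u - L v) \<le> p (N (u - v))"
    by (rule tendsto_upperbound[OF is_norm_tendsto[OF N tendsto_diff[OF lim[of u] lim[of v]]] _ F])
      (use con uv in \<open>auto elim!: eventually_mono simp: D_contraction_def\<close>)
next
  show "N (L 0) \<le> C"
    by (rule tendsto_upperbound[OF is_norm_tendsto[OF N lim[of 0]] _ F])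
      (use con in \<open>auto elim!: eventually_mono simp: D_contraction_def\<close>)
qed

text \<open>
  The bound on \<open>y\<close> makes \<open>u \<mapsto> y + T u\<close> a self-map of the compact ball. A minimum point of
  \<open>N (u - (y + T u))\<close> must be fixed, since applying the map once more would decrease this distance
  (Edelstein's argument).
\<close>

lemma D_contraction_resolvent_exists:
  fixes N :: "real ^ 'n \<Rightarrow> real"
  assumes N: "is_norm N" and p: "D_function p" "\<forall>t>0. p t < t"
    and T: "D_contraction N p r C T" and r: "r \<ge> 0" and y: "N y + p r + C \<le> r"
  shows "\<exists>u. N u \<le> r \<and> u = y + T u"
proof -
  let ?B = "{x. N x \<le> r}"
  let ?T = "\<lambda>u. y + T u"
  have self: "N (?T u) \<le> r" if u: "N u \<le> r" for u
  proof -
    have "N (T u - T 0) \<le> p (N (u - 0))"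
      using conjunct1[OF T[unfolded D_contraction_def], rule_format, of u 0] u r
      by (simp add: is_norm_zero[OF N])
    also have "\<dots> \<le> p r"
      using p(1) u is_norm_nonneg[OF N, of u] r by (auto simp: D_function_def mono_on_def)
    finally have "N (T u - T 0) \<le> p r" .
    moreover have "N (T 0) \<le> C" using T by (simp add: D_contraction_def)
    moreover have "N (y + ((T u - T 0) + T 0)) \<le> N y + (N (T u - T 0) + N (T 0))"
      using is_norm_triangle[OF N, of y "(T u - T 0) + T 0"] is_norm_triangle[OF N, of "T u - T 0" "T 0"]
      by linarith
    ultimately show ?thesis using y by simp
  qed
  have ne: "nonexpansive_on_ball N r T" by (rule D_contraction_nonexpansive[OF N p T])
  have "continuous_on ?B (\<lambda>u. u - ?T u)"
    by (intro continuous_intros nonexpansive_continuous_on[OF N ne])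
  then have cont: "continuous_on ?B (\<lambda>u. N (u - ?T u))"
    using continuous_on_compose2[OF is_norm_continuous_on[OF N, of UNIV]] by blast
  have "0 \<in> ?B" using r by (simp add: is_norm_zero[OF N])
  then obtain u where u: "u \<in> ?B" "\<And>v. v \<in> ?B \<Longrightarrow> N (u - ?T u) \<le> N (v - ?T v)"
    using continuous_attains_inf[OF compact_is_norm_ball[OF N] _ cont] by blast
  have "u = ?T u"
  proof (rule ccontr)
    assume "u \<noteq> ?T u"
    then have pos: "N (u - ?T u) > 0"
      using is_norm_nonneg[OF N, of "u - ?T u"] is_norm_eq_0[OF N, of "u - ?T u"] by simp
    have v: "N (?T u) \<le> r" using self u(1) by simp
    have "N (?T u - ?T (?T u)) = N (T u - T (?T u))" by simp
    also have "\<dots> \<le> p (N (u - ?T u))" using T u(1) v unfolding D_contraction_def by blast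
    also have "\<dots> < N (u - ?T u)" using p(2) pos by simp
    finally show False using u(2)[of "?T u"] v by simp
  qed
  then show ?thesis using u(1) by blast
qed

text \<open>
  The fixed point depends continuously on \<open>y\<close> and on the map, uniformly over all contractions with
  the same \<open>p\<close>. For a distance \<open>d\<close> between two fixed points, \<open>d - p d\<close> is at most the sum of the
  two perturbations, while on \<open>[e, 2 * r]\<close> the continuous function \<open>d - p d\<close> has a positive lower
  bound.
\<close>

lemma D_contraction_resolvent_modulus:
  fixes N :: "real ^ 'n \<Rightarrow> real"
  assumes N: "is_norm N" and p: "D_function p" "\<forall>t>0. p t < t" and e: "e > 0"
  shows "\<exists>\<eta>>0. \<forall>T T' y y' u u'. D_contraction N p r C T \<longrightarrow> N u \<le> r \<longrightarrow> N u' \<le> r \<longrightarrow>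
     u = y + T u \<longrightarrow> u' = y' + T' u' \<longrightarrow> N (y - y') < \<eta> \<longrightarrow> N (T u' - T' u') < \<eta> \<longrightarrow> N (u - u') < e"
proof -
  have "\<exists>\<eta>>0. \<forall>d. d \<ge> e \<longrightarrow> d \<le> 2 * r \<longrightarrow> 2 * \<eta> \<le> d - p d"
  proof (cases "e \<le> 2 * r")
    case True
    have "continuous_on {e..2 * r} p"
      using p(1) e by (auto simp: D_function_def elim: continuous_on_subset)
    then have "continuous_on {e..2 * r} (\<lambda>d. d - p d)" by (intro continuous_intros)
    then obtain m where m: "m \<in> {e..2 * r}" "\<And>d. d \<in> {e..2 * r} \<Longrightarrow> m - p m \<le> d - p d"
      using continuous_attains_inf[of "{e..2 * r}" "\<lambda>d. d - p d"] True by auto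
    have "2 * ((m - p m) / 2) \<le> d - p d" if "d \<ge> e" "d \<le> 2 * r" for d
      using m(2)[of d] that by simp
    then show ?thesis using p(2) m(1) e by (intro exI[of _ "(m - p m) / 2"]) auto
  qed (auto intro: exI[of _ 1])
  then obtain \<eta> where \<eta>: "\<eta> > 0" "\<And>d. d \<ge> e \<Longrightarrow> d \<le> 2 * r \<Longrightarrow> 2 * \<eta> \<le> d - p d" by blast
  show ?thesis
  proof (intro exI[of _ \<eta>] conjI \<eta>(1) allI impI)
    fix T T' :: "real ^ 'n \<Rightarrow> real ^ 'n" and y y' u u'
    assume T: "D_contraction N p r C T" and u: "N u \<le> r" "N u' \<le> r" "u = y + T u" "u' = y' + T' u'"
      and y: "N (y - y') < \<eta>" and d: "N (T u' - T' u') < \<eta>"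
    show "N (u - u') < e"
    proof (rule ccontr)
      assume "\<not> N (u - u') < e"
      moreover have "N (u - u') \<le> 2 * r"
        using is_norm_triangle[OF N, of u "- u'"] u(1,2) by (simp add: is_norm_minus[OF N])
      ultimately have ge: "2 * \<eta> \<le> N (u - u') - p (N (u - u'))" using \<eta>(2) by simp
      have "u - u' = (y - y') + ((T u - T u') + (T u' - T' u'))"
        by (subst u(3), subst u(4)) simp
      then have "N (u - u') \<le> N (y - y') + (N (T u - T u') + N (T u' - T' u'))"
        using is_norm_triangle[OF N, of "y - y'" "(T u - T u') + (T u' - T' u')"]
          is_norm_triangle[OF N, of "T u - T u'" "T u' - T' u'"] by simp
      moreover have "N (T u - T u') \<le> p (N (u - u'))" using T u unfolding D_contraction_def by blast
      ultimately show False using ge y d by linarith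
    qed
  qed
qed

definition resolvent :: "('a::real_vector \<Rightarrow> real) \<Rightarrow> real \<Rightarrow> ('a \<Rightarrow> 'a) \<Rightarrow> 'a \<Rightarrow> 'a" where
  "resolvent N r T y = (SOME u. N u \<le> r \<and> u = y + T u)"

lemma resolvent_fixed_point:
  fixes N :: "real ^ 'n \<Rightarrow> real"
  assumes "is_norm N" "D_function p" "\<forall>t>0. p t < t"
    and "D_contraction N p r C T" "r \<ge> 0" "N y \<le> r - p r - C"
  shows "N (resolvent N r T y) \<le> r" "resolvent N r T y = y + T (resolvent N r T y)"
proof -
  have "\<exists>u. N u \<le> r \<and> u = y + T u"
    by (rule D_contraction_resolvent_exists[OF assms(1-5)]) (use assms(6) in auto)
  from someI_ex[OF this]
  show "N (resolvent N r T y) \<le> r" "resolvent N r T y = y + T (resolvent N r T y)"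
    unfolding resolvent_def[symmetric] by auto
qed

text \<open>
  For \<open>F\<close> a one-sided neighbourhood filter this gives uniform one-sided limits of
  \<open>s \<mapsto> resolvent N r (h s)\<close>; for a constant \<open>h\<close> it is uniform continuity of the resolvent.
\<close>

lemma resolvent_one_sided_limit:
  fixes N :: "real ^ 'n \<Rightarrow> real"
  assumes N: "is_norm N" and p: "D_function p" "\<forall>t>0. p t < t" and r: "r \<ge> 0"
    and F: "F \<noteq> bot" and con: "eventually (\<lambda>s. D_contraction N p r C (h s)) F"
    and lim: "\<And>w. ((\<lambda>s. h s w) \<longlongrightarrow> L w) F"
  shows "\<forall>y. N y \<le> r - p r - C \<longrightarrow> N (resolvent N r L y) \<le> r"
    and "\<forall>\<epsilon>>0. \<exists>\<eta>>0. eventually (\<lambda>s. \<forall>y y'. N y \<le> r - p r - C \<longrightarrow> N y' \<le> r - p r - C \<longrightarrow>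
      N (y - y') < \<eta> \<longrightarrow> N (resolvent N r (h s) y - resolvent N r L y') < \<epsilon>) F"
proof -
  have L: "D_contraction N p r C L" by (rule D_contraction_limit[OF N F con lim])
  show "\<forall>y. N y \<le> r - p r - C \<longrightarrow> N (resolvent N r L y) \<le> r"
    using resolvent_fixed_point(1)[OF N p L r] by blast
  show "\<forall>\<epsilon>>0. \<exists>\<eta>>0. eventually (\<lambda>s. \<forall>y y'. N y \<le> r - p r - C \<longrightarrow> N y' \<le> r - p r - C \<longrightarrow>
      N (y - y') < \<eta> \<longrightarrow> N (resolvent N r (h s) y - resolvent N r L y') < \<epsilon>) F"
  proof (intro allI impI)
    fix \<epsilon> :: real assume \<epsilon>: "\<epsilon> > 0"
    obtain \<eta> where \<eta>: "\<eta> > 0" "\<forall>T T' y y' u u'. D_contraction N p r C T \<longrightarrow> N u \<le> r \<longrightarrow> N u' \<le> r \<longrightarrow>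
       u = y + T u \<longrightarrow> u' = y' + T' u' \<longrightarrow> N (y - y') < \<eta> \<longrightarrow> N (T u' - T' u') < \<eta> \<longrightarrow> N (u - u') < \<epsilon>"
      using D_contraction_resolvent_modulus[OF N p \<epsilon>, of r C] by (elim exE conjE)
    have "eventually (\<lambda>s. nonexpansive_on_ball N r (h s)) F"
      using con by (rule eventually_mono) (rule D_contraction_nonexpansive[OF N p])
    from nonexpansive_limit_uniform[OF N F this lim \<eta>(1)]
    have "eventually (\<lambda>s. \<forall>y y'. N y \<le> r - p r - C \<longrightarrow> N y' \<le> r - p r - C \<longrightarrow>
      N (y - y') < \<eta> \<longrightarrow> N (resolvent N r (h s) y - resolvent N r L y') < \<epsilon>) F"
      using con
    proof eventually_elim
      case (elim s)
      show ?case
      proof (intro allI impI)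
        fix y y' assume y: "N y \<le> r - p r - C" "N y' \<le> r - p r - C" "N (y - y') < \<eta>"
        note 1 = resolvent_fixed_point[OF N p elim(2) r y(1)]
        note 2 = resolvent_fixed_point[OF N p L r y(2)]
        show "N (resolvent N r (h s) y - resolvent N r L y') < \<epsilon>"
          by (rule \<eta>(2)[rule_format, where T = "h s" and T' = L, OF elim(2) 1(1) 2(1) 1(2) 2(2) y(3)]) (use elim(1) 2(1) in blast)
      qed
    qed
    then show "\<exists>\<eta>>0. eventually (\<lambda>s. \<forall>y y'. N y \<le> r - p r - C \<longrightarrow> N y' \<le> r - p r - C \<longrightarrow>
      N (y - y') < \<eta> \<longrightarrow> N (resolvent N r (h s) y - resolvent N r L y') < \<epsilon>) F"
      using \<eta>(1) by blast
  qed
qed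

section \<open>Integral equations with a state given implicitly\<close>

text \<open>
  A selection principle of Helly type. The common bound by increments of \<open>Q\<close> makes the functions
  equicontinuous for the pseudometric \<open>\<bar>Q s - Q t\<bar>\<close>, whose countable dense subsets need not be
  dense in \<open>[a, b]\<close> but must represent the jumps of \<open>Q\<close>. Convergence on such a set spreads to
  every point.
\<close>

lemma mono_controlled_subsequence:
  fixes y :: "nat \<Rightarrow> real \<Rightarrow> real ^ 'n" and Q :: "real \<Rightarrow> real"
  assumes ab: "a \<le> b" and bdd: "norm (y 0 a) \<le> B" "\<And>n. y n a = y 0 a"
    and ctrl: "\<And>n c d. a \<le> c \<Longrightarrow> c \<le> d \<Longrightarrow> d \<le> b \<Longrightarrow> norm (y n d - y n c) \<le> Q d - Q c"
  obtains k z where "strict_mono (k :: nat \<Rightarrow> nat)" "\<forall>t\<in>{a..b}. (\<lambda>n. y (k n) t) \<longlonglongrightarrow> z t"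
proof -
  obtain T where T: "countable T" "T \<subseteq> Q ` {a..b}" "Q ` {a..b} \<subseteq> closure T"
    using separable by metis
  obtain D where D: "countable D" "D \<subseteq> {a..b}" "T = Q ` D"
    using T(1,2) countable_subset_image by metis
  have close: "norm (y n s - y n t) \<le> \<bar>Q s - Q t\<bar>" if "s \<in> {a..b}" "t \<in> {a..b}" for n s t
  proof (cases "t \<le> s")
    case True
    then show ?thesis using ctrl[of t s n] that by auto
  next
    case False
    then show ?thesis using ctrl[of s t n] that by (auto simp: norm_minus_commute)
  qed
  have bound: "norm (y n t) \<le> B + (Q b - Q a)" if "t \<in> D" for n t
  proof -
    have "t \<in> {a..b}" using that D(2) by blast
    then have "norm (y n t - y n a) \<le> Q t - Q a" "0 \<le> Q b - Q t"
      using ctrl[of a t n] order_trans[OF norm_ge_zero ctrl[of t b n]] by auto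
    moreover have "norm (y n t) \<le> norm (y n t - y n a) + norm (y n a)"
      using norm_triangle_ineq[of "y n t - y n a" "y n a"] by simp
    ultimately show ?thesis using bdd(1) bdd(2)[of n] by simp
  qed
  obtain k where k: "strict_mono (k :: nat \<Rightarrow> nat)" "\<And>t. t \<in> D \<Longrightarrow> \<exists>l. (\<lambda>n. y (k n) t) \<longlonglongrightarrow> l"
    using function_convergent_subsequence[OF D(1), of y "B + (Q b - Q a)"] bound by blast
  have "Cauchy (\<lambda>n. y (k n) t)" if t: "t \<in> {a..b}" for t
  proof (rule metric_CauchyI)
    fix e :: real assume e: "e > 0"
    have "Q t \<in> closure T" using T(3) t by blast
    then obtain s where s: "s \<in> D" "\<bar>Q s - Q t\<bar> < e / 3"
      using e D(3) unfolding closure_approachable dist_real_def by (force dest: spec[of _ "e / 3"])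
    have "Cauchy (\<lambda>n. y (k n) s)" using k(2)[OF s(1)] LIMSEQ_imp_Cauchy by blast
    then obtain M where M: "\<And>m n. m \<ge> M \<Longrightarrow> n \<ge> M \<Longrightarrow> dist (y (k m) s) (y (k n) s) < e / 3"
      using e unfolding Cauchy_def by (metis zero_less_divide_iff zero_less_numeral)
    have "dist (y (k m) t) (y (k n) t) < e" if "m \<ge> M" "n \<ge> M" for m n
    proof -
      have s': "s \<in> {a..b}" using s(1) D(2) by blast
      have "dist (y (k m) t) (y (k n) t) \<le>
          dist (y (k m) t) (y (k m) s) + dist (y (k m) s) (y (k n) s) + dist (y (k n) s) (y (k n) t)"
        by (meson add_right_mono dist_triangle order_trans)
      moreover have "dist (y (k m) t) (y (k m) s) < e / 3" "dist (y (k n) s) (y (k n) t) < e / 3"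
        using close[OF t s', of "k m"] close[OF s' t, of "k n"] s(2) by (auto simp: dist_norm abs_minus_commute)
      ultimately show ?thesis using M[OF that] by linarith
    qed
    then show "\<exists>M. \<forall>m\<ge>M. \<forall>n\<ge>M. dist (y (k m) t) (y (k n) t) < e" by blast
  qed
  then have "\<exists>l. (\<lambda>n. y (k n) t) \<longlonglongrightarrow> l" if "t \<in> {a..b}" for t
    using that Cauchy_convergent convergent_def by blast
  then obtain z where "\<forall>t\<in>{a..b}. (\<lambda>n. y (k n) t) \<longlonglongrightarrow> z t" by metis
  with k(1) show ?thesis by (rule that)
qed

text \<open>
  The equation \<open>y t = c + \<integral> f(s, R s (y s)) dg(s)\<close>, where \<open>R s\<close> recovers the state from \<open>y s\<close>.
  The ball of radius \<open>\<rho>\<close> contains the values of \<open>y\<close>, that of radius \<open>r\<close> the states. Where \<open>R\<close>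
  jumps, \<open>R t\<close> and its two one-sided limits at \<open>t\<close> may all differ, as happens for the resolvents of
  a regulated \<open>h\<close>. The function \<open>Q\<close> stands for an indefinite integral of \<open>M(s, r)\<close>.
\<close>

locale implicit_measure_ode =
  fixes N :: "real ^ 'n \<Rightarrow> real" and g Q :: "real \<Rightarrow> real" and a b :: real
    and f R :: "real \<Rightarrow> real ^ 'n \<Rightarrow> real ^ 'n" and r \<rho> :: real
  assumes N: "is_norm N" and ab: "a < b"
    and g_mono: "mono_on {a..b} g" and g_left: "\<And>t. t \<in> {a<..b} \<Longrightarrow> (g \<longlongrightarrow> g t) (at_left t)"
    and Q_mono: "mono_on {a..b} Q" and Q_left: "\<And>t. t \<in> {a<..b} \<Longrightarrow> (Q \<longlongrightarrow> Q t) (at_left t)"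
    and f_cont: "\<And>t. t \<in> {a..b} \<Longrightarrow> continuous_on UNIV (f t)"
    and f_prim: "\<And>u. N u \<le> r \<Longrightarrow> \<exists>\<Phi>. ks_primitive g a b (\<lambda>s. f s u) \<Phi> \<and>
      (\<forall>c d. a \<le> c \<longrightarrow> c \<le> d \<longrightarrow> d \<le> b \<longrightarrow> N (\<Phi> d - \<Phi> c) \<le> Q d - Q c)"
    and R_ball: "\<And>s y. s \<in> {a..b} \<Longrightarrow> N y \<le> \<rho> \<Longrightarrow> N (R s y) \<le> r"
    and R_cont: "\<And>s y \<epsilon>. s \<in> {a..b} \<Longrightarrow> N y \<le> \<rho> \<Longrightarrow> \<epsilon> > 0 \<Longrightarrow>
      \<exists>\<delta>>0. \<forall>y'. N y' \<le> \<rho> \<longrightarrow> N (y' - y) < \<delta> \<longrightarrow> N (R s y' - R s y) < \<epsilon>"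
    and R_left: "\<And>t. t \<in> {a<..b} \<Longrightarrow> \<exists>L. (\<forall>y. N y \<le> \<rho> \<longrightarrow> N (L y) \<le> r) \<and>
      (\<forall>\<epsilon>>0. \<exists>\<delta>>0. \<forall>s\<in>{a..b}. \<forall>y y'. t - \<delta> < s \<longrightarrow> s < t \<longrightarrow> N y \<le> \<rho> \<longrightarrow> N y' \<le> \<rho> \<longrightarrow>
        N (y - y') < \<delta> \<longrightarrow> N (R s y - L y') < \<epsilon>)"
    and R_right: "\<And>t. t \<in> {a..<b} \<Longrightarrow> \<exists>L. (\<forall>y. N y \<le> \<rho> \<longrightarrow> N (L y) \<le> r) \<and>
      (\<forall>\<epsilon>>0. \<exists>\<delta>>0. \<forall>s\<in>{a..b}. \<forall>y y'. t < s \<longrightarrow> s < t + \<delta> \<longrightarrow> N y \<le> \<rho> \<longrightarrow> N y' \<le> \<rho> \<longrightarrow>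
        N (y - y') < \<delta> \<longrightarrow> N (R s y - L y') < \<epsilon>)"
begin

definition controlled :: "real \<Rightarrow> real \<Rightarrow> (real \<Rightarrow> real ^ 'n) \<Rightarrow> bool" where
  "controlled u v y \<longleftrightarrow> (\<forall>c d. u \<le> c \<longrightarrow> c \<le> d \<longrightarrow> d \<le> v \<longrightarrow> N (y d - y c) \<le> Q d - Q c)"

text \<open>
  The right end point is left out of the error bound: since \<open>g\<close> is left-continuous, the value of
  \<open>x\<close> there does not influence \<open>y\<close>, and adjacent solutions can be joined whatever it is.
\<close>

definition approx_solution ::
    "real \<Rightarrow> real \<Rightarrow> real \<Rightarrow> real ^ 'n \<Rightarrow> (real \<Rightarrow> real ^ 'n) \<Rightarrow> (real \<Rightarrow> real ^ 'n) \<Rightarrow> bool" where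
  "approx_solution \<epsilon> u v c x y \<longleftrightarrow> ks_primitive g u v (\<lambda>s. f s (x s)) y \<and> y u = c \<and>
     controlled u v y \<and> (\<forall>s\<in>{u..<v}. N (x s - R s (y s)) \<le> \<epsilon>)"

text \<open>
  The initial value is subject to the bound that keeps every solution controlled by \<open>Q\<close> in the ball
  of radius \<open>\<rho>\<close> up to time \<open>b\<close>. Quantifying over it makes the property transitive.
\<close>

definition approx_solvable :: "real \<Rightarrow> real \<Rightarrow> real \<Rightarrow> bool" where
  "approx_solvable \<epsilon> u v \<longleftrightarrow>
     (\<forall>c. N c + (Q b - Q u) \<le> \<rho> \<longrightarrow> (\<exists>x y. approx_solution \<epsilon> u v c x y))"

lemma Q_le: "a \<le> u \<Longrightarrow> u \<le> v \<Longrightarrow> v \<le> b \<Longrightarrow> Q u \<le> Q v"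
  using Q_mono by (auto simp: mono_on_def)

lemma controlled_bound:
  assumes "controlled u v y" "u \<le> s" "s \<le> v"
  shows "N (y s) \<le> N (y u) + (Q s - Q u)"
  using assms is_norm_triangle[OF N, of "y s - y u" "y u"] by (force simp: controlled_def)

lemma approx_solvable_refl: "approx_solvable \<epsilon> t t"
proof -
  have "approx_solution \<epsilon> t t c (\<lambda>_. 0) (\<lambda>_. c)" for c
    unfolding approx_solution_def controlled_def
  proof (intro conjI allI impI)
    fix u v assume "t \<le> u" "u \<le> v" "v \<le> t"
    then have "u = v" by simp
    then show "N (c - c) \<le> Q v - Q u" by (simp add: is_norm_zero[OF N])
  qed (auto simp: ks_primitive_degenerate)
  then show ?thesis unfolding approx_solvable_def by blast
qed

lemma approx_solvable_trans:
  assumes uvw: "a \<le> u" "u \<le> v" "v \<le> w" "w \<le> b"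
    and 1: "approx_solvable \<epsilon> u v" and 2: "approx_solvable \<epsilon> v w"
  shows "approx_solvable \<epsilon> u w"
  unfolding approx_solvable_def
proof (intro allI impI)
  fix c assume c: "N c + (Q b - Q u) \<le> \<rho>"
  then obtain x1 y1 where A1: "ks_primitive g u v (\<lambda>s. f s (x1 s)) y1" "y1 u = c" "controlled u v y1"
    "\<forall>s\<in>{u..<v}. N (x1 s - R s (y1 s)) \<le> \<epsilon>"
    using 1 unfolding approx_solvable_def approx_solution_def by blast
  have "N (y1 v) + (Q b - Q v) \<le> \<rho>"
    using controlled_bound[OF A1(3) uvw(2) order_refl] A1(2) c by simp
  then obtain x2 y2 where A2: "ks_primitive g v w (\<lambda>s. f s (x2 s)) y2" "y2 v = y1 v" "controlled v w y2"
    "\<forall>s\<in>{v..<w}. N (x2 s - R s (y2 s)) \<le> \<epsilon>"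
    using 2 unfolding approx_solvable_def approx_solution_def by blast
  let ?x = "\<lambda>s. if s < v then x1 s else x2 s" and ?y = "\<lambda>s. if s \<le> v then y1 s else y2 s"
  have "ks_primitive g u w (\<lambda>s. if s < v then f s (x1 s) else f s (x2 s))
      (\<lambda>s. if s \<le> v then y1 s else y1 v + (y2 s - y2 v))"
    using uvw by (intro ks_primitive_glue A1(1) A2(1) g_left) auto
  then have "ks_primitive g u w (\<lambda>s. f s (?x s)) ?y"
    by (rule ks_primitive_cong[where c = 0]) (auto simp: A2(2))
  moreover have "?y u = c" using A1(2) uvw by simp
  moreover have "controlled u w ?y"
    unfolding controlled_def
  proof (intro allI impI)
    fix s t assume st: "u \<le> s" "s \<le> t" "t \<le> w"
    consider "t \<le> v" | "v < s" | "s \<le> v" "v < t" by linarith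
    then show "N (?y t - ?y s) \<le> Q t - Q s"
    proof cases
      case 1
      then show ?thesis using A1(3) st by (auto simp: controlled_def)
    next
      case 2
      then show ?thesis using A2(3) st by (auto simp: controlled_def)
    next
      case 3
      then have "N (y1 v - y1 s) \<le> Q v - Q s" "N (y2 t - y2 v) \<le> Q t - Q v"
        using A1(3) A2(3) st unfolding controlled_def by auto
      then show ?thesis
        using 3 is_norm_diff_triangle[OF N, of "y2 t" "y1 s" "y2 v"] A2(2) by simp
    qed
  qed
  moreover have "N (?x s - R s (?y s)) \<le> \<epsilon>" if "s \<in> {u..<w}" for s
  proof (cases "s < v")
    case True
    then show ?thesis using that A1(4) by simp
  next
    case False
    then have "?y s = y2 s" using A2(2) by auto
    then show ?thesis using that False A2(4) by simp
  qed
  ultimately show "\<exists>x y. approx_solution \<epsilon> u w c x y"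
    unfolding approx_solution_def by (intro exI[of _ ?x] exI[of _ ?y] conjI ballI)
qed

text \<open>
  On a short interval that ends at \<open>t\<close> the state can be frozen at \<open>L c\<close>, with \<open>L\<close> the left limit
  of \<open>R\<close> at \<open>t\<close>: \<open>Q\<close> is left-continuous at \<open>t\<close>, so \<open>y\<close> stays close to its initial value
  \<open>c\<close>.
\<close>

lemma approx_solvable_left:
  assumes t: "t \<in> {a..b}" and \<epsilon>: "\<epsilon> > 0"
  shows "\<exists>\<delta>>0. \<forall>v\<in>{a..b}. t - \<delta> < v \<longrightarrow> v \<le> t \<longrightarrow> approx_solvable \<epsilon> v t"
proof (cases "t = a")
  case True
  then show ?thesis using approx_solvable_refl by (intro exI[of _ 1]) auto
next
  case False
  then have t': "t \<in> {a<..b}" using t by auto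
  obtain L where L: "\<forall>y. N y \<le> \<rho> \<longrightarrow> N (L y) \<le> r" and lim_L:
    "\<forall>\<epsilon>>0. \<exists>\<delta>>0. \<forall>s\<in>{a..b}. \<forall>y y'. t - \<delta> < s \<longrightarrow> s < t \<longrightarrow> N y \<le> \<rho> \<longrightarrow> N y' \<le> \<rho> \<longrightarrow>
        N (y - y') < \<delta> \<longrightarrow> N (R s y - L y') < \<epsilon>"
    using R_left[OF t'] by (elim exE conjE)
  obtain \<delta> where \<delta>: "\<delta> > 0"
    "\<forall>s\<in>{a..b}. \<forall>y y'. t - \<delta> < s \<longrightarrow> s < t \<longrightarrow> N y \<le> \<rho> \<longrightarrow> N y' \<le> \<rho> \<longrightarrow>
        N (y - y') < \<delta> \<longrightarrow> N (R s y - L y') < \<epsilon>"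
    using lim_L[rule_format, OF \<epsilon>] by (elim exE conjE)
  have "eventually (\<lambda>v. Q v > Q t - \<delta>) (at_left t)"
    using order_tendstoD(1)[OF Q_left[OF t'], of "Q t - \<delta>"] \<delta>(1) by simp
  then obtain l where l: "l < t" "\<And>v. l < v \<Longrightarrow> v < t \<Longrightarrow> Q v > Q t - \<delta>"
    by (auto simp: eventually_at_left_field)
  have "approx_solvable \<epsilon> v t" if v: "v \<in> {a..b}" "t - min \<delta> (t - l) < v" "v \<le> t" for v
  proof (cases "v = t")
    case True
    then show ?thesis using approx_solvable_refl by simp
  next
    case False
    then have vt: "a \<le> v" "v < t" "t \<le> b" "l < v" "t - \<delta> < v" using v t by auto
    show ?thesis
      unfolding approx_solvable_def
    proof (intro allI impI)
      fix c assume c: "N c + (Q b - Q v) \<le> \<rho>"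
      then have Nc: "N c \<le> \<rho>" using Q_le[of v b] vt by simp
      obtain \<Phi> where \<Phi>: "ks_primitive g a b (\<lambda>s. f s (L c)) \<Phi>"
        "\<And>s t. a \<le> s \<Longrightarrow> s \<le> t \<Longrightarrow> t \<le> b \<Longrightarrow> N (\<Phi> t - \<Phi> s) \<le> Q t - Q s"
        using f_prim[OF L[rule_format, OF Nc]] by blast
      let ?y = "\<lambda>s. \<Phi> s + (c - \<Phi> v)"
      have "ks_primitive g v t (\<lambda>s. f s (L c)) ?y"
        by (rule ks_primitive_cong[OF ks_primitive_subinterval[OF \<Phi>(1)]]) (use vt in auto)
      moreover have ctrl: "controlled v t ?y"
        using \<Phi>(2) vt by (auto simp: controlled_def)
      moreover have "N (L c - R s (?y s)) \<le> \<epsilon>" if s: "s \<in> {v..<t}" for s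
      proof -
        have "N (?y s - c) \<le> Q s - Q v" using \<Phi>(2)[of v s] s vt by (simp add: algebra_simps)
        also have "\<dots> < \<delta>" using Q_le[of s t] l(2)[of v] s vt by auto
        finally have "N (?y s - c) < \<delta>" .
        moreover have "N (?y s) \<le> \<rho>"
          using controlled_bound[OF ctrl, of s] s c Q_le[of s b] vt by auto
        ultimately have "N (R s (?y s) - L c) < \<epsilon>"
          using s vt Nc by (intro \<delta>(2)[rule_format]) auto
        then show ?thesis by (simp add: is_norm_commute[OF N])
      qed
      ultimately have "approx_solution \<epsilon> v t c (\<lambda>_. L c) ?y"
        by (simp add: approx_solution_def)
      then show "\<exists>x y. approx_solution \<epsilon> v t c x y" by blast
    qed
  qed
  then show ?thesis using \<delta>(1) l(1) by (intro exI[of _ "min \<delta> (t - l)"]) auto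
qed

text \<open>
  On an interval that starts at \<open>t\<close> the state at \<open>t\<close> itself must be \<open>R t c\<close>, because \<open>g\<close> may
  jump there. The jump takes \<open>y\<close> from \<open>c\<close> to \<open>c' = c + J *\<^sub>R f t (R t c)\<close>, and after it the state is
  frozen at \<open>L c'\<close>, with \<open>L\<close> the right limit of \<open>R\<close> at \<open>t\<close>. The length of the interval depends on
  \<open>L\<close> and on the right limit of \<open>Q\<close>, but not on \<open>c\<close>.
\<close>

lemma approx_solvable_right:
  assumes t: "t \<in> {a..b}" and \<epsilon>: "\<epsilon> > 0"
  shows "\<exists>\<delta>>0. \<forall>v\<in>{a..b}. v < t + \<delta> \<longrightarrow> t \<le> v \<longrightarrow> approx_solvable \<epsilon> t v"
proof (cases "t = b")
  case True
  then show ?thesis using approx_solvable_refl by (intro exI[of _ 1]) auto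
next
  case False
  then have t': "t \<in> {a..<b}" using t by auto
  obtain L where L: "\<forall>y. N y \<le> \<rho> \<longrightarrow> N (L y) \<le> r" and lim_L:
    "\<forall>\<epsilon>>0. \<exists>\<delta>>0. \<forall>s\<in>{a..b}. \<forall>y y'. t < s \<longrightarrow> s < t + \<delta> \<longrightarrow> N y \<le> \<rho> \<longrightarrow> N y' \<le> \<rho> \<longrightarrow>
        N (y - y') < \<delta> \<longrightarrow> N (R s y - L y') < \<epsilon>"
    using R_right[OF t'] by (elim exE conjE)
  obtain \<delta> where \<delta>: "\<delta> > 0"
    "\<forall>s\<in>{a..b}. \<forall>y y'. t < s \<longrightarrow> s < t + \<delta> \<longrightarrow> N y \<le> \<rho> \<longrightarrow> N y' \<le> \<rho> \<longrightarrow>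
        N (y - y') < \<delta> \<longrightarrow> N (R s y - L y') < \<epsilon>"
    using lim_L[rule_format, OF \<epsilon>] by (elim exE conjE)
  obtain gp where gp: "(g \<longlongrightarrow> gp) (at_right t)"
    using mono_on_right_limit[OF g_mono] t' by auto
  define J where "J = gp - g t"
  have J: "(g \<longlongrightarrow> g t + J) (at_right t)" using gp by (simp add: J_def)
  obtain Qp where Qp: "(Q \<longlongrightarrow> Qp) (at_right t)"
    using mono_on_right_limit[OF Q_mono] t' by auto
  have near: "eventually (\<lambda>s. s \<in> {t<..d}) (at_right t)" if "t < d" for d
    using that by (rule eventually_at_right_mem)
  have inJ: "eventually (\<lambda>s. s \<in> {a..b}) (at_right t)"
    using near[of b] t' by (auto elim!: eventually_mono)
  have lim: "(\<Phi> \<longlongrightarrow> \<Phi> t + J *\<^sub>R \<psi> t) (at_right t)" if "ks_primitive g a b \<psi> \<Phi>" for \<psi> \<Phi> :: "real \<Rightarrow> real ^ 'n"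
    by (rule ks_primitive_tendsto[OF that t _ inJ J]) (simp add: at_within_le_at)
  have Qp_le: "Qp \<le> Q d" if "t < d" "d \<le> b" for d
    by (rule tendsto_upperbound[OF Qp]) (use near[OF that(1)] that t in \<open>auto elim!: eventually_mono intro!: Q_le\<close>)
  have "eventually (\<lambda>v. Q v < Qp + \<delta>) (at_right t)"
    using order_tendstoD(2)[OF Qp, of "Qp + \<delta>"] \<delta>(1) by simp
  then obtain l where l: "t < l" "\<And>v. t < v \<Longrightarrow> v < l \<Longrightarrow> Q v < Qp + \<delta>"
    by (auto simp: eventually_at_right_field)
  have "approx_solvable \<epsilon> t v" if v: "v \<in> {a..b}" "v < t + min \<delta> (l - t)" "t \<le> v" for v
  proof (cases "v = t")
    case True
    then show ?thesis using approx_solvable_refl by simp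
  next
    case False
    then have vt: "a \<le> t" "t < v" "v \<le> b" "v < l" "v < t + \<delta>" using v t by auto
    show ?thesis
      unfolding approx_solvable_def
    proof (intro allI impI)
      fix c assume c: "N c + (Q b - Q t) \<le> \<rho>"
      then have Nc: "N c \<le> \<rho>" using Q_le[of t b] vt by simp
      have Rc: "N (R t c) \<le> r" using R_ball t Nc by blast
      obtain \<Phi>0 where \<Phi>0: "ks_primitive g a b (\<lambda>s. f s (R t c)) \<Phi>0"
        "\<And>s t. a \<le> s \<Longrightarrow> s \<le> t \<Longrightarrow> t \<le> b \<Longrightarrow> N (\<Phi>0 t - \<Phi>0 s) \<le> Q t - Q s"
        using f_prim[OF Rc] by blast
      define c' where "c' = c + J *\<^sub>R f t (R t c)"
      have jump: "N (J *\<^sub>R f t (R t c)) \<le> Qp - Q t"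
      proof (rule tendsto_le[OF _ tendsto_diff[OF Qp tendsto_const]])
        have "((\<lambda>s. \<Phi>0 s - \<Phi>0 t) \<longlongrightarrow> (\<Phi>0 t + J *\<^sub>R f t (R t c)) - \<Phi>0 t) (at_right t)"
          by (intro tendsto_intros lim[OF \<Phi>0(1)])
        then show "((\<lambda>s. N (\<Phi>0 s - \<Phi>0 t)) \<longlongrightarrow> N (J *\<^sub>R f t (R t c))) (at_right t)"
          using is_norm_tendsto[OF N] by simp
        show "eventually (\<lambda>s. N (\<Phi>0 s - \<Phi>0 t) \<le> Q s - Q t) (at_right t)"
          using near[OF vt(2)] by eventually_elim (use \<Phi>0(2) vt in auto)
      qed simp
      have "N c' \<le> N c + (Qp - Q t)"
        unfolding c'_def using is_norm_triangle[OF N, of c "J *\<^sub>R f t (R t c)"] jump by linarith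
      then have Nc': "N c' \<le> \<rho>" using c Qp_le[of b] vt by linarith
      obtain \<Phi> where \<Phi>: "ks_primitive g a b (\<lambda>s. f s (L c')) \<Phi>"
        "\<And>s t. a \<le> s \<Longrightarrow> s \<le> t \<Longrightarrow> t \<le> b \<Longrightarrow> N (\<Phi> t - \<Phi> s) \<le> Q t - Q s"
        using f_prim[OF L[rule_format, OF Nc']] by blast
      define y where "y s = (if s \<le> t then \<Phi> s else \<Phi> s + J *\<^sub>R (f t (R t c) - f t (L c'))) + (c - \<Phi> t)" for s
      let ?x = "\<lambda>s. if s = t then R t c else L c'"
      have yt: "y t = c" by (simp add: y_def)
      have "ks_primitive g t v ((\<lambda>s. f s (L c'))(t := f t (R t c)))
          (\<lambda>s. if s \<le> t then \<Phi> s else \<Phi> s + J *\<^sub>R (f t (R t c) - f t (L c')))"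
        using vt J by (intro ks_primitive_update ks_primitive_subinterval[OF \<Phi>(1)]) auto
      then have prim: "ks_primitive g t v (\<lambda>s. f s (?x s)) y"
        by (rule ks_primitive_cong[where c = "c - \<Phi> t"]) (auto simp: y_def)
      \<comment> \<open>The value \<open>c'\<close> is the right limit of \<open>y\<close> at \<open>t\<close>.\<close>
      have from_c': "N (y d - c') \<le> Q d - Qp" if d: "t < d" "d \<le> v" for d
      proof (rule tendsto_le[OF _ tendsto_diff[OF tendsto_const Qp]])
        have "((\<lambda>s. \<Phi> d - \<Phi> s) \<longlongrightarrow> \<Phi> d - (\<Phi> t + J *\<^sub>R f t (L c'))) (at_right t)"
          by (intro tendsto_intros lim[OF \<Phi>(1)])
        moreover have "\<Phi> d - (\<Phi> t + J *\<^sub>R f t (L c')) = y d - c'"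
          using d by (simp add: y_def c'_def algebra_simps)
        ultimately show "((\<lambda>s. N (\<Phi> d - \<Phi> s)) \<longlongrightarrow> N (y d - c')) (at_right t)"
          using is_norm_tendsto[OF N] by simp
        show "eventually (\<lambda>s. N (\<Phi> d - \<Phi> s) \<le> Q d - Q s) (at_right t)"
          using near[OF d(1)] by eventually_elim (use \<Phi>(2) vt d in auto)
      qed simp
      have ctrl: "controlled t v y"
        unfolding controlled_def
      proof (intro allI impI)
        fix s d assume sd: "t \<le> s" "s \<le> d" "d \<le> v"
        consider "d = s" | "t < s" | "s = t" "t < d" using sd by linarith
        then show "N (y d - y s) \<le> Q d - Q s"
        proof cases
          case 1
          then show ?thesis by (simp add: is_norm_zero[OF N])
        next
          case 2
          then show ?thesis using \<Phi>(2)[of s d] sd vt by (simp add: y_def)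
        next
          case 3
          have "N (y d - c) \<le> N (y d - c') + N (c' - c)" by (rule is_norm_diff_triangle[OF N])
          then show ?thesis using from_c'[of d] jump 3 sd yt by (simp add: c'_def)
        qed
      qed
      have "N (?x s - R s (y s)) \<le> \<epsilon>" if s: "s \<in> {t..<v}" for s
      proof (cases "s = t")
        case True
        then show ?thesis using \<epsilon> yt by (simp add: is_norm_zero[OF N])
      next
        case False
        then have s': "t < s" "s < v" using s by auto
        have "N (y s - c') < \<delta>" using from_c'[of s] l(2)[of s] s' vt by linarith
        moreover have "N (y s) \<le> \<rho>"
          using controlled_bound[OF ctrl, of s] s' yt c Q_le[of s b] vt by auto
        ultimately have "N (R s (y s) - L c') < \<epsilon>"
          using s' vt Nc' by (intro \<delta>(2)[rule_format]) auto
        then show ?thesis using False by (simp add: is_norm_commute[OF N])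
      qed
      then have "approx_solution \<epsilon> t v c ?x y"
        using prim yt ctrl by (simp add: approx_solution_def)
      then show "\<exists>x y. approx_solution \<epsilon> t v c x y" by blast
    qed
  qed
  then show ?thesis using \<delta>(1) l(1) by (intro exI[of _ "min \<delta> (l - t)"]) auto
qed

lemma approx_solvable_interval:
  assumes "\<epsilon> > 0"
  shows "approx_solvable \<epsilon> a b"
proof (rule local_to_global[where a = a and b = b and P = "approx_solvable \<epsilon>"])
  fix t assume t: "t \<in> {a..b}"
  obtain \<delta>1 where 1: "\<delta>1 > 0" "\<forall>v\<in>{a..b}. t - \<delta>1 < v \<longrightarrow> v \<le> t \<longrightarrow> approx_solvable \<epsilon> v t"
    using approx_solvable_left[OF t assms] by blast
  obtain \<delta>2 where 2: "\<delta>2 > 0" "\<forall>v\<in>{a..b}. v < t + \<delta>2 \<longrightarrow> t \<le> v \<longrightarrow> approx_solvable \<epsilon> t v"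
    using approx_solvable_right[OF t assms] by blast
  show "\<exists>\<delta>>0. \<forall>v\<in>{a..b}. \<bar>v - t\<bar> < \<delta> \<longrightarrow> (t \<le> v \<longrightarrow> approx_solvable \<epsilon> t v) \<and> (v \<le> t \<longrightarrow> approx_solvable \<epsilon> v t)"
    using 1 2 by (intro exI[of _ "min \<delta>1 \<delta>2"]) auto
qed (use ab approx_solvable_trans in auto)

text \<open>
  Along a convergent subsequence of approximate solutions the states converge to \<open>R s (y s)\<close> by
  continuity of \<open>R s\<close>, hence the integrands converge by continuity of \<open>f s\<close>.
\<close>

theorem exact_solution:
  assumes c: "N c + (Q b - Q a) \<le> \<rho>"
  obtains y where "y a = c" "ks_primitive g a b (\<lambda>s. f s (R s (y s))) y" "controlled a b y"
proof -
  define e where "e n = 1 / real (Suc n)" for n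
  have e: "e n > 0" for n by (simp add: e_def)
  have e_lim: "e \<longlonglongrightarrow> 0" unfolding e_def by (rule LIMSEQ_inverse_real_of_nat[unfolded inverse_eq_divide])
  have "\<exists>x y. approx_solution (e n) a b c x y" for n
    using approx_solvable_interval[OF e[of n]] c unfolding approx_solvable_def by blast
  then obtain X Y where XY: "\<And>n. approx_solution (e n) a b c (X n) (Y n)" by metis
  have Y: "ks_primitive g a b (\<lambda>s. f s (X n s)) (Y n)" "Y n a = c" "controlled a b (Y n)" for n
    using XY[of n] by (auto simp: approx_solution_def)
  have X: "N (X n s - R s (Y n s)) \<le> e n" if "s \<in> {a..<b}" for n s
    using XY[of n] that by (auto simp: approx_solution_def)
  obtain C where C: "C > 0" "\<And>x. norm x \<le> C * N x" using norm_le_is_norm[OF N] by blast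
  have ctrl: "norm (Y n d - Y n s) \<le> C * Q d - C * Q s" if "a \<le> s" "s \<le> d" "d \<le> b" for n s d
  proof -
    have "N (Y n d - Y n s) \<le> Q d - Q s" using Y(3)[of n] that by (simp add: controlled_def)
    then have "C * N (Y n d - Y n s) \<le> C * (Q d - Q s)" using C(1) by simp
    then show ?thesis using C(2)[of "Y n d - Y n s"] by (simp add: algebra_simps)
  qed
  obtain k y where k: "strict_mono (k :: nat \<Rightarrow> nat)" and lim: "\<forall>t\<in>{a..b}. (\<lambda>n. Y (k n) t) \<longlonglongrightarrow> y t"
    using mono_controlled_subsequence[OF less_imp_le[OF ab] order_refl, of Y "\<lambda>t. C * Q t"] Y(2) ctrl by metis
  have e_lim': "(\<lambda>n. e (k n)) \<longlonglongrightarrow> 0" using LIMSEQ_subseq_LIMSEQ[OF e_lim k] by (simp add: o_def)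
  have ya: "y a = c"
  proof -
    have "(\<lambda>n. Y (k n) a) \<longlonglongrightarrow> y a" using lim ab by simp
    then show ?thesis using Y(2) by (simp add: LIMSEQ_const_iff)
  qed
  have y_ctrl: "controlled a b y"
    unfolding controlled_def
  proof (intro allI impI)
    fix s d assume sd: "a \<le> s" "s \<le> d" "d \<le> b"
    then have "(\<lambda>n. Y (k n) d - Y (k n) s) \<longlonglongrightarrow> y d - y s" using lim by (intro tendsto_diff) auto
    then show "N (y d - y s) \<le> Q d - Q s"
      using sd Y(3) by (intro LIMSEQ_le_const2[OF is_norm_tendsto[OF N]]) (auto simp: controlled_def)
  qed
  have bound: "N (z s) \<le> \<rho>" if "controlled a b z" "z a = c" "s \<in> {a..b}" for z s
    using controlled_bound[OF that(1), of s] that(2,3) c Q_le[of s b] by auto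
  \<comment> \<open>Changing the state at the right end point, where the error bound says nothing, leaves \<open>Y n\<close>
    a primitive.\<close>
  define X' where "X' n = (X n)(b := R b (Y n b))" for n
  have X': "N (X' n s - R s (Y n s)) \<le> e n" if "s \<in> {a..b}" for n s
    using X[of s n] that e[of n] by (auto simp: X'_def is_norm_zero[OF N])
  have "ks_primitive g a b ((\<lambda>s. f s (X n s))(b := f b (R b (Y n b)))) (\<lambda>s. if s \<le> b then Y n s else Y n s + 0 *\<^sub>R (f b (R b (Y n b)) - f b (X n b)))" for n
    using ab g_left by (intro ks_primitive_update Y(1)) auto
  then have prim: "ks_primitive g a b (\<lambda>s. f s (X' n s)) (Y n)" for n
    by (rule ks_primitive_cong[where c = 0]) (auto simp: X'_def)
  have X_lim: "(\<lambda>n. X' (k n) s) \<longlonglongrightarrow> R s (y s)" if s: "s \<in> {a..b}" for s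
  proof (rule tendsto_if_is_norm_diff[OF N])
    fix \<epsilon> :: real assume "\<epsilon> > 0"
    then have e2: "\<epsilon> / 2 > 0" by simp
    obtain \<delta> where \<delta>: "\<delta> > 0" "\<And>y'. N y' \<le> \<rho> \<Longrightarrow> N (y' - y s) < \<delta> \<Longrightarrow> N (R s y' - R s (y s)) < \<epsilon> / 2"
      using R_cont[OF s bound[OF y_ctrl ya s] e2] by blast
    have "eventually (\<lambda>n. N (Y (k n) s - y s) < \<delta>) sequentially"
      using order_tendstoD(2)[OF is_norm_diff_tendsto_0[OF N, of "\<lambda>n. Y (k n) s" "y s" sequentially] \<delta>(1)] lim s by blast
    moreover have "eventually (\<lambda>n. e (k n) < \<epsilon> / 2) sequentially"
      using order_tendstoD(2)[OF e_lim' e2] .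
    ultimately show "eventually (\<lambda>n. N (X' (k n) s - R s (y s)) < \<epsilon>) sequentially"
    proof eventually_elim
      case (elim n)
      have "N (R s (Y (k n) s) - R s (y s)) < \<epsilon> / 2"
        using \<delta>(2) bound[OF Y(3) Y(2) s] elim(1) by blast
      then show ?case
        using is_norm_diff_triangle[OF N, of "X' (k n) s" "R s (y s)" "R s (Y (k n) s)"] X'[OF s, of "k n"] elim(2)
        by linarith
    qed
  qed
  have f_lim: "(\<lambda>n. f s (X' (k n) s)) \<longlonglongrightarrow> f s (R s (y s))" if s: "s \<in> {a..b}" for s
    using continuous_on_tendsto_compose[OF f_cont[OF s] X_lim[OF s]] by simp
  have "ks_primitive g a b (\<lambda>s. f s (R s (y s))) y"
    by (rule ks_primitive_dominated_convergence[where \<phi> = "\<lambda>n s. f s (X' (k n) s)"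
          and \<Phi> = "\<lambda>n. Y (k n)" and G = "\<lambda>t. C * Q t",
          OF less_imp_le[OF ab] g_mono prim ctrl f_lim bspec[OF lim]])
  then show ?thesis using ya y_ctrl that by blast
qed

end

section \<open>Existence of a solution\<close>

lemma regulated_bounded:
  fixes N :: "real ^ 'n \<Rightarrow> real"
  assumes N: "is_norm N" and ab: "a \<le> b" and x: "regulated a b x"
  obtains C where "C \<ge> 0" "\<And>s. s \<in> {a..b} \<Longrightarrow> N (x s) \<le> C"
proof -
  have one_sided: "\<exists>C. eventually (\<lambda>s. N (x s) \<le> C) F" if "(x \<longlongrightarrow> l) F" for F and l
  proof -
    have "eventually (\<lambda>s. N (x s) < N l + 1) F"
      by (rule order_tendstoD(2)[OF is_norm_tendsto[OF N that]]) simp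
    then show ?thesis by (intro exI[of _ "N l + 1"]) (auto elim!: eventually_mono)
  qed
  have "\<exists>C. \<forall>s\<in>{a..b}. N (x s) \<le> C"
  proof (rule local_to_global[OF order_refl ab order_refl, where P = "\<lambda>u v. \<exists>C. \<forall>s\<in>{u..v}. N (x s) \<le> C"])
    fix u v w assume "\<exists>C. \<forall>s\<in>{u..v}. N (x s) \<le> C" "\<exists>C. \<forall>s\<in>{v..w}. N (x s) \<le> C"
    then obtain C D where "\<forall>s\<in>{u..v}. N (x s) \<le> C" "\<forall>s\<in>{v..w}. N (x s) \<le> D" by blast
    then have "N (x s) \<le> max C D" if "s \<in> {u..w}" for s
      using that by (cases "s \<le> v") (auto simp: le_max_iff_disj)
    then show "\<exists>C. \<forall>s\<in>{u..w}. N (x s) \<le> C" by blast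
  next
    fix t assume t: "t \<in> {a..b}"
    have "\<exists>l<t. \<exists>C. \<forall>s\<in>{a..b}. l < s \<longrightarrow> s < t \<longrightarrow> N (x s) \<le> C"
    proof (cases "a < t")
      case True
      then have "\<exists>l. (x \<longlongrightarrow> l) (at_left t)" using x t by (simp add: regulated_def)
      then obtain C where "eventually (\<lambda>s. N (x s) \<le> C) (at_left t)"
        using one_sided by blast
      then show ?thesis unfolding eventually_at_left_field by blast
    qed (use t in \<open>auto intro!: exI[of _ "t - 1"]\<close>)
    then obtain l C where l: "l < t" "\<And>s. s \<in> {a..b} \<Longrightarrow> l < s \<Longrightarrow> s < t \<Longrightarrow> N (x s) \<le> C" by blast
    have "\<exists>u>t. \<exists>D. \<forall>s\<in>{a..b}. t < s \<longrightarrow> s < u \<longrightarrow> N (x s) \<le> D"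
    proof (cases "t < b")
      case True
      then have "\<exists>l. (x \<longlongrightarrow> l) (at_right t)" using x t by (simp add: regulated_def)
      then obtain D where "eventually (\<lambda>s. N (x s) \<le> D) (at_right t)"
        using one_sided by blast
      then show ?thesis unfolding eventually_at_right_field by blast
    qed (use t in \<open>auto intro!: exI[of _ "t + 1"]\<close>)
    then obtain u D where u: "u > t" "\<And>s. s \<in> {a..b} \<Longrightarrow> t < s \<Longrightarrow> s < u \<Longrightarrow> N (x s) \<le> D" by blast
    have "N (x s) \<le> max (N (x t)) (max C D)" if "s \<in> {a..b}" "l < s" "s < u" for s
      using l(2)[of s] u(2)[of s] that by (cases s t rule: linorder_cases) (auto simp: le_max_iff_disj)
    then have "(\<forall>s\<in>{t..v}. N (x s) \<le> max (N (x t)) (max C D)) \<and> (\<forall>s\<in>{v..t}. N (x s) \<le> max (N (x t)) (max C D))"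
      if "v \<in> {a..b}" "\<bar>v - t\<bar> < min (t - l) (u - t)" for v
      using that t by auto
    then show "\<exists>\<delta>>0. \<forall>v\<in>{a..b}. \<bar>v - t\<bar> < \<delta> \<longrightarrow>
      (t \<le> v \<longrightarrow> (\<exists>C. \<forall>s\<in>{t..v}. N (x s) \<le> C)) \<and> (v \<le> t \<longrightarrow> (\<exists>C. \<forall>s\<in>{v..t}. N (x s) \<le> C))"
      using l(1) u(1) by (intro exI[of _ "min (t - l) (u - t)"]) fastforce
  qed
  then obtain C where C: "\<And>s. s \<in> {a..b} \<Longrightarrow> N (x s) \<le> C" by blast
  moreover have "C \<ge> 0" using C[of a] is_norm_nonneg[OF N, of "x a"] ab by simp
  ultimately show ?thesis using that by blast
qed

text \<open>
  A lower limit below \<open>1\<close> provides some \<open>q < 1\<close> and arbitrarily large \<open>r\<close> with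
  \<open>A r + B r < q * r\<close>; the remaining \<open>(1 - q) * r\<close> exceeds the constant \<open>K\<close> once \<open>r\<close> is large.
\<close>

lemma exists_radius:
  assumes liminf_less: "Liminf at_top (\<lambda>r::real. ereal (A r / r + 1 / r * B r)) < 1"
  shows "\<exists>r\<ge>r0. r > 0 \<and> A r + B r + K \<le> r"
proof -
  have "\<not> 1 \<le> Liminf at_top (\<lambda>r::real. ereal (A r / r + 1 / r * B r))" using liminf_less by simp
  then obtain z :: ereal where z: "z < 1" "\<not> eventually (\<lambda>r::real. z < ereal (A r / r + 1 / r * B r)) at_top"
    unfolding le_Liminf_iff by blast
  obtain q where q: "z < ereal q" "ereal q < 1" using ereal_dense2[OF z(1)] by blast
  have "eventually (\<lambda>r::real. r \<ge> max (max 1 r0) (K / (1 - q))) at_top" by (rule eventually_ge_at_top)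
  moreover have "frequently (\<lambda>r::real. \<not> z < ereal (A r / r + 1 / r * B r)) at_top"
    using z(2) by (simp add: frequently_def)
  ultimately obtain r where r: "\<not> z < ereal (A r / r + 1 / r * B r)" "r \<ge> max (max 1 r0) (K / (1 - q))"
    using frequently_ex[OF frequently_eventually_frequently] by blast
  have r1: "r > 0" using r(2) by auto
  have "ereal (A r / r + 1 / r * B r) < ereal q" using r(1) q(1) by (meson not_less order_le_less_trans)
  then have "(A r + B r) / r < q" by (simp add: add_divide_distrib)
  then have "A r + B r < q * r" using r1 by (simp add: divide_less_eq)
  moreover have "K \<le> (1 - q) * r"
    using r(2) q(2) by (simp add: divide_le_eq mult.commute one_ereal_def)
  ultimately show ?thesis using r1 r(2) by (intro exI[of _ r]) (auto simp: algebra_simps)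
qed

text \<open>
  It remains to choose the radius and to read the solution off from that of the reduced equation.
  The radius also has to be at least \<open>N x0\<close>: this places \<open>x0\<close> among the candidates for the fixed
  point at \<open>t0\<close>, and uniqueness of that point gives \<open>x t0 = x0\<close>.
\<close>

theorem theorem3p13:
  fixes N :: "real ^ 'n \<Rightarrow> real"
    and t0 a :: real
    and g :: "real \<Rightarrow> real"
    and x0 :: "real ^ 'n"
    and f h :: "real \<Rightarrow> real ^ 'n \<Rightarrow> real ^ 'n"
    and M \<phi> :: "real \<Rightarrow> real \<Rightarrow> real"
  assumes "is_norm N"
    and "a > 0"
    and "mono_on {t0..t0 + a} g"
    and "left_continuous t0 (t0 + a) g"
    and A0: "\<And>t. t \<in> {t0..t0 + a} \<Longrightarrow> continuous_on UNIV (f t)"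
    and A1: "\<And>u. ks_integrable N (\<lambda>s. f s u) g t0 (t0 + a)"
    and A2_nonneg: "\<And>s \<alpha>. s \<in> {t0..t0 + a} \<Longrightarrow> \<alpha> \<ge> 0 \<Longrightarrow> M s \<alpha> \<ge> 0"
    and A2_integrable: "\<And>\<alpha>. \<alpha> \<ge> 0 \<Longrightarrow> ks_integrable abs (\<lambda>s. M s \<alpha>) g t0 (t0 + a)"
    and A2_mono: "\<And>s. s \<in> {t0..t0 + a} \<Longrightarrow> mono_on {0..} (M s)"
    and A2_bound: "\<And>u c d. t0 \<le> c \<Longrightarrow> c \<le> d \<Longrightarrow> d \<le> t0 + a \<Longrightarrow>
      N (ks_integral N (\<lambda>s. f s u) g c d) \<le> ks_integral abs (\<lambda>s. M s (N u)) g c d"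
    and A3_regulated: "\<And>v. regulated t0 (t0 + a) (\<lambda>t. h t v)"
    and A3_D: "\<And>r. r \<ge> 0 \<Longrightarrow> D_function (\<lambda>t. \<phi> t r)"
    and A3_less: "\<And>r t. r \<ge> 0 \<Longrightarrow> t > 0 \<Longrightarrow> \<phi> t r < t"
    and A3_bound: "\<And>r t u v. r \<ge> 0 \<Longrightarrow> t \<in> {t0..t0 + a} \<Longrightarrow> N u \<le> r \<Longrightarrow> N v \<le> r \<Longrightarrow>
      N (h t u - h t v) \<le> \<phi> (N (u - v)) r"
    and liminf_less: "Liminf at_top (\<lambda>r::real. ereal (\<phi> r r / r +
      1 / r * ks_integral abs (\<lambda>s. M s r) g t0 (t0 + a))) < 1"
  shows "\<exists>x. is_solution N t0 a g x0 f h x"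
proof -
  define b where "b = t0 + a"
  note N = assms(1) and g_mono = assms(3)[folded b_def]
  have t0b: "t0 < b" using assms(2) by (simp add: b_def)
  have g_left: "(g \<longlongrightarrow> g t) (at_left t)" if "t \<in> {t0<..b}" for t
    using assms(4) that by (simp add: left_continuous_def b_def)
  define c where "c = x0 - h t0 x0"
  obtain C where C: "C \<ge> 0" "\<And>s. s \<in> {t0..b} \<Longrightarrow> N (h s 0) \<le> C"
    using regulated_bounded[OF N less_imp_le[OF t0b] A3_regulated[of 0, folded b_def]] by metis
  \<comment> \<open>With this radius, \<open>N c + (Q b - Q t0)\<close> is at most \<open>\<rho> = r - p r - C\<close>, the size of \<open>y\<close>
    up to which the fixed points are known to exist.\<close>
  obtain r where r: "r \<ge> N x0" "r > 0"
    "\<phi> r r + ks_integral abs (\<lambda>s. M s r) g t0 b + (N c + C) \<le> r"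
    using exists_radius[OF liminf_less[folded b_def], of "N x0" "N c + C"] by blast
  have r0: "r \<ge> 0" using r(2) by simp
  define p where "p t = \<phi> t r" for t
  define \<rho> where "\<rho> = r - p r - C"
  have p: "D_function p" "\<forall>t>0. p t < t"
    using A3_D[OF r0] A3_less[OF r0] by (auto simp: p_def[abs_def])
  have con: "D_contraction N p r C (h s)" if s: "s \<in> {t0..b}" for s
    using A3_bound[OF r0] s C(2)[OF s] unfolding D_contraction_def p_def b_def by auto

  have M_prim: "\<exists>Q. ks_primitive g t0 b (\<lambda>s. M s \<alpha>) Q" if "\<alpha> \<ge> 0" for \<alpha>
    using A2_integrable[OF that] has_ks_integral_imp_ks_primitive_real[of t0 b "\<lambda>s. M s \<alpha>" g] t0b
    unfolding ks_integrable_def b_def by force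
  have M_int: "ks_integral abs (\<lambda>s. M s \<alpha>) g u v = Q v - Q u"
    if "ks_primitive g t0 b (\<lambda>s. M s \<alpha>) Q" "t0 \<le> u" "u \<le> v" "v \<le> b" for \<alpha> Q u v
    by (rule ks_integral_eqI[OF is_norm_abs that(3) has_ks_integral_ks_primitive[OF is_norm_abs _ _ that(1-4), of 1]]) simp_all
  obtain K where K: "K > 0" "\<And>x. N x \<le> K * norm x" using is_norm_le_norm[OF N] by blast
  have int: "has_ks_integral N \<psi> g u v (\<Phi> v - \<Phi> u)"
    if "ks_primitive g t0 b \<psi> \<Phi>" "t0 \<le> u" "u \<le> v" "v \<le> b" for \<psi> \<Phi> u v
    by (rule has_ks_integral_ks_primitive[OF N K that])
  obtain Q where Q: "ks_primitive g t0 b (\<lambda>s. M s r) Q" using M_prim[OF r0] by blast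
  have Q_mono: "mono_on {t0..b} Q"
    unfolding mono_on_def
    by (auto intro!: ks_primitive_nonneg[OF g_mono Q] A2_nonneg[OF _ r0] simp: b_def)
  have bound: "N c + (Q b - Q t0) \<le> \<rho>"
    using r(3) M_int[OF Q order_refl less_imp_le[OF t0b] order_refl] by (simp add: \<rho>_def p_def)

  interpret ode: implicit_measure_ode N g Q t0 b f "\<lambda>s. resolvent N r (h s)" r \<rho>
  proof unfold_locales
    fix t assume t: "t \<in> {t0<..b}"
    have "(Q \<longlongrightarrow> Q t + 0 *\<^sub>R M t r) (at_left t)"
      by (rule ks_primitive_tendsto[OF Q]) (use t g_left eventually_at_left_mem[of t0 t] in \<open>auto simp: at_within_le_at elim!: eventually_mono\<close>)
    then show "(Q \<longlongrightarrow> Q t) (at_left t)" by simp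
  next
    fix u assume u: "N u \<le> r"
    obtain \<Phi> where \<Phi>: "ks_primitive g t0 b (\<lambda>s. f s u) \<Phi>"
      using ks_integrable_imp_ks_primitive[OF N less_imp_le[OF t0b], of "\<lambda>s. f s u" g] A1[of u] by (auto simp: b_def)
    obtain Qu where Qu: "ks_primitive g t0 b (\<lambda>s. M s (N u)) Qu" using M_prim[OF is_norm_nonneg[OF N]] by blast
    have "N (\<Phi> d - \<Phi> s) \<le> Q d - Q s" if sd: "t0 \<le> s" "s \<le> d" "d \<le> b" for s d
    proof -
      have "N (\<Phi> d - \<Phi> s) = N (ks_integral N (\<lambda>s. f s u) g s d)"
        using ks_integral_eqI[OF N sd(2) int[OF \<Phi> sd]] by simp
      also have "\<dots> \<le> ks_integral abs (\<lambda>s. M s (N u)) g s d"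
        using A2_bound[of s d u] sd by (simp add: b_def)
      also have "\<dots> = Qu d - Qu s" by (rule M_int[OF Qu sd])
      also have "\<dots> \<le> Q d - Q s"
        using A2_mono u is_norm_nonneg[OF N, of u] r0
        by (intro ks_primitive_mono[OF g_mono Qu Q _ sd]) (auto simp: mono_on_def b_def)
      finally show ?thesis .
    qed
    with \<Phi> show "\<exists>\<Phi>. ks_primitive g t0 b (\<lambda>s. f s u) \<Phi> \<and>
      (\<forall>c d. t0 \<le> c \<longrightarrow> c \<le> d \<longrightarrow> d \<le> b \<longrightarrow> N (\<Phi> d - \<Phi> c) \<le> Q d - Q c)" by blast
  next
    fix s y assume "s \<in> {t0..b}" "N y \<le> \<rho>"
    then show "N (resolvent N r (h s) y) \<le> r"
      using resolvent_fixed_point(1)[OF N p con r0] by (simp add: \<rho>_def)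
  next
    fix s y and \<epsilon> :: real assume s: "s \<in> {t0..b}" and y: "N y \<le> \<rho>" and \<epsilon>: "\<epsilon> > 0"
    have "\<exists>\<eta>>0. eventually (\<lambda>_ :: nat. \<forall>y y'. N y \<le> \<rho> \<longrightarrow> N y' \<le> \<rho> \<longrightarrow>
      N (y - y') < \<eta> \<longrightarrow> N (resolvent N r (h s) y - resolvent N r (h s) y') < \<epsilon>) sequentially"
      using resolvent_one_sided_limit(2)[OF N p r0 _ _ tendsto_const, of sequentially C "h s"] con[OF s] \<epsilon>
      by (simp add: \<rho>_def)
    then show "\<exists>\<delta>>0. \<forall>y'. N y' \<le> \<rho> \<longrightarrow> N (y' - y) < \<delta> \<longrightarrow>
        N (resolvent N r (h s) y' - resolvent N r (h s) y) < \<epsilon>"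
      using y by auto
  next
    fix t assume t: "t \<in> {t0<..b}"
    then have "\<forall>w. \<exists>l. ((\<lambda>s. h s w) \<longlongrightarrow> l) (at_left t)"
      using A3_regulated by (simp add: regulated_def b_def)
    then have "\<exists>L. \<forall>w. ((\<lambda>s. h s w) \<longlongrightarrow> L w) (at_left t)" by (rule choice)
    then obtain L where L: "\<And>w. ((\<lambda>s. h s w) \<longlongrightarrow> L w) (at_left t)" by blast
    have ev: "eventually (\<lambda>s. D_contraction N p r C (h s)) (at_left t)"
      using eventually_at_left_mem[of t0 t] t con by (auto elim!: eventually_mono)
    note lim = resolvent_one_sided_limit[OF N p r0 trivial_limit_at_left_real ev L, folded \<rho>_def]
    have "\<exists>\<delta>>0. \<forall>s\<in>{t0..b}. \<forall>y y'. t - \<delta> < s \<longrightarrow> s < t \<longrightarrow> N y \<le> \<rho> \<longrightarrow> N y' \<le> \<rho> \<longrightarrow>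
        N (y - y') < \<delta> \<longrightarrow> N (resolvent N r (h s) y - resolvent N r L y') < \<epsilon>" if \<epsilon>: "\<epsilon> > 0" for \<epsilon>
    proof -
      obtain \<eta> where \<eta>: "\<eta> > 0" "eventually (\<lambda>s. \<forall>y y'. N y \<le> \<rho> \<longrightarrow> N y' \<le> \<rho> \<longrightarrow>
          N (y - y') < \<eta> \<longrightarrow> N (resolvent N r (h s) y - resolvent N r L y') < \<epsilon>) (at_left t)"
        using lim(2)[rule_format, OF \<epsilon>] by blast
      obtain l where "l < t" "\<forall>s>l. s < t \<longrightarrow> (\<forall>y y'. N y \<le> \<rho> \<longrightarrow> N y' \<le> \<rho> \<longrightarrow>
          N (y - y') < \<eta> \<longrightarrow> N (resolvent N r (h s) y - resolvent N r L y') < \<epsilon>)"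
        using \<eta>(2) unfolding eventually_at_left_field by (elim exE conjE)
      then show ?thesis using \<eta>(1) by (intro exI[of _ "min \<eta> (t - l)"]) auto
    qed
    with lim(1) show "\<exists>L. (\<forall>y. N y \<le> \<rho> \<longrightarrow> N (L y) \<le> r) \<and>
      (\<forall>\<epsilon>>0. \<exists>\<delta>>0. \<forall>s\<in>{t0..b}. \<forall>y y'. t - \<delta> < s \<longrightarrow> s < t \<longrightarrow> N y \<le> \<rho> \<longrightarrow> N y' \<le> \<rho> \<longrightarrow>
        N (y - y') < \<delta> \<longrightarrow> N (resolvent N r (h s) y - L y') < \<epsilon>)"
      by (intro exI[of _ "resolvent N r L"] conjI allI impI) auto
  next
    fix t assume t: "t \<in> {t0..<b}"
    then have "\<forall>w. \<exists>l. ((\<lambda>s. h s w) \<longlongrightarrow> l) (at_right t)"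
      using A3_regulated by (simp add: regulated_def b_def)
    then have "\<exists>L. \<forall>w. ((\<lambda>s. h s w) \<longlongrightarrow> L w) (at_right t)" by (rule choice)
    then obtain L where L: "\<And>w. ((\<lambda>s. h s w) \<longlongrightarrow> L w) (at_right t)" by blast
    have ev: "eventually (\<lambda>s. D_contraction N p r C (h s)) (at_right t)"
      using eventually_at_right_mem[of t b] t con by (auto elim!: eventually_mono)
    note lim = resolvent_one_sided_limit[OF N p r0 trivial_limit_at_right_real ev L, folded \<rho>_def]
    have "\<exists>\<delta>>0. \<forall>s\<in>{t0..b}. \<forall>y y'. t < s \<longrightarrow> s < t + \<delta> \<longrightarrow> N y \<le> \<rho> \<longrightarrow> N y' \<le> \<rho> \<longrightarrow>
        N (y - y') < \<delta> \<longrightarrow> N (resolvent N r (h s) y - resolvent N r L y') < \<epsilon>" if \<epsilon>: "\<epsilon> > 0" for \<epsilon>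
    proof -
      obtain \<eta> where \<eta>: "\<eta> > 0" "eventually (\<lambda>s. \<forall>y y'. N y \<le> \<rho> \<longrightarrow> N y' \<le> \<rho> \<longrightarrow>
          N (y - y') < \<eta> \<longrightarrow> N (resolvent N r (h s) y - resolvent N r L y') < \<epsilon>) (at_right t)"
        using lim(2)[rule_format, OF \<epsilon>] by blast
      obtain l where "t < l" "\<forall>s>t. s < l \<longrightarrow> (\<forall>y y'. N y \<le> \<rho> \<longrightarrow> N y' \<le> \<rho> \<longrightarrow>
          N (y - y') < \<eta> \<longrightarrow> N (resolvent N r (h s) y - resolvent N r L y') < \<epsilon>)"
        using \<eta>(2) unfolding eventually_at_right_field by (elim exE conjE)
      then show ?thesis using \<eta>(1) by (intro exI[of _ "min \<eta> (l - t)"]) auto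
    qed
    with lim(1) show "\<exists>L. (\<forall>y. N y \<le> \<rho> \<longrightarrow> N (L y) \<le> r) \<and>
      (\<forall>\<epsilon>>0. \<exists>\<delta>>0. \<forall>s\<in>{t0..b}. \<forall>y y'. t < s \<longrightarrow> s < t + \<delta> \<longrightarrow> N y \<le> \<rho> \<longrightarrow> N y' \<le> \<rho> \<longrightarrow>
        N (y - y') < \<delta> \<longrightarrow> N (resolvent N r (h s) y - L y') < \<epsilon>)"
      by (intro exI[of _ "resolvent N r L"] conjI allI impI) auto
  qed (use N t0b g_mono g_left Q_mono A0 in \<open>auto simp: b_def\<close>)

  obtain y where y: "y t0 = c" "ks_primitive g t0 b (\<lambda>s. f s (resolvent N r (h s) (y s))) y"
    "ode.controlled t0 b y"
    using ode.exact_solution[OF bound] by blast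
  define x where "x s = resolvent N r (h s) (y s)" for s
  have y_ball: "N (y s) \<le> \<rho>" if "s \<in> {t0..b}" for s
    using ode.controlled_bound[OF y(3), of s] that y(1) bound ode.Q_le[of s b] by auto
  have x: "N (x s) \<le> r" "x s = y s + h s (x s)" if "s \<in> {t0..b}" for s
    using resolvent_fixed_point[OF N p con[OF that] r0, of "y s"] y_ball[OF that] by (auto simp: x_def \<rho>_def)
  have prim: "ks_primitive g t0 b (\<lambda>s. f s (x s)) y" using y(2) by (simp add: x_def)

  have x_t0: "x t0 = x0"
  proof (rule ccontr)
    assume "x t0 \<noteq> x0"
    have t0: "t0 \<in> {t0..b}" using t0b by simp
    have eq: "x t0 - x0 = h t0 (x t0) - h t0 x0" using x(2)[OF t0] y(1) by (simp add: c_def algebra_simps)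
    have pos: "N (x t0 - x0) > 0"
      using \<open>x t0 \<noteq> x0\<close> is_norm_nonneg[OF N, of "x t0 - x0"] is_norm_eq_0[OF N, of "x t0 - x0"] by simp
    have "N (x t0 - x0) \<le> p (N (x t0 - x0))"
      using con[OF t0] x(1)[OF t0] r(1) unfolding D_contraction_def by (subst eq) blast
    then show False using p(2) pos by auto
  qed

  have y_left: "(y \<longlongrightarrow> y t) (at_left t)" if t: "t \<in> {t0<..b}" for t
  proof -
    have "(y \<longlongrightarrow> y t + 0 *\<^sub>R f t (x t)) (at_left t)"
      by (rule ks_primitive_tendsto[OF prim]) (use t g_left eventually_at_left_mem[of t0 t] in \<open>auto simp: at_within_le_at elim!: eventually_mono\<close>)
    then show ?thesis by simp
  qed
  have y_right: "\<exists>l. (y \<longlongrightarrow> l) (at_right t)" if t: "t \<in> {t0..<b}" for t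
  proof -
    obtain gp where "(g \<longlongrightarrow> gp) (at_right t)" using mono_on_right_limit[OF g_mono] t by auto
    then have "(g \<longlongrightarrow> g t + (gp - g t)) (at_right t)" by simp
    then have "(y \<longlongrightarrow> y t + (gp - g t) *\<^sub>R f t (x t)) (at_right t)"
      by (intro ks_primitive_tendsto[OF prim]) (use t eventually_at_right_mem[of t b] in \<open>auto simp: at_within_le_at elim!: eventually_mono\<close>)
    then show ?thesis by blast
  qed
  have x_left: "\<exists>l. (x \<longlongrightarrow> l) (at_left t)" if t: "t \<in> {t0<..b}" for t
  proof -
    obtain L where L: "\<forall>\<epsilon>>0. \<exists>\<delta>>0. \<forall>s\<in>{t0..b}. \<forall>y y'. t - \<delta> < s \<longrightarrow> s < t \<longrightarrow> N y \<le> \<rho> \<longrightarrow> N y' \<le> \<rho> \<longrightarrow>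
        N (y - y') < \<delta> \<longrightarrow> N (resolvent N r (h s) y - L y') < \<epsilon>"
      using ode.R_left[OF t] by blast
    have "(x \<longlongrightarrow> L (y t)) (at_left t)"
    proof (rule tendsto_if_is_norm_diff[OF N])
      fix \<epsilon> :: real assume "\<epsilon> > 0"
      then obtain \<delta> where \<delta>: "\<delta> > 0" "\<forall>s\<in>{t0..b}. \<forall>y y'. t - \<delta> < s \<longrightarrow> s < t \<longrightarrow> N y \<le> \<rho> \<longrightarrow> N y' \<le> \<rho> \<longrightarrow>
        N (y - y') < \<delta> \<longrightarrow> N (resolvent N r (h s) y - L y') < \<epsilon>"
        using L by blast
      have "eventually (\<lambda>s. s \<in> {max t0 (t - \<delta> / 2)..<t}) (at_left t)"
        using \<delta>(1) t by (intro eventually_at_left_mem) auto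
      moreover have "eventually (\<lambda>s. N (y s - y t) < \<delta>) (at_left t)"
        using order_tendstoD(2)[OF is_norm_diff_tendsto_0[OF N y_left[OF t]] \<delta>(1)] .
      ultimately show "eventually (\<lambda>s. N (x s - L (y t)) < \<epsilon>) (at_left t)"
      proof eventually_elim
        case (elim s)
        then have s: "s \<in> {t0..b}" "t - \<delta> < s" "s < t" using t \<delta>(1) by auto
        have "N (y t) \<le> \<rho>" using y_ball t by auto
        then show ?case
          unfolding x_def by (rule \<delta>(2)[rule_format, OF s y_ball[OF s(1)] _ elim(2)])
      qed
    qed
    then show ?thesis by blast
  qed
  have x_right: "\<exists>l. (x \<longlongrightarrow> l) (at_right t)" if t: "t \<in> {t0..<b}" for t
  proof -
    obtain L where L: "\<forall>\<epsilon>>0. \<exists>\<delta>>0. \<forall>s\<in>{t0..b}. \<forall>y y'. t < s \<longrightarrow> s < t + \<delta> \<longrightarrow> N y \<le> \<rho> \<longrightarrow> N y' \<le> \<rho> \<longrightarrow>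
        N (y - y') < \<delta> \<longrightarrow> N (resolvent N r (h s) y - L y') < \<epsilon>"
      using ode.R_right[OF t] by blast
    obtain l where l: "(y \<longlongrightarrow> l) (at_right t)" using y_right[OF t] by blast
    have in_J: "eventually (\<lambda>s. s \<in> {t0..b}) (at_right t)"
      using eventually_at_right_mem[of t b] t by (auto elim!: eventually_mono)
    have l_ball: "N l \<le> \<rho>"
      by (rule tendsto_upperbound[OF is_norm_tendsto[OF N l]]) (use in_J y_ball in \<open>auto elim!: eventually_mono\<close>)
    have "(x \<longlongrightarrow> L l) (at_right t)"
    proof (rule tendsto_if_is_norm_diff[OF N])
      fix \<epsilon> :: real assume "\<epsilon> > 0"
      then obtain \<delta> where \<delta>: "\<delta> > 0" "\<forall>s\<in>{t0..b}. \<forall>y y'. t < s \<longrightarrow> s < t + \<delta> \<longrightarrow> N y \<le> \<rho> \<longrightarrow> N y' \<le> \<rho> \<longrightarrow>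
        N (y - y') < \<delta> \<longrightarrow> N (resolvent N r (h s) y - L y') < \<epsilon>"
        using L by blast
      have "eventually (\<lambda>s. s \<in> {t<..min b (t + \<delta> / 2)}) (at_right t)"
        using \<delta>(1) t by (intro eventually_at_right_mem) auto
      moreover have "eventually (\<lambda>s. N (y s - l) < \<delta>) (at_right t)"
        using order_tendstoD(2)[OF is_norm_diff_tendsto_0[OF N l] \<delta>(1)] .
      ultimately show "eventually (\<lambda>s. N (x s - L l) < \<epsilon>) (at_right t)"
      proof eventually_elim
        case (elim s)
        then have s: "s \<in> {t0..b}" "t < s" "s < t + \<delta>" using t \<delta>(1) by auto
        show ?case
          unfolding x_def by (rule \<delta>(2)[rule_format, OF s y_ball[OF s(1)] l_ball elim(2)])
      qed
    qed
    then show ?thesis by blast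
  qed
  have hx: "h s (x s) = x s - y s" if "s \<in> {t0..b}" for s using x(2)[OF that] by (simp add: algebra_simps)

  have "regulated t0 b x" using x_left x_right by (simp add: regulated_def)
  moreover have "regulated t0 b (\<lambda>t. h t (x t))"
    unfolding regulated_def
  proof (intro conjI ballI)
    fix t assume t: "t \<in> {t0<..b}"
    then obtain l where "(x \<longlongrightarrow> l) (at_left t)" using x_left by blast
    then have "((\<lambda>s. x s - y s) \<longlongrightarrow> l - y t) (at_left t)" by (intro tendsto_diff y_left t)
    moreover have "eventually (\<lambda>s. x s - y s = h s (x s)) (at_left t)"
      using eventually_at_left_mem[of t0 t] t hx by (auto elim!: eventually_mono)
    ultimately have "((\<lambda>s. h s (x s)) \<longlongrightarrow> l - y t) (at_left t)" by (rule Lim_transform_eventually)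
    then show "\<exists>l. ((\<lambda>s. h s (x s)) \<longlongrightarrow> l) (at_left t)" by blast
  next
    fix t assume t: "t \<in> {t0..<b}"
    then obtain l l' where "(x \<longlongrightarrow> l) (at_right t)" "(y \<longlongrightarrow> l') (at_right t)" using x_right y_right by blast
    then have "((\<lambda>s. x s - y s) \<longlongrightarrow> l - l') (at_right t)" by (intro tendsto_diff)
    moreover have "eventually (\<lambda>s. x s - y s = h s (x s)) (at_right t)"
      using eventually_at_right_mem[of t b] t hx by (auto elim!: eventually_mono)
    ultimately have "((\<lambda>s. h s (x s)) \<longlongrightarrow> l - l') (at_right t)" by (rule Lim_transform_eventually)
    then show "\<exists>l. ((\<lambda>s. h s (x s)) \<longlongrightarrow> l) (at_right t)" by blast
  qed
  moreover have "ks_integrable N (\<lambda>s. f s (x s)) g t0 t \<and>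
      x t = x0 - h t0 (x t0) + h t (x t) + ks_integral N (\<lambda>s. f s (x s)) g t0 t" if t: "t \<in> {t0..b}" for t
  proof -
    have t': "t0 \<le> t" "t \<le> b" using t by auto
    have I: "has_ks_integral N (\<lambda>s. f s (x s)) g t0 t (y t - y t0)"
      by (rule int[OF prim order_refl t'])
    have "ks_integral N (\<lambda>s. f s (x s)) g t0 t = y t - (x0 - h t0 x0)"
      using ks_integral_eqI[OF N t'(1) I] y(1) by (simp add: c_def)
    then have "x t = x0 - h t0 (x t0) + h t (x t) + ks_integral N (\<lambda>s. f s (x s)) g t0 t"
      using hx[OF t] x_t0 by simp
    then show ?thesis using I unfolding ks_integrable_def by blast
  qed
  ultimately have "is_solution N t0 a g x0 f h x"
    using x_t0 unfolding is_solution_def b_def[symmetric] by blast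
  then show ?thesis by blast
qed

end
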